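(* If a virtual knot $K$ is classical, then $QD_T(K)=0$ for every finite quandle $T$, where $QD_T(K)=|\mathrm{Hom}(U,T)|-|\mathrm{Hom}(L,T)|$ with $U$ the upper quandle and $L$ the lower quandle of $K$.
   Context: A quandle is a set $Q$ with an operation $\triangleright:Q\times Q\to Q$ such that (i) $a\triangleright a=a$ for all $a$; (ii) for all $a,b\in Q$ there is a unique $c\in Q$ with $a=c\triangleright b$; (iii) $(a\triangleright b)\triangleright c=(a\triangleright c)\triangleright(b\triangleright c)$ for all $a,b,c$. Quandle homomorphisms are maps preserving $\triangleright$; $\mathrm{Hom}(Q,T)$ is the set of quandle homomorphisms $Q\to T$. A (signed, oriented, one-component) Gauss code is a finite cyclic word, possibly empty, in which each crossing label $X$ occurring in it appears exactly twice, once as an overcrossing $OX^{\varepsilon}$ and once as an undercrossing $UX^{\varepsilon}$, with the same sign $\varepsilon\in\{+,-\}$. Codes are taken up to cyclic permutation and renaming of labels. Virtual isotopy is the equivalence relation on Gauss codes generated by the Reidemeister moves: (I) insert or delete two cyclically adjacent letters $OX^{\varepsilon}UX^{\varepsilon}$ or $UX^{\varepsilon}OX^{\varepsilon}$; (II) insert or delete two crossings $X,Y$ of opposite signs $\varepsilon,-\varepsilon$ such that $OX,OY$ occupy adjacent positions and $UX,UY$ occupy adjacent positions (in either order in each pair); (III) if there are three distinct crossings $A,B,C$ such that $\{OA,OB\}$ (top strand), $\{UA,OC\}$ (middle strand) and $\{UB,UC\}$ (bottom strand) each occupy two adjacent positions, simultaneously transpose the two letters in each of the three pairs, provided the configuration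 is one arising from a planar oriented Reidemeister III move. Explicitly, with $\varepsilon_A,\varepsilon_B,\varepsilon_C\in\{\pm1\}$ the crossing signs and with $\sigma_t=+1$ if $A$ precedes $B$ on the top strand, $\sigma_m=+1$ if $A$ precedes $C$ on the middle strand, $\sigma_b=+1$ if $B$ precedes $C$ on the bottom strand (and $-1$ otherwise), the requirement is $\sigma_t\sigma_m\varepsilon_A=\sigma_t\sigma_b\varepsilon_B=\sigma_m\sigma_b\varepsilon_C$. A virtual knot is an equivalence class of Gauss codes under virtual isotopy. A Gauss code is realizable if it is the Gauss code of an oriented planar knot diagram (all crossings being classical crossings recorded in the code). A virtual knot is classical if its equivalence class contains a realizable Gauss code. Upper quandle $U$: cut the cyclic word at each undercrossing letter to obtain arcs; these are the generators (if there are no crossings there is one generator and no relation). For each crossing $X$, let $x_i$ and $x_{i+1}$ be the arcs immediately before and after $UX$, and let $y$ be the arc containing $OX$. Impose the relation $x_i\triangleright y=x_{i+1}$ if $X$ has sign $+$, and $x_{i+1}\triangleright y=x_i$ if $X$ has sign $-$. $U$ is the quandle presented in this way. Lower quandle $L$: the upper quandle of the Gauss code obtained by replacing every $OX^{\varepsilon}$ by $UX^{\varepsilon}$ and vice versa, keeping signs. Up to isomorphism $U$ and $L$ depend only on the virtual knot. *)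

theory Defs
  imports "HOL-Analysis.Analysis"
begin

section \<open>Quandles\<close>

record 'a quandle_struct =
  qcarrier :: "'a set"
  qop :: "'a \<Rightarrow> 'a \<Rightarrow> 'a"

definition quandle :: "'a quandle_struct \<Rightarrow> bool" where
  "quandle Q \<longleftrightarrow>
     (\<forall>a\<in>qcarrier Q. \<forall>b\<in>qcarrier Q. qop Q a b \<in> qcarrier Q) \<and>
     (\<forall>a\<in>qcarrier Q. qop Q a a = a) \<and>
     (\<forall>a\<in>qcarrier Q. \<forall>b\<in>qcarrier Q. \<exists>!c. c \<in> qcarrier Q \<and> a = qop Q c b) \<and>
     (\<forall>a\<in>qcarrier Q. \<forall>b\<in>qcarrier Q. \<forall>c\<in>qcarrier Q.
        qop Q (qop Q a b) c = qop Q (qop Q a c) (qop Q b c))"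

definition finite_quandle :: "'a quandle_struct \<Rightarrow> bool" where
  "finite_quandle Q \<longleftrightarrow> quandle Q \<and> finite (qcarrier Q)"

text \<open>Homomorphisms are taken to be extensional, so that \<open>Hom Q T\<close> contains each map between
  the carriers exactly once and can be counted.\<close>

definition Hom :: "'a quandle_struct \<Rightarrow> 'b quandle_struct \<Rightarrow> ('a \<Rightarrow> 'b) set" where
  "Hom Q T = {h \<in> qcarrier Q \<rightarrow>\<^sub>E qcarrier T.
     \<forall>a\<in>qcarrier Q. \<forall>b\<in>qcarrier Q. h (qop Q a b) = qop T (h a) (h b)}"

subsection \<open>Presentations\<close>

text \<open>Quandles form an equational class once the solution \<open>c\<close> of \<open>a = c \<triangleright> b\<close> is made a second
  operation, here \<open>QInv a b\<close>. The quandle presented by generators \<open>G\<close> and relations \<open>R\<close> is the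
  algebra of terms over \<open>G\<close> modulo the congruence generated by the quandle laws and \<open>R\<close>.\<close>

datatype 'g qterm = Gen 'g | QOp "'g qterm" "'g qterm" | QInv "'g qterm" "'g qterm"

definition qterms :: "'g set \<Rightarrow> 'g qterm set" where
  "qterms G = {t. set_qterm t \<subseteq> G}"

inductive qcong :: "'g set \<Rightarrow> ('g qterm \<times> 'g qterm) set \<Rightarrow> 'g qterm \<Rightarrow> 'g qterm \<Rightarrow> bool"
  for G R where
  qcong_refl: "s \<in> qterms G \<Longrightarrow> qcong G R s s"
| qcong_sym: "qcong G R s t \<Longrightarrow> qcong G R t s"
| qcong_trans: "qcong G R s t \<Longrightarrow> qcong G R t u \<Longrightarrow> qcong G R s u"
| qcong_op: "qcong G R s s' \<Longrightarrow> qcong G R t t' \<Longrightarrow> qcong G R (QOp s t) (QOp s' t')"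
| qcong_inv: "qcong G R s s' \<Longrightarrow> qcong G R t t' \<Longrightarrow> qcong G R (QInv s t) (QInv s' t')"
| qcong_idem: "s \<in> qterms G \<Longrightarrow> qcong G R (QOp s s) s"
| qcong_inv_op: "s \<in> qterms G \<Longrightarrow> t \<in> qterms G \<Longrightarrow> qcong G R (QInv (QOp s t) t) s"
| qcong_op_inv: "s \<in> qterms G \<Longrightarrow> t \<in> qterms G \<Longrightarrow> qcong G R (QOp (QInv s t) t) s"
| qcong_dist: "s \<in> qterms G \<Longrightarrow> t \<in> qterms G \<Longrightarrow> u \<in> qterms G \<Longrightarrow>
    qcong G R (QOp (QOp s t) u) (QOp (QOp s u) (QOp t u))"
| qcong_rel: "(s, t) \<in> R \<Longrightarrow> s \<in> qterms G \<Longrightarrow> t \<in> qterms G \<Longrightarrow> qcong G R s t"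

definition qcong_set :: "'g set \<Rightarrow> ('g qterm \<times> 'g qterm) set \<Rightarrow> ('g qterm \<times> 'g qterm) set" where
  "qcong_set G R = {(s, t). s \<in> qterms G \<and> t \<in> qterms G \<and> qcong G R s t}"

definition presented_quandle ::
    "'g set \<Rightarrow> ('g qterm \<times> 'g qterm) set \<Rightarrow> 'g qterm set quandle_struct" where
  "presented_quandle G R =
     \<lparr>qcarrier = qterms G // qcong_set G R,
      qop = (\<lambda>A B. \<Union>a\<in>A. \<Union>b\<in>B. qcong_set G R `` {QOp a b})\<rparr>"

section \<open>Gauss codes and virtual knots\<close>

text \<open>A cyclic word is represented by a list; cyclic permutation is one of the steps generating
  virtual isotopy below, as is renaming of labels. Signs are the integers \<open>1\<close> and \<open>-1\<close>.\<close>

datatype 'l letter = Over (label: 'l) (lsign: int) | Under (label: 'l) (lsign: int)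

fun is_over :: "'l letter \<Rightarrow> bool" where
  "is_over (Over _ _) \<longleftrightarrow> True"
| "is_over (Under _ _) \<longleftrightarrow> False"

fun swap_letter :: "'l letter \<Rightarrow> 'l letter" where
  "swap_letter (Over X e) = Under X e"
| "swap_letter (Under X e) = Over X e"

type_synonym code = "nat letter list"

definition gauss_code :: "code \<Rightarrow> bool" where
  "gauss_code w \<longleftrightarrow>
     (\<forall>X \<in> label ` set w. \<exists>e \<in> {1, -1}.
        mset (filter (\<lambda>l. label l = X) w) = {#Over X e, Under X e#})"

definition swap_next :: "code \<Rightarrow> nat \<Rightarrow> code" where
  "swap_next w i = (let j = Suc i mod length w in w[i := w ! j, j := w ! i])"

definition adjacent_at :: "code \<Rightarrow> nat \<Rightarrow> nat letter \<Rightarrow> nat letter \<Rightarrow> bool" where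
  "adjacent_at w i l m \<longleftrightarrow>
     i < length w \<and> {w ! i, w ! (Suc i mod length w)} = {l, m}"

text \<open>Moves I and II are stated as deletions; insertions are obtained by symmetric closure. Because
  of \<open>rotate\<close>, their adjacent pairs may be assumed not to wrap around the end of the list and, in
  move II, the overcrossing pair may be assumed to come first. In move III, \<open>a\<close>, \<open>b\<close>, \<open>c\<close> are the
  crossing signs and \<open>s\<^sub>t\<close>, \<open>s\<^sub>m\<close>, \<open>s\<^sub>b\<close> record the orders in which the top, middle and
  bottom strands meet their two crossings.\<close>

inductive move :: "code \<Rightarrow> code \<Rightarrow> bool" where
  rotate: "gauss_code w \<Longrightarrow> move w (rotate1 w)"
| rename: "gauss_code w \<Longrightarrow> inj_on p (label ` set w) \<Longrightarrow> move w (map (map_letter p) w)"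
| RI_over_under: "gauss_code (u @ [Over X e, Under X e] @ v) \<Longrightarrow>
    move (u @ [Over X e, Under X e] @ v) (u @ v)"
| RI_under_over: "gauss_code (u @ [Under X e, Over X e] @ v) \<Longrightarrow>
    move (u @ [Under X e, Over X e] @ v) (u @ v)"
| RII: "gauss_code (u @ p @ v @ q @ z) \<Longrightarrow>
    mset p = {#Over X e, Over Y (- e)#} \<Longrightarrow> mset q = {#Under X e, Under Y (- e)#} \<Longrightarrow>
    move (u @ p @ v @ q @ z) (u @ v @ z)"
| RIII: "gauss_code w \<Longrightarrow> distinct [A, B, C] \<Longrightarrow>
    adjacent_at w i (Over A a) (Over B b) \<Longrightarrow>
    adjacent_at w j (Under A a) (Over C c) \<Longrightarrow>
    adjacent_at w k (Under B b) (Under C c) \<Longrightarrow>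
    s\<^sub>t = (if w ! i = Over A a then 1 else -1) \<Longrightarrow>
    s\<^sub>m = (if w ! j = Under A a then 1 else -1) \<Longrightarrow>
    s\<^sub>b = (if w ! k = Under B b then 1 else -1) \<Longrightarrow>
    s\<^sub>t * s\<^sub>m * a = s\<^sub>t * s\<^sub>b * b \<Longrightarrow> s\<^sub>t * s\<^sub>b * b = s\<^sub>m * s\<^sub>b * c \<Longrightarrow>
    move w (swap_next (swap_next (swap_next w i) j) k)"

definition virtual_isotopy :: "(code \<times> code) set" where
  "virtual_isotopy = {(v, w). gauss_code v \<and> gauss_code w \<and> equivclp move v w}"

definition virtual_knots :: "code set set" where
  "virtual_knots = {w. gauss_code w} // virtual_isotopy"

section \<open>Planar diagrams and classical knots\<close>

text \<open>The plane is \<^typ>\<open>complex\<close> with its usual orientation.\<close>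

definition plane_det :: "complex \<Rightarrow> complex \<Rightarrow> real" where
  "plane_det z w = Re z * Im w - Im z * Re w"

definition velocity :: "(real \<Rightarrow> complex) \<Rightarrow> real \<Rightarrow> complex" where
  "velocity f t = vector_derivative f (at t)"

text \<open>The parameters in one period at which the closed curve \<open>f\<close> passes through a double point.\<close>

definition double_params :: "(real \<Rightarrow> complex) \<Rightarrow> real set" where
  "double_params f = {t \<in> {0..<1}. \<exists>s \<in> {0..<1}. s \<noteq> t \<and> f s = f t}"

text \<open>A generic immersed closed curve, oriented by its parameter: finitely many multiple points,
  each of them a transverse double point.\<close>

definition generic_closed_curve :: "(real \<Rightarrow> complex) \<Rightarrow> bool" where
  "generic_closed_curve f \<longleftrightarrow>
     f C1_differentiable_on UNIV \<and>
     (\<forall>t. f (t + 1) = f t) \<and>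
     (\<forall>t. velocity f t \<noteq> 0) \<and>
     finite (double_params f) \<and>
     (\<forall>r\<in>{0..<1}. \<forall>s\<in>{0..<1}. \<forall>t\<in>{0..<1}. f r = f s \<and> f s = f t \<longrightarrow> r = s \<or> s = t \<or> r = t) \<and>
     (\<forall>s\<in>{0..<1}. \<forall>t\<in>{0..<1}. s \<noteq> t \<and> f s = f t \<longrightarrow>
        plane_det (velocity f s) (velocity f t) \<noteq> 0)"

text \<open>The second component of a diagram is the set of parameters of the overpasses: exactly one of
  the two passes through each double point.\<close>

definition knot_diagram :: "(real \<Rightarrow> complex) \<Rightarrow> real set \<Rightarrow> bool" where
  "knot_diagram f Ov \<longleftrightarrow>
     generic_closed_curve f \<and> Ov \<subseteq> double_params f \<and>
     (\<forall>s\<in>{0..<1}. \<forall>t\<in>{0..<1}. s \<noteq> t \<and> f s = f t \<longrightarrow> (s \<in> Ov \<longleftrightarrow> t \<notin> Ov))"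

text \<open>Reading off the code along the curve, starting at parameter 0. A crossing is positive iff
  the direction of the overpass followed by that of the underpass is a positively oriented basis.\<close>

definition gauss_code_of :: "(real \<Rightarrow> complex) \<Rightarrow> real set \<Rightarrow> code \<Rightarrow> bool" where
  "gauss_code_of f Ov w \<longleftrightarrow>
     (let ts = sorted_list_of_set (double_params f) in
       length w = length ts \<and>
       (\<forall>i < length w. is_over (w ! i) \<longleftrightarrow> ts ! i \<in> Ov) \<and>
       (\<forall>i < length w. \<forall>j < length w. label (w ! i) = label (w ! j) \<longleftrightarrow> f (ts ! i) = f (ts ! j)) \<and>
       (\<forall>i < length w. \<forall>j < length w.
          f (ts ! i) = f (ts ! j) \<and> ts ! i \<in> Ov \<and> ts ! j \<notin> Ov \<longrightarrow>
            real_of_int (lsign (w ! i)) =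
              sgn (plane_det (velocity f (ts ! i)) (velocity f (ts ! j))) \<and>
            lsign (w ! j) = lsign (w ! i)))"

definition realizable :: "code \<Rightarrow> bool" where
  "realizable w \<longleftrightarrow> (\<exists>f Ov. knot_diagram f Ov \<and> gauss_code_of f Ov w)"

definition classical :: "code set \<Rightarrow> bool" where
  "classical K \<longleftrightarrow> (\<exists>w\<in>K. realizable w)"

section \<open>Upper and lower quandles\<close>

text \<open>Arcs are numbered in the order in which they are met, starting with the one containing the
  beginning of the list: \<open>arc_at w p\<close> is the arc just before position \<open>p\<close>, obtained by counting
  undercrossings before \<open>p\<close>. The count is reduced modulo the number of crossings since the first and
  the last part of the list belong to the same arc. If there are no crossings, there is one arc.\<close>

definition num_under :: "code \<Rightarrow> nat" where
  "num_under w = length (filter (\<lambda>l. \<not> is_over l) w)"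

definition arcs :: "code \<Rightarrow> nat set" where
  "arcs w = {..< max 1 (num_under w)}"

definition arc_at :: "code \<Rightarrow> nat \<Rightarrow> nat" where
  "arc_at w p = num_under (take p w) mod num_under w"

definition upper_relations :: "code \<Rightarrow> (nat qterm \<times> nat qterm) set" where
  "upper_relations w =
     {(QOp (Gen (arc_at w p)) (Gen (arc_at w q)), Gen (arc_at w (Suc p))) | p q X.
        p < length w \<and> q < length w \<and> w ! p = Under X 1 \<and> w ! q = Over X 1} \<union>
     {(QOp (Gen (arc_at w (Suc p))) (Gen (arc_at w q)), Gen (arc_at w p)) | p q X.
        p < length w \<and> q < length w \<and> w ! p = Under X (-1) \<and> w ! q = Over X (-1)}"

definition upper_quandle :: "code \<Rightarrow> nat qterm set quandle_struct" where
  "upper_quandle w = presented_quandle (arcs w) (upper_relations w)"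

definition lower_quandle :: "code \<Rightarrow> nat qterm set quandle_struct" where
  "lower_quandle w = upper_quandle (map swap_letter w)"

definition QD :: "'b quandle_struct \<Rightarrow> code \<Rightarrow> int" where
  "QD T w = int (card (Hom (upper_quandle w) T)) - int (card (Hom (lower_quandle w) T))"

end

theory Submission
  imports Defs
begin

text \<open>
  Counting homomorphisms amounts to counting colourings of the code by \<open>T\<close>, and both the upper and
  the lower count are invariant under the moves, so it suffices to compare them on a realizable code.
  There, an upper colouring \<open>C\<close> determines an automorphism \<open>\<phi>\<close> of \<open>T\<close> for every face of the diagram:
  crossing the curve from left to right at a point coloured \<open>c\<close> composes \<open>\<phi>\<close> with the right translation
  by \<open>c\<close>. The colouring rule says that this prescription is consistent around each crossing, and then
  it is globally consistent because the plane is simply connected. (In terms of the knot group, \<open>\<phi>\<close> is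
  the action of a loop that descends from a base point above the diagram through the face and returns
  around the outside.) The values \<open>\<phi> c\<close> on the two sides of an edge agree since \<open>c \<triangleright> c = c\<close>, and they
  form a lower colouring. Its own faces carry \<open>\<phi>\<close> inverted, so \<open>C\<close> can be recovered from it. Hence
  there are at least as many lower as upper colourings; the reflected diagram gives the converse.
\<close>

section \<open>Curves and charts\<close>

text \<open>No face, path or loop occurs as an object. A labelling of faces is a function on the
  plane that is locally constant off the curve, and the curve is seen only through charts around its
  points; this suits a curve that is merely C1. Jumps are composed on the right, so two solutions of
  one jump problem differ by a left factor without jump. Such a factor is constant on every
  connected open set, although the complement of the curve falls apart into faces. Hence local
  solutions can be glued whenever their overlap is connected, and bisection of a square around the
  curve takes the place of an argument with loops. Fixing the value at one point \<open>z0\<close>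
  removes the left factor; without this, the recovery of \<open>C\<close> would be possible only up
  to an automorphism. Consistency around a crossing is the identity \<open>rtrans y \<circ> rtrans x
  = rtrans (x \<triangleright> y) \<circ> rtrans y\<close>, that is, self-distributivity. The moves
  act on words and know nothing of arcs. For them a colouring is described by the colours of the
  overpasses and a walk along the word, so that a move has to be checked only on the short subwords
  that it alters.\<close>

text \<open>If \<open>g\<close> and \<open>k\<close> are curves crossing transversely at \<open>p = g 0 = k 0\<close>, this map straightens both of
  them at once: near 0 it is a homeomorphism that takes the coordinate axes to \<open>g\<close> and \<open>k\<close>.\<close>

definition chart :: "(real \<Rightarrow> complex) \<Rightarrow> (real \<Rightarrow> complex) \<Rightarrow> complex \<Rightarrow> complex \<Rightarrow> complex" where
  "chart g k p z = g (Re z) + k (Im z) - p"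

section \<open>Straightening two transverse curves\<close>

lemma chart_has_derivative:
  assumes "(g has_vector_derivative a) (at (Re z))" "(k has_vector_derivative b) (at (Im z))"
  shows "(chart g k p has_derivative (\<lambda>v. Re v *\<^sub>R a + Im v *\<^sub>R b)) (at z)"
proof -
  have "((\<lambda>z. g (Re z)) has_derivative (\<lambda>v. Re v *\<^sub>R a)) (at z)"
    using has_derivative_compose[of Re Re z UNIV g "\<lambda>x. x *\<^sub>R a"] assms(1) has_derivative_Re[OF has_derivative_ident]
    unfolding has_vector_derivative_def by blast
  moreover have "((\<lambda>z. k (Im z)) has_derivative (\<lambda>v. Im v *\<^sub>R b)) (at z)"
    using has_derivative_compose[of Im Im z UNIV k "\<lambda>x. x *\<^sub>R b"] assms(2) has_derivative_Im[OF has_derivative_ident]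
    unfolding has_vector_derivative_def by blast
  ultimately show ?thesis
    unfolding chart_def[abs_def] by (auto intro!: derivative_eq_intros)
qed

lemma plane_det_add: "plane_det (a + b) c = plane_det a c + plane_det b c"
    "plane_det a (b + c) = plane_det a b + plane_det a c"
  and plane_det_scaleR: "plane_det (x *\<^sub>R a) c = x * plane_det a c"
    "plane_det a (x *\<^sub>R c) = x * plane_det a c"
  by (simp_all add: plane_det_def algebra_simps)

text \<open>Cramer's rule: coordinates with respect to the basis \<open>a\<close>, \<open>b\<close>
  are quotients of determinants. Both compositions are recorded because local injectivity asks for a
  left inverse of the derivative, and differentiating the inverse chart for a right inverse.\<close>

lemma plane_det_solve:
  assumes "plane_det a b \<noteq> 0"
  shows "(\<lambda>v. Re v *\<^sub>R a + Im v *\<^sub>R b) \<circ>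
         (\<lambda>v. Complex (plane_det v b / plane_det a b) (plane_det a v / plane_det a b)) = id"
    and "(\<lambda>v. Complex (plane_det v b / plane_det a b) (plane_det a v / plane_det a b)) \<circ>
         (\<lambda>v. Re v *\<^sub>R a + Im v *\<^sub>R b) = id"
proof -
  have *: "x * d / d = x" if "d \<noteq> 0" for x d :: real
    using that by simp
  show "(\<lambda>v. Re v *\<^sub>R a + Im v *\<^sub>R b) \<circ>
         (\<lambda>v. Complex (plane_det v b / plane_det a b) (plane_det a v / plane_det a b)) = id"
  proof
    fix v
    have 1: "plane_det v b * Re a + plane_det a v * Re b = Re v * plane_det a b"
      and 2: "plane_det v b * Im a + plane_det a v * Im b = Im v * plane_det a b"
      by (simp_all add: plane_det_def algebra_simps)
    have "Re a * (plane_det v b / plane_det a b) + Re b * (plane_det a v / plane_det a b) = Re v"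
      using assms 1 by (simp add: field_simps)
    moreover have "Im a * (plane_det v b / plane_det a b) + Im b * (plane_det a v / plane_det a b) = Im v"
      using assms 2 by (simp add: field_simps)
    ultimately show "((\<lambda>v. Re v *\<^sub>R a + Im v *\<^sub>R b) \<circ>
         (\<lambda>v. Complex (plane_det v b / plane_det a b) (plane_det a v / plane_det a b))) v = id v"
      by (simp add: complex_eq_iff mult.commute)
  qed
  show "(\<lambda>v. Complex (plane_det v b / plane_det a b) (plane_det a v / plane_det a b)) \<circ>
         (\<lambda>v. Re v *\<^sub>R a + Im v *\<^sub>R b) = id"
  proof
    fix v
    have 1: "plane_det (Re v *\<^sub>R a + Im v *\<^sub>R b) b = Re v * plane_det a b"
      and 2: "plane_det a (Re v *\<^sub>R a + Im v *\<^sub>R b) = Im v * plane_det a b"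
      by (simp_all add: plane_det_def algebra_simps)
    show "((\<lambda>v. Complex (plane_det v b / plane_det a b) (plane_det a v / plane_det a b)) \<circ>
         (\<lambda>v. Re v *\<^sub>R a + Im v *\<^sub>R b)) v = id v"
      unfolding o_def 1 2 using assms by (simp add: complex_eq_iff)
  qed
qed

text \<open>The second curve is left general: it will be another strand at a double point and a
  straight normal line at a simple point.\<close>

locale crossing_curves =
  fixes g k Dg Dk :: "real \<Rightarrow> complex" and p :: complex
  assumes g_deriv: "\<And>t. (g has_vector_derivative Dg t) (at t)"
    and k_deriv: "\<And>t. (k has_vector_derivative Dk t) (at t)"
    and Dg_cont: "continuous_on UNIV Dg" and Dk_cont: "continuous_on UNIV Dk"
    and g_0: "g 0 = p" and k_0: "k 0 = p"
begin

lemma chart_real: "chart g k p (of_real s) = g s"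
  by (simp add: chart_def k_0)

lemma chart_imag: "chart g k p (\<i> * of_real u) = k u"
  by (simp add: chart_def g_0)

lemma chart_deriv: "(chart g k p has_derivative (\<lambda>v. Re v *\<^sub>R Dg (Re z) + Im v *\<^sub>R Dk (Im z))) (at z)"
  by (rule chart_has_derivative[OF g_deriv k_deriv])

lemma continuous_on_chart: "continuous_on S (chart g k p)"
  by (meson chart_deriv continuous_at_imp_continuous_on has_derivative_continuous)

text \<open>The derivative of the chart at \<open>z\<close> has columns \<open>Dg (Re z)\<close> and
  \<open>Dk (Im z)\<close>, so it is continuous, and it is invertible at 0. The determinant is kept
  positive for all small parameters because the two sides of a strand must be told apart at every
  point of the axes, not only at \<open>p\<close>.\<close>

lemma chart_locally_injective:
  assumes "plane_det (Dg 0) (Dk 0) > 0"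
  obtains r where "r > 0" "inj_on (chart g k p) (ball 0 r)"
    "\<And>s u. \<bar>s\<bar> < r \<Longrightarrow> \<bar>u\<bar> < r \<Longrightarrow> plane_det (Dg s) (Dk u) > 0"
proof -
  let ?d = "plane_det (Dg 0) (Dk 0)"
  let ?g' = "\<lambda>v. Complex (plane_det v (Dk 0) / ?d) (plane_det (Dg 0) v / ?d)"
  have lin: "bounded_linear ?g'"
  proof -
    have "linear ?g'"
      by (rule linearI) (simp_all add: plane_det_add plane_det_scaleR complex_eq_iff add_divide_distrib)
    then show ?thesis using linear_conv_bounded_linear by blast
  qed
  have cg: "isCont (\<lambda>z. Dg (Re z)) z" and ck: "isCont (\<lambda>z. Dk (Im z)) z" for z
    using continuous_on_compose2[OF Dg_cont continuous_on_Re[OF continuous_on_id[of UNIV]]]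
      continuous_on_compose2[OF Dk_cont continuous_on_Im[OF continuous_on_id[of UNIV]]]
    by (auto simp: continuous_on_eq_continuous_at)
  have cont: "\<exists>d>0. \<forall>x. dist 0 x < d \<longrightarrow>
      onorm (\<lambda>v. (Re v *\<^sub>R Dg (Re x) + Im v *\<^sub>R Dk (Im x)) - (Re v *\<^sub>R Dg (Re 0) + Im v *\<^sub>R Dk (Im 0))) < e"
    if e: "e > 0" for e
  proof -
    have cz: "isCont (\<lambda>x. cmod (Dg (Re x) - Dg 0) + cmod (Dk (Im x) - Dk 0)) 0"
      by (intro continuous_intros cg ck)
    define F where "F = (\<lambda>x. cmod (Dg (Re x) - Dg 0) + cmod (Dk (Im x) - Dk 0))"
    have "isCont F 0" "F 0 = 0" unfolding F_def using cz by simp_all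
    then obtain d where d0: "d > 0" "\<And>x. dist x 0 < d \<Longrightarrow> dist (F x) 0 < e"
      using e unfolding continuous_at_eps_delta by metis
    have d: "d > 0" "\<And>x. dist x 0 < d \<Longrightarrow> F x < e"
      using d0 by (auto simp: dist_real_def abs_less_iff)
    show ?thesis
    proof (intro exI conjI allI impI)
      show "d > 0" by fact
      fix x :: complex assume "dist 0 x < d"
      then have lt: "cmod (Dg (Re x) - Dg 0) + cmod (Dk (Im x) - Dk 0) < e"
        using d(2)[of x] by (simp add: dist_commute F_def)
      have "onorm (\<lambda>v. (Re v *\<^sub>R Dg (Re x) + Im v *\<^sub>R Dk (Im x)) - (Re v *\<^sub>R Dg (Re 0) + Im v *\<^sub>R Dk (Im 0)))
         \<le> cmod (Dg (Re x) - Dg 0) + cmod (Dk (Im x) - Dk 0)"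
      proof (rule onorm_le)
        fix v :: complex
        have "(Re v *\<^sub>R Dg (Re x) + Im v *\<^sub>R Dk (Im x)) - (Re v *\<^sub>R Dg (Re 0) + Im v *\<^sub>R Dk (Im 0))
          = Re v *\<^sub>R (Dg (Re x) - Dg 0) + Im v *\<^sub>R (Dk (Im x) - Dk 0)"
          by (simp add: algebra_simps)
        also have "cmod \<dots> \<le> \<bar>Re v\<bar> * cmod (Dg (Re x) - Dg 0) + \<bar>Im v\<bar> * cmod (Dk (Im x) - Dk 0)"
          by (metis norm_scaleR norm_triangle_ineq)
        also have "\<dots> \<le> cmod v * cmod (Dg (Re x) - Dg 0) + cmod v * cmod (Dk (Im x) - Dk 0)"
          by (intro add_mono mult_right_mono abs_Re_le_cmod abs_Im_le_cmod) auto
        finally show "cmod ((Re v *\<^sub>R Dg (Re x) + Im v *\<^sub>R Dk (Im x)) - (Re v *\<^sub>R Dg (Re 0) + Im v *\<^sub>R Dk (Im 0)))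
          \<le> (cmod (Dg (Re x) - Dg 0) + cmod (Dk (Im x) - Dk 0)) * cmod v"
          by (simp add: algebra_simps)
      qed
      then show "onorm (\<lambda>v. (Re v *\<^sub>R Dg (Re x) + Im v *\<^sub>R Dk (Im x)) - (Re v *\<^sub>R Dg (Re 0) + Im v *\<^sub>R Dk (Im 0))) < e"
        using lt by linarith
    qed
  qed
  obtain r1 where r1: "r1 > 0" "inj_on (chart g k p) (ball 0 r1)"
  proof (rule has_derivative_locally_injective[of 0 UNIV ?g'
        "\<lambda>z v. Re v *\<^sub>R Dg (Re z) + Im v *\<^sub>R Dk (Im z)" "chart g k p"])
    show "?g' \<circ> (\<lambda>v. Re v *\<^sub>R Dg (Re 0) + Im v *\<^sub>R Dk (Im 0)) = id"
      using plane_det_solve(2)[of "Dg 0" "Dk 0"] assms by simp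
  qed (use lin chart_deriv cont in auto)
  have "isCont (\<lambda>z. plane_det (Dg (Re z)) (Dk (Im z))) 0"
    unfolding plane_det_def by (intro continuous_intros isCont_Re isCont_Im cg ck)
  then have "\<forall>\<^sub>F z in at 0. plane_det (Dg (Re z)) (Dk (Im z)) > 0"
    using assms order_tendstoD(1) unfolding isCont_def by fastforce
  then have "\<forall>\<^sub>F z in nhds 0. plane_det (Dg (Re z)) (Dk (Im z)) > 0"
    using assms by (simp add: eventually_nhds_conv_at)
  then obtain r2 where r2: "r2 > 0"
    "\<And>z. dist z 0 < r2 \<Longrightarrow> plane_det (Dg (Re z)) (Dk (Im z)) > 0"
    unfolding eventually_nhds_metric by blast
  \<comment> \<open>Halving \<open>r2\<close> turns bounds on the two coordinates into a bound on
    \<open>cmod (Complex s u)\<close>.\<close>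
  have "plane_det (Dg s) (Dk u) > 0" if "\<bar>s\<bar> < r2 / 2" "\<bar>u\<bar> < r2 / 2" for s u
  proof -
    have "cmod (Complex s u) < r2"
      using cmod_le[of "Complex s u"] that by simp
    then show ?thesis using r2(2)[of "Complex s u"] by simp
  qed
  then show thesis
    using that[of "min r1 (r2 / 2)"] r1(1) r2(1) inj_on_subset[OF r1(2) subset_ball[of "min r1 (r2 / 2)" r1 0]]
    by auto
qed

text \<open>The inverse of the chart is differentiable at \<open>g s\<close>. In direction
  \<open>w\<close> its imaginary part has derivative \<open>plane_det (Dg s) w\<close> divided by
  \<open>plane_det (Dg s) (Dk 0)\<close>, which is positive, so a short step along \<open>w\<close>
  leads into the upper half of the chart.\<close>

lemma chart_side:
  assumes inj: "inj_on (chart g k p) (ball 0 r)" and s: "\<bar>s\<bar> < r"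
    and det: "plane_det (Dg s) (Dk 0) > 0" and w: "plane_det (Dg s) w > 0"
  shows "\<forall>\<^sub>F \<epsilon> in at_right 0. g s + of_real \<epsilon> * w \<in> chart g k p ` (ball 0 r \<inter> {z. Im z > 0})"
    and "\<forall>\<^sub>F \<epsilon> in at_right 0. g s - of_real \<epsilon> * w \<in> chart g k p ` (ball 0 r \<inter> {z. Im z < 0})"
proof -
  let ?h = "chart g k p" and ?B = "ball 0 r :: complex set"
  define m where "m = inv_into ?B ?h"
  let ?d = "plane_det (Dg s) (Dk 0)"
  let ?g' = "\<lambda>v. Complex (plane_det v (Dk 0) / ?d) (plane_det (Dg s) v / ?d)"
  have sB: "of_real s \<in> ?B" using s by simp
  have hs: "?h (of_real s) = g s" by (rule chart_real)
  have "(m has_derivative ?g') (at (?h (of_real s)))"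
  proof (rule has_derivative_inverse_strong[of ?B "of_real s" ?h m])
    show "m (?h x) = x" if "x \<in> ?B" for x
      using that inj by (simp add: m_def)
    show "(?h has_derivative (\<lambda>v. Re v *\<^sub>R Dg (Re (of_real s)) + Im v *\<^sub>R Dk (Im (of_real s)))) (at (of_real s))"
      by (rule chart_deriv)
    show "(\<lambda>v. Re v *\<^sub>R Dg (Re (of_real s)) + Im v *\<^sub>R Dk (Im (of_real s))) \<circ> ?g' = id"
      using plane_det_solve(1)[of "Dg s" "Dk 0"] det by simp
  qed (use sB continuous_on_chart in auto)
  then have md: "(m has_derivative ?g') (at (g s))" by (simp add: hs)
  have mg: "m (g s) = of_real s"
    using inv_into_f_f[OF inj sB] by (simp add: m_def hs)
  have opn: "open (?h ` ?B)"
    using invariance_of_domain continuous_on_chart inj by blast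
  have gin: "g s \<in> ?h ` ?B" using sB hs by (metis imageI)
  \<comment> \<open>One computation serves both sides: the second claim is the case
    \<open>\<sigma> = -1\<close> with \<open>v = - w\<close>.\<close>
  have main: "\<forall>\<^sub>F \<epsilon> in at_right 0. g s + of_real \<epsilon> * v \<in> ?h ` (?B \<inter> {z. \<sigma> * Im z > 0})"
    if pos: "\<sigma> * plane_det (Dg s) v > 0" for v :: complex and \<sigma> :: real
  proof -
    define F where "F = (\<lambda>\<epsilon>::real. \<sigma> * Im (m (g s + of_real \<epsilon> * v)))"
    have l: "((\<lambda>\<epsilon>::real. g s + of_real \<epsilon> * v) has_derivative (\<lambda>\<epsilon>. of_real \<epsilon> * v)) (at 0)"
      by (auto intro!: derivative_eq_intros)
    have "((\<lambda>\<epsilon>::real. m (g s + of_real \<epsilon> * v)) has_derivative (\<lambda>\<epsilon>. ?g' (of_real \<epsilon> * v))) (at 0)"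
      using has_derivative_compose[OF l, of m ?g'] md by simp
    from has_derivative_mult_right[OF has_derivative_Im[OF this], of \<sigma>]
    have "(F has_derivative (\<lambda>\<epsilon>. \<sigma> * Im (?g' (of_real \<epsilon> * v)))) (at 0)"
      unfolding F_def .
    moreover have "(\<lambda>\<epsilon>::real. \<sigma> * Im (?g' (of_real \<epsilon> * v))) = (\<lambda>\<epsilon>. (\<sigma> * plane_det (Dg s) v / ?d) * \<epsilon>)"
      by (auto simp: plane_det_def field_simps)
    ultimately have "(F has_real_derivative (\<sigma> * plane_det (Dg s) v / ?d)) (at 0)"
      unfolding has_field_derivative_def by argo
    moreover have "\<sigma> * plane_det (Dg s) v / ?d > 0" using pos det by simp
    ultimately obtain \<delta> where \<delta>: "\<delta> > 0" "\<And>\<epsilon>. 0 < \<epsilon> \<Longrightarrow> \<epsilon> < \<delta> \<Longrightarrow> F 0 < F (0 + \<epsilon>)"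
      using DERIV_pos_inc_right[of F] by blast
    have F0: "F 0 = 0" by (simp add: F_def mg)
    have 1: "\<forall>\<^sub>F \<epsilon> in at_right 0. F \<epsilon> > 0"
      unfolding eventually_at_right_field using \<delta> F0 by (intro exI[of _ \<delta>]) auto
    have "((\<lambda>\<epsilon>::real. g s + of_real \<epsilon> * v) \<longlongrightarrow> g s + of_real 0 * v) (at_right 0)"
      by (intro tendsto_intros)
    then have 2: "\<forall>\<^sub>F \<epsilon> in at_right 0. g s + of_real \<epsilon> * v \<in> ?h ` ?B"
      using topological_tendstoD[OF _ opn] gin by simp
    show ?thesis
      using 1 2
    proof eventually_elim
      case (elim \<epsilon>)
      then obtain z where z: "z \<in> ?B" "g s + of_real \<epsilon> * v = ?h z" by blast
      then have "m (?h z) = z" using inj by (simp add: m_def)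
      then have "\<sigma> * Im z > 0" using elim(1) z(2) by (simp add: F_def)
      then show ?case using z by blast
    qed
  qed
  show "\<forall>\<^sub>F \<epsilon> in at_right 0. g s + of_real \<epsilon> * w \<in> ?h ` (?B \<inter> {z. Im z > 0})"
    using main[of 1 w] w by simp
  have "(-1) * plane_det (Dg s) (- w) > 0" using w by (simp add: plane_det_def)
  from main[OF this] show "\<forall>\<^sub>F \<epsilon> in at_right 0. g s - of_real \<epsilon> * w \<in> ?h ` (?B \<inter> {z. Im z < 0})"
    by simp
qed

end

text \<open>A quarter turn of the chart exchanges the two curves. Reversing \<open>g\<close> at the
  same time preserves the determinant of the velocities, so results about the sides of the first
  curve carry over to the second.\<close>

lemma crossing_curves_rotate:
  assumes "crossing_curves g k Dg Dk p"
  shows "crossing_curves k (\<lambda>t. g (- t)) Dk (\<lambda>t. - Dg (- t)) p"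
proof -
  interpret crossing_curves g k Dg Dk p by fact
  have "((\<lambda>t. g (- t)) has_vector_derivative - Dg (- t)) (at t)" for t
  proof -
    have "(uminus has_vector_derivative (-1 :: real)) (at t)"
      by (auto intro!: derivative_eq_intros)
    from vector_diff_chain_at[OF this g_deriv] show ?thesis by (simp add: o_def)
  qed
  then show ?thesis
    using k_deriv Dk_cont Dg_cont g_0 k_0
    by unfold_locales
      (auto intro!: continuous_intros continuous_on_compose2[of UNIV Dg])
qed

lemma chart_rotate: "chart k (\<lambda>t. g (- t)) p z = chart g k p (\<i> * z)"
  by (simp add: chart_def)

lemma image_ball_rotate: "(*) \<i> ` (ball 0 r \<inter> {z. P z}) = ball 0 r \<inter> {z. P (- \<i> * z)}"
proof (rule set_eqI, rule iffI)
  fix z assume "z \<in> ball 0 r \<inter> {z. P (- \<i> * z)}"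
  then have "z = \<i> * (- \<i> * z)" "- \<i> * z \<in> ball 0 r \<inter> {z. P z}"
    by (auto simp: norm_mult)
  then show "z \<in> (*) \<i> ` (ball 0 r \<inter> {z. P z})" by blast
qed (auto simp: norm_mult)

text \<open>This is \<open>chart_side\<close> after a quarter turn: the left of the imaginary axis,
  traversed upwards, is where the real part is negative.\<close>

lemma (in crossing_curves) chart_side_imag:
  assumes inj: "inj_on (chart g k p) (ball 0 r)" and u: "\<bar>u\<bar> < r"
    and det: "plane_det (Dg 0) (Dk u) > 0" and w: "plane_det (Dk u) w > 0"
  shows "\<forall>\<^sub>F \<epsilon> in at_right 0. k u + of_real \<epsilon> * w \<in> chart g k p ` (ball 0 r \<inter> {z. Re z < 0})"
    and "\<forall>\<^sub>F \<epsilon> in at_right 0. k u - of_real \<epsilon> * w \<in> chart g k p ` (ball 0 r \<inter> {z. Re z > 0})"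
proof -
  interpret rot: crossing_curves k "\<lambda>t. g (- t)" Dk "\<lambda>t. - Dg (- t)" p
    by (rule crossing_curves_rotate) unfold_locales
  have ch: "chart k (\<lambda>t. g (- t)) p = chart g k p \<circ> (*) \<i>"
    by (auto simp: chart_rotate)
  have "inj_on (chart g k p) ((*) \<i> ` ball 0 r)"
    using inj image_ball_rotate[of r "\<lambda>_. True"] by simp
  then have inj': "inj_on (chart k (\<lambda>t. g (- t)) p) (ball 0 r)"
    unfolding ch by (intro comp_inj_on) (auto simp: inj_on_def)
  have det': "plane_det (Dk u) (- Dg (- 0)) > 0"
    using det by (simp add: plane_det_def algebra_simps)
  have im: "(chart g k p \<circ> (*) \<i>) ` (ball 0 r \<inter> {z. Im z > 0}) = chart g k p ` (ball 0 r \<inter> {z. Re z < 0})"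
    "(chart g k p \<circ> (*) \<i>) ` (ball 0 r \<inter> {z. Im z < 0}) = chart g k p ` (ball 0 r \<inter> {z. Re z > 0})"
    unfolding image_comp[symmetric] image_ball_rotate by simp_all
  show "\<forall>\<^sub>F \<epsilon> in at_right 0. k u + of_real \<epsilon> * w \<in> chart g k p ` (ball 0 r \<inter> {z. Re z < 0})"
    "\<forall>\<^sub>F \<epsilon> in at_right 0. k u - of_real \<epsilon> * w \<in> chart g k p ` (ball 0 r \<inter> {z. Re z > 0})"
    using rot.chart_side[OF inj' u det' w] unfolding ch im by auto
qed

section \<open>Generic closed curves: parameters modulo the period, sides, and charts\<close>

locale generic_curve =
  fixes f :: "real \<Rightarrow> complex"
  assumes generic: "generic_closed_curve f"
begin

lemma f_deriv: "(f has_vector_derivative velocity f t) (at t)"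
  using generic unfolding generic_closed_curve_def C1_differentiable_on_eq velocity_def
  by (simp add: vector_derivative_works)

lemma velocity_continuous: "continuous_on UNIV (velocity f)"
  using generic unfolding generic_closed_curve_def C1_differentiable_on_eq velocity_def[abs_def]
  by simp

lemma f_continuous: "continuous_on S f"
  by (meson f_deriv continuous_at_imp_continuous_on has_vector_derivative_continuous)

lemma velocity_nonzero: "velocity f t \<noteq> 0"
  using generic by (simp add: generic_closed_curve_def)

lemma velocity_left: "plane_det (velocity f t) (\<i> * velocity f t) > 0"
proof -
  have "plane_det (velocity f t) (\<i> * velocity f t) = (cmod (velocity f t))\<^sup>2"
    unfolding cmod_power2 by (simp add: plane_det_def power2_eq_square)
  then show ?thesis using velocity_nonzero by simp
qed

lemma f_periodic_nat: "f (t + of_nat n) = f t"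
proof (induction n)
  case (Suc n)
  have "f ((t + of_nat n) + 1) = f (t + of_nat n)"
    using generic by (simp add: generic_closed_curve_def)
  then show ?case using Suc by (simp add: algebra_simps)
qed simp

lemma f_periodic: 
  assumes "k \<in> \<int>"
  shows "f (t + k) = f t"
proof -
  obtain j where k: "k = of_int j" using assms Ints_cases by blast
  show ?thesis
  proof (cases "j \<ge> 0")
    case True
    then show ?thesis using f_periodic_nat[of t "nat j"] k by simp
  next
    case False
    then show ?thesis using f_periodic_nat[of "t + k" "nat (- j)"] k by simp
  qed
qed

lemma f_eq_mod:
  assumes "s - t \<in> \<int>"
  shows "f s = f t"
  using f_periodic[OF assms, of t] by simp

lemma velocity_periodic:
  assumes "s - t \<in> \<int>"
  shows "velocity f s = velocity f t"
proof -
  define k where "k = s - t"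
  have sh: "((\<lambda>x. x + k) has_vector_derivative 1) (at t)"
    by (auto intro!: derivative_eq_intros)
  have "((f \<circ> (\<lambda>x. x + k)) has_vector_derivative 1 *\<^sub>R velocity f (t + k)) (at t)"
    by (rule vector_diff_chain_at[OF sh f_deriv])
  moreover have "f \<circ> (\<lambda>x. x + k) = f"
    using f_periodic assms by (auto simp: k_def)
  ultimately have "(f has_vector_derivative velocity f s) (at t)"
    by (simp add: k_def)
  then show ?thesis
    unfolding velocity_def using vector_derivative_at by metis
qed

definition simple :: "real \<Rightarrow> bool" where
  "simple t \<longleftrightarrow> (\<forall>s. f s = f t \<longrightarrow> s - t \<in> \<int>)"

lemma frac_diff_Ints: "frac t - (t::real) \<in> \<int>" "t - frac t \<in> \<int>"
  by (simp_all add: frac_def)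

lemma frac_mem: "frac (t::real) \<in> {0..<1}"
  by (simp add: frac_ge_0 frac_lt_1)

lemma f_frac: "f (frac t) = f t"
  by (rule f_eq_mod[OF frac_diff_Ints(1)])

lemma Ints_diff_trans: "(a::real) - b \<in> \<int> \<Longrightarrow> b - c \<in> \<int> \<Longrightarrow> a - c \<in> \<int>"
  using Ints_add[of "a - b" "b - c"] by simp

lemma Ints_diff_commute: "(a::real) - b \<in> \<int> \<Longrightarrow> b - a \<in> \<int>"
  using Ints_minus[of "a - b"] by simp

lemma frac_eq_Ints: "frac s = frac (t::real) \<longleftrightarrow> s - t \<in> \<int>"
proof
  assume "frac s = frac t"
  then show "s - t \<in> \<int>"
    using Ints_diff_trans[OF frac_diff_Ints(2)[of s], of t] frac_diff_Ints(1)[of t] by simp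
next
  assume "s - t \<in> \<int>"
  then obtain k :: int where "s = t + of_int k"
    by (metis Ints_cases add.commute diff_add_cancel)
  then show "frac s = frac t" by (simp add: frac_def)
qed

text \<open>Genericity is stated for parameters in one period; \<open>frac\<close> extends it to all
  real parameters, equality being replaced by an integral difference.\<close>

lemma triple:
  assumes "f r = f s" "f s = f t" "r - s \<notin> \<int>" "s - t \<notin> \<int>"
  shows "r - t \<in> \<int>"
proof -
  have "f (frac r) = f (frac s)" "f (frac s) = f (frac t)"
    using assms(1,2) by (simp_all add: f_frac)
  then have "frac r = frac s \<or> frac s = frac t \<or> frac r = frac t"
    using generic frac_mem unfolding generic_closed_curve_def by blast
  then show ?thesis using assms(3,4) by (simp add: frac_eq_Ints)
qed

lemma double_transverse:
  assumes "f s = f t" "s - t \<notin> \<int>"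
  shows "plane_det (velocity f s) (velocity f t) \<noteq> 0"
proof -
  have "f (frac s) = f (frac t)" "frac s \<noteq> frac t"
    using assms by (simp_all add: f_frac frac_eq_Ints)
  then have "plane_det (velocity f (frac s)) (velocity f (frac t)) \<noteq> 0"
    using generic frac_mem unfolding generic_closed_curve_def by blast
  then show ?thesis
    by (simp add: velocity_periodic[OF frac_diff_Ints(1)])
qed

lemma simple_iff_double_params: "simple t \<longleftrightarrow> frac t \<notin> double_params f"
proof -
  have "frac t \<in> double_params f \<longleftrightarrow> (\<exists>s\<in>{0..<1}. s \<noteq> frac t \<and> f s = f t)"
    using frac_mem[of t] by (simp add: double_params_def f_frac del: atLeastLessThan_iff)
  also have "\<dots> \<longleftrightarrow> (\<exists>s. frac s \<noteq> frac t \<and> f s = f t)"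
    by (metis f_frac frac_mem frac_eq atLeastLessThan_iff)
  finally show ?thesis unfolding simple_def by (auto simp: frac_eq_Ints)
qed

lemma range_compact: "compact (range f)"
proof -
  have "range f = f ` {0..1}"
  proof
    show "range f \<subseteq> f ` {0..1}"
    proof
      fix z assume "z \<in> range f"
      then obtain t where "z = f (frac t)" by (auto simp: f_frac)
      then show "z \<in> f ` {0..1}" using frac_mem[of t] by auto
    qed
  qed auto
  then show ?thesis using f_continuous compact_continuous_image compact_Icc by metis
qed

text \<open>Parameters in \<open>{0..1}\<close> that stay at distance \<open>r\<close> from the
  whole fibre over \<open>p\<close> form a compact set. Its image is compact and misses
  \<open>p\<close>, so the complement of the image serves as \<open>N\<close>. Other parameters are
  reduced to this case by an integral shift, which also shifts the fibre.\<close>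

lemma nearby_params:
  assumes "r > 0"
  obtains N where "open N" "p \<in> N" "\<And>t. f t \<in> N \<Longrightarrow> \<exists>\<tau>. f \<tau> = p \<and> \<bar>t - \<tau>\<bar> < r"
proof -
  define K where "K = {0..1} \<inter> (\<Inter>\<tau>\<in>{\<tau>. f \<tau> = p}. {t. r \<le> \<bar>t - \<tau>\<bar>})"
  have "closed (\<Inter>\<tau>\<in>{\<tau>. f \<tau> = p}. {t. r \<le> \<bar>t - \<tau>\<bar>})"
    by (intro closed_INT ballI closed_Collect_le continuous_intros)
  then have "compact K" unfolding K_def by (intro compact_Int_closed) auto
  then have "compact (f ` K)" using f_continuous compact_continuous_image by blast
  then have "open (- (f ` K))" by (simp add: compact_imp_closed open_Compl)
  moreover have "p \<in> - (f ` K)"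
  proof
    assume "p \<in> f ` K"
    then obtain x where "x \<in> K" "f x = p" by blast
    then have "r \<le> \<bar>x - x\<bar>" unfolding K_def by blast
    then show False using assms by simp
  qed
  moreover have "\<exists>\<tau>. f \<tau> = p \<and> \<bar>t - \<tau>\<bar> < r" if "f t \<in> - (f ` K)" for t
  proof -
    have "frac t \<notin> K" using that f_frac[of t] by (metis ComplD imageI)
    then obtain \<tau> where \<tau>: "f \<tau> = p" "\<bar>frac t - \<tau>\<bar> < r"
      using frac_mem[of t] unfolding K_def by force
    have "f (\<tau> + (t - frac t)) = p" using \<tau>(1) f_periodic[OF frac_diff_Ints(2)] by simp
    then show ?thesis
      using \<tau>(2) by (intro exI[of _ "\<tau> + (t - frac t)"]) simp
  qed
  ultimately show thesis using that by blast
qed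

text \<open>A differentiable curve is a null set in the plane, and a nonempty open set is
  not.\<close>

lemma dense_complement:
  assumes "open U" "U \<noteq> {}"
  shows "U - range f \<noteq> {}"
proof -
  have "f differentiable_on UNIV"
    using f_deriv by (auto simp: differentiable_on_def has_vector_derivative_def differentiable_def)
  then have "negligible (range f)"
    by (intro negligible_differentiable_image_lowdim) auto
  moreover have "\<not> negligible U" using assms open_not_negligible by blast
  ultimately show ?thesis by (metis Diff_eq_empty_iff negligible_subset)
qed

text \<open>The left and the right side of the curve are approached along the normal \<open>\<i> * velocity f t\<close>.\<close>

definition on_left :: "real \<Rightarrow> complex set \<Rightarrow> bool" where
  "on_left t S \<longleftrightarrow> (\<forall>\<^sub>F \<epsilon> in at_right 0. f t + of_real \<epsilon> * (\<i> * velocity f t) \<in> S)"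

definition on_right :: "real \<Rightarrow> complex set \<Rightarrow> bool" where
  "on_right t S \<longleftrightarrow> (\<forall>\<^sub>F \<epsilon> in at_right 0. f t - of_real \<epsilon> * (\<i> * velocity f t) \<in> S)"

lemma on_left_Int: "on_left t S \<Longrightarrow> on_left t S' \<Longrightarrow> on_left t (S \<inter> S')"
  and on_right_Int: "on_right t S \<Longrightarrow> on_right t S' \<Longrightarrow> on_right t (S \<inter> S')"
  unfolding on_left_def on_right_def by (auto elim: eventually_elim2)

lemma on_left_mono: "on_left t S \<Longrightarrow> S \<subseteq> S' \<Longrightarrow> on_left t S'"
  and on_right_mono: "on_right t S \<Longrightarrow> S \<subseteq> S' \<Longrightarrow> on_right t S'"
  unfolding on_left_def on_right_def by (auto elim: eventually_mono)

lemma on_left_ex: "on_left t S \<Longrightarrow> \<exists>z. z \<in> S"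
  and on_right_ex: "on_right t S \<Longrightarrow> \<exists>z. z \<in> S"
  unfolding on_left_def on_right_def
  by (auto dest!: eventually_happens simp: trivial_limit_at_right_real)

lemma on_left_open: "open S \<Longrightarrow> f t \<in> S \<Longrightarrow> on_left t S"
  and on_right_open: "open S \<Longrightarrow> f t \<in> S \<Longrightarrow> on_right t S"
proof -
  assume S: "open S" "f t \<in> S"
  have "((\<lambda>\<epsilon>::real. f t + of_real \<epsilon> * (\<i> * velocity f t)) \<longlongrightarrow> f t + of_real 0 * (\<i> * velocity f t)) (at_right 0)"
    by (intro tendsto_intros)
  then show "on_left t S" unfolding on_left_def using topological_tendstoD[OF _ S(1)] S(2) by simp
  have "((\<lambda>\<epsilon>::real. f t - of_real \<epsilon> * (\<i> * velocity f t)) \<longlongrightarrow> f t - of_real 0 * (\<i> * velocity f t)) (at_right 0)"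
    by (intro tendsto_intros)
  then show "on_right t S" unfolding on_right_def using topological_tendstoD[OF _ S(1)] S(2) by simp
qed

lemma on_left_periodic: "s - t \<in> \<int> \<Longrightarrow> on_left s S \<longleftrightarrow> on_left t S"
  and on_right_periodic: "s - t \<in> \<int> \<Longrightarrow> on_right s S \<longleftrightarrow> on_right t S"
  unfolding on_left_def on_right_def using f_eq_mod[of s t] velocity_periodic[of s t] by auto

lemma simple_periodic: "s - t \<in> \<int> \<Longrightarrow> simple s \<longleftrightarrow> simple t"
  by (metis frac_eq_Ints simple_iff_double_params)

lemma strand_deriv: "((\<lambda>s. f (t + s)) has_vector_derivative velocity f (t + s)) (at s)"
proof -
  have "((\<lambda>x. t + x) has_vector_derivative 1) (at s)"
    by (auto intro!: derivative_eq_intros)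
  from vector_diff_chain_at[OF this f_deriv] show ?thesis by (simp add: o_def)
qed

lemma strand_continuous: "continuous_on UNIV (\<lambda>s. velocity f (t + s))"
  by (intro continuous_on_compose2[OF velocity_continuous] continuous_intros) auto

text \<open>The same \<open>r\<close> bounds points and parameters because the curve itself
  parametrises the real axis of the chart. The clause on all \<open>t\<close> excludes passages of
  the curve through the image other than the strand at \<open>t0\<close>.\<close>

definition is_simple_chart :: "real \<Rightarrow> real \<Rightarrow> (complex \<Rightarrow> complex) \<Rightarrow> bool" where
  "is_simple_chart t0 r h \<longleftrightarrow> continuous_on UNIV h \<and> inj_on h (ball 0 r) \<and>
    (\<forall>z. z \<in> ball 0 r \<longrightarrow> (h z \<in> range f \<longleftrightarrow> Im z = 0)) \<and>
    (\<forall>t. f t \<in> h ` ball 0 r \<longrightarrow> (\<exists>s. \<bar>s\<bar> < r \<and> t - (t0 + s) \<in> \<int>)) \<and>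
    (\<forall>s. \<bar>s\<bar> < r \<longrightarrow> f (t0 + s) \<in> h ` ball 0 r \<and> simple (t0 + s) \<and>
       on_left (t0 + s) (h ` (ball 0 r \<inter> {z. Im z > 0})) \<and>
       on_right (t0 + s) (h ` (ball 0 r \<inter> {z. Im z < 0})))"

text \<open>The strand through \<open>t0\<close> is the real axis and the one through
  \<open>t1\<close> the imaginary axis. The sign of \<open>s\<close> distinguishes the incoming from
  the outgoing half of a strand, so \<open>s * Re z > 0\<close> selects the half plane around the
  half-strand that contains the point with parameter \<open>s\<close>.\<close>

definition is_double_chart :: "real \<Rightarrow> real \<Rightarrow> real \<Rightarrow> (complex \<Rightarrow> complex) \<Rightarrow> bool" where
  "is_double_chart t0 t1 r h \<longleftrightarrow> continuous_on UNIV h \<and> inj_on h (ball 0 r) \<and> h 0 = f t0 \<and>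
    (\<forall>z. z \<in> ball 0 r \<longrightarrow> (h z \<in> range f \<longleftrightarrow> Re z = 0 \<or> Im z = 0)) \<and>
    (\<forall>t. f t \<in> h ` ball 0 r \<longrightarrow> (\<exists>s. \<bar>s\<bar> < r \<and> (t - (t0 + s) \<in> \<int> \<or> t - (t1 + s) \<in> \<int>))) \<and>
    (\<forall>s. \<bar>s\<bar> < r \<and> s \<noteq> 0 \<longrightarrow>
       f (t0 + s) \<in> h ` ball 0 r \<and> simple (t0 + s) \<and>
       on_left (t0 + s) (h ` (ball 0 r \<inter> {z. s * Re z > 0 \<and> Im z > 0})) \<and>
       on_right (t0 + s) (h ` (ball 0 r \<inter> {z. s * Re z > 0 \<and> Im z < 0}))) \<and>
    (\<forall>s. \<bar>s\<bar> < r \<and> s \<noteq> 0 \<longrightarrow>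
       f (t1 + s) \<in> h ` ball 0 r \<and> simple (t1 + s) \<and>
       on_left (t1 + s) (h ` (ball 0 r \<inter> {z. Re z < 0 \<and> s * Im z > 0})) \<and>
       on_right (t1 + s) (h ` (ball 0 r \<inter> {z. Re z > 0 \<and> s * Im z > 0})))"

text \<open>Only one strand is present, so the second curve of the chart is the normal line at
  \<open>t0\<close>. The radius \<open>r0\<close> gives injectivity, \<open>r1\<close> limits how
  far parameters may be from the fibre over \<open>f t0\<close>, and \<open>r2\<close> keeps the
  image inside \<open>U\<close> and the neighbourhood \<open>N\<close> in which this limit is
  guaranteed.\<close>

lemma simple_chart:
  assumes t0: "simple t0" and U: "open U" "f t0 \<in> U" and \<rho>: "\<rho> > 0"
  obtains r h where "0 < r" "r \<le> \<rho>" "h ` ball 0 r \<subseteq> U" "is_simple_chart t0 r h"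
proof -
  define g where "g = (\<lambda>s. f (t0 + s))"
  define Dg where "Dg = (\<lambda>s. velocity f (t0 + s))"
  define w where "w = \<i> * velocity f t0"
  define k where "k = (\<lambda>u. f t0 + of_real u * w)"
  have k: "(k has_vector_derivative w) (at u)" for u
    unfolding k_def has_vector_derivative_def
    by (auto intro!: derivative_eq_intros simp: scaleR_conv_of_real)
  interpret crossing_curves g k Dg "\<lambda>_. w" "f t0"
    using strand_deriv strand_continuous k
    by unfold_locales (auto simp: g_def Dg_def k_def)
  define h where "h = chart g k (f t0)"
  have hcont: "continuous_on UNIV h" unfolding h_def by (rule continuous_on_chart)
  have "plane_det (Dg 0) w > 0" using velocity_left by (simp add: Dg_def w_def)
  then obtain r0 where r0: "r0 > 0" "inj_on h (ball 0 r0)"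
    "\<And>s u. \<bar>s\<bar> < r0 \<Longrightarrow> \<bar>u\<bar> < r0 \<Longrightarrow> plane_det (Dg s) w > 0"
    unfolding h_def using chart_locally_injective by blast
  define r1 where "r1 = min r0 \<rho>"
  have "r1 > 0" using r0(1) \<rho> by (simp add: r1_def)
  then obtain N where N: "open N" "f t0 \<in> N" "\<And>t. f t \<in> N \<Longrightarrow> \<exists>\<tau>. f \<tau> = f t0 \<and> \<bar>t - \<tau>\<bar> < r1"
    using nearby_params[of r1 "f t0"] by metis
  have h0: "h 0 = f t0" using chart_real[of 0] by (simp add: h_def g_def)
  have "open (h -` (U \<inter> N))"
    using hcont U(1) N(1) by (simp add: continuous_on_open_vimage open_Int)
  moreover have "0 \<in> h -` (U \<inter> N)" using h0 U(2) N(2) by simp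
  ultimately obtain r2 where r2: "r2 > 0" "ball 0 r2 \<subseteq> h -` (U \<inter> N)"
    using open_contains_ball by metis
  define r where "r = min r1 r2"
  have r: "0 < r" "r \<le> \<rho>" "r \<le> r0" "r \<le> r1" "r \<le> r2"
    using \<open>r1 > 0\<close> r2(1) by (auto simp: r_def r1_def)
  have inj: "inj_on h (ball 0 r)" using r0(2) r(3) by (meson inj_on_subset subset_ball)
  have hUN: "h ` ball 0 r \<subseteq> U \<inter> N" using r2(2) r(5) by (force simp: subset_iff)
  have hs: "h (of_real s) = f (t0 + s)" for s
    using chart_real[of s] by (simp add: h_def g_def)
  \<comment> \<open>The parameter found by \<open>nearby_params\<close> gives a point
    \<open>of_real s\<close> in the larger ball of radius \<open>r0\<close> only. Injectivity there
    identifies it with \<open>z\<close>, and this puts it into the smaller ball.\<close>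
  have key: "\<exists>s. \<bar>s\<bar> < r \<and> t - (t0 + s) \<in> \<int> \<and> z = of_real s" if "z \<in> ball 0 r" "f t = h z" for t z
  proof -
    have "f t \<in> N" using that hUN by auto
    then obtain \<tau> where \<tau>: "f \<tau> = f t0" "\<bar>t - \<tau>\<bar> < r1" using N(3) by blast
    define s where "s = t - \<tau>"
    have d: "\<tau> - t0 \<in> \<int>" using t0 \<tau>(1) by (simp add: simple_def)
    then have ts: "t - (t0 + s) \<in> \<int>" by (simp add: s_def)
    then have "h z = h (of_real s)" using f_eq_mod[OF ts] that(2) hs by simp
    moreover have "\<bar>s\<bar> < r0" using \<tau>(2) by (simp add: s_def r1_def)
    then have "of_real s \<in> ball (0::complex) r0" by simp
    moreover have "z \<in> ball 0 r0" using that(1) r(3) by simp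
    ultimately have "z = of_real s" using r0(2) by (meson inj_onD)
    then show ?thesis using ts that(1) by auto
  qed
  have realb: "of_real s \<in> ball (0::complex) r" if "\<bar>s\<bar> < r" for s using that by simp
  have side: "plane_det (Dg s) (\<i> * velocity f (t0 + s)) > 0" for s
    unfolding Dg_def by (rule velocity_left)
  have "is_simple_chart t0 r h"
    unfolding is_simple_chart_def
  proof (intro conjI allI impI)
    show "h z \<in> range f \<longleftrightarrow> Im z = 0" if "z \<in> ball 0 r" for z
    proof
      assume "h z \<in> range f"
      then obtain t where t: "f t = h z" by auto
      show "Im z = 0" using key[OF that t] by auto
    next
      assume "Im z = 0"
      then have "z = of_real (Re z)" by (simp add: complex_eq_iff)
      then show "h z \<in> range f" using hs by (metis rangeI)
    qed
    show "\<exists>s. \<bar>s\<bar> < r \<and> t - (t0 + s) \<in> \<int>" if "f t \<in> h ` ball 0 r" for t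
      using that key by fastforce
    show "f (t0 + s) \<in> h ` ball 0 r" if "\<bar>s\<bar> < r" for s
      using realb[OF that] hs by (metis imageI)
    show "simple (t0 + s)" if "\<bar>s\<bar> < r" for s
      unfolding simple_def using key[OF realb[OF that]] hs by force
    show "on_left (t0 + s) (h ` (ball 0 r \<inter> {z. Im z > 0}))" if "\<bar>s\<bar> < r" for s
      using chart_side(1)[of r s "\<i> * velocity f (t0 + s)"] inj that r0(3)[of s 0] r side
      by (simp add: on_left_def g_def h_def)
    show "on_right (t0 + s) (h ` (ball 0 r \<inter> {z. Im z < 0}))" if "\<bar>s\<bar> < r" for s
      using chart_side(2)[of r s "\<i> * velocity f (t0 + s)"] inj that r0(3)[of s 0] r side
      by (simp add: on_right_def g_def h_def)
  qed (use hcont inj in auto)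
  then show thesis using that r hUN by blast
qed

text \<open>Here the second curve of the chart is the other strand, and positivity of the
  determinant decides which of the two strands becomes the real axis.\<close>

lemma double_chart:
  assumes eq: "f t1 = f t0" and ne: "t1 - t0 \<notin> \<int>"
    and det: "plane_det (velocity f t0) (velocity f t1) > 0"
    and U: "open U" "f t0 \<in> U" and \<rho>: "\<rho> > 0"
  obtains r h where "0 < r" "r \<le> \<rho>" "h ` ball 0 r \<subseteq> U" "is_double_chart t0 t1 r h"
proof -
  define g where "g = (\<lambda>s. f (t0 + s))"
  define Dg where "Dg = (\<lambda>s. velocity f (t0 + s))"
  define k where "k = (\<lambda>s. f (t1 + s))"
  define Dk where "Dk = (\<lambda>s. velocity f (t1 + s))"
  interpret crossing_curves g k Dg Dk "f t0"
    using strand_deriv strand_continuous eq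
    by unfold_locales (auto simp: g_def Dg_def k_def Dk_def)
  define h where "h = chart g k (f t0)"
  have hcont: "continuous_on UNIV h" unfolding h_def by (rule continuous_on_chart)
  have "plane_det (Dg 0) (Dk 0) > 0" using det by (simp add: Dg_def Dk_def)
  then obtain r0 where r0: "r0 > 0" "inj_on h (ball 0 r0)"
    "\<And>s u. \<bar>s\<bar> < r0 \<Longrightarrow> \<bar>u\<bar> < r0 \<Longrightarrow> plane_det (Dg s) (Dk u) > 0"
    unfolding h_def using chart_locally_injective by blast
  define r1 where "r1 = min r0 \<rho>"
  have "r1 > 0" using r0(1) \<rho> by (simp add: r1_def)
  then obtain N where N: "open N" "f t0 \<in> N" "\<And>t. f t \<in> N \<Longrightarrow> \<exists>\<tau>. f \<tau> = f t0 \<and> \<bar>t - \<tau>\<bar> < r1"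
    using nearby_params[of r1 "f t0"] by metis
  have h0: "h 0 = f t0" using chart_real[of 0] by (simp add: h_def g_def)
  have "open (h -` (U \<inter> N))"
    using hcont U(1) N(1) by (simp add: continuous_on_open_vimage open_Int)
  moreover have "0 \<in> h -` (U \<inter> N)" using h0 U(2) N(2) by simp
  ultimately obtain r2 where r2: "r2 > 0" "ball 0 r2 \<subseteq> h -` (U \<inter> N)"
    using open_contains_ball by metis
  define r where "r = min r1 r2"
  have r: "0 < r" "r \<le> \<rho>" "r \<le> r0" "r \<le> r1" "r \<le> r2"
    using \<open>r1 > 0\<close> r2(1) by (auto simp: r_def r1_def)
  have inj: "inj_on h (ball 0 r)" using r0(2) r(3) by (meson inj_on_subset subset_ball)
  have hUN: "h ` ball 0 r \<subseteq> U \<inter> N" using r2(2) r(5) by (force simp: subset_iff)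
  have hs: "h (of_real s) = f (t0 + s)" for s
    using chart_real[of s] by (simp add: h_def g_def)
  have hu: "h (\<i> * of_real s) = f (t1 + s)" for s
    using chart_imag[of s] by (simp add: h_def k_def)
  have realb: "of_real s \<in> ball (0::complex) a" "\<i> * of_real s \<in> ball (0::complex) a" if "\<bar>s\<bar> < a" for s a
    using that by (simp_all add: norm_mult)
  have key: "\<exists>s. \<bar>s\<bar> < r \<and> ((t - (t0 + s) \<in> \<int> \<and> z = of_real s) \<or> (t - (t1 + s) \<in> \<int> \<and> z = \<i> * of_real s))"
    if "z \<in> ball 0 r" "f t = h z" for t z
  proof -
    have "f t \<in> N" using that hUN by auto
    then obtain \<tau> where \<tau>: "f \<tau> = f t0" "\<bar>t - \<tau>\<bar> < r1" using N(3) by blast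
    define s where "s = t - \<tau>"
    have s0: "\<bar>s\<bar> < r0" using \<tau>(2) by (simp add: s_def r1_def)
    have z0: "z \<in> ball 0 r0" using that(1) r(3) by simp
    \<comment> \<open>Triple points are excluded, so the fibre over \<open>f t0\<close> consists of
      \<open>t0\<close> and \<open>t1\<close> up to integers.\<close>
    have "\<tau> - t0 \<in> \<int> \<or> \<tau> - t1 \<in> \<int>"
      using triple[of \<tau> t1 t0] \<tau>(1) eq ne by auto
    then show ?thesis
    proof
      assume "\<tau> - t0 \<in> \<int>"
      then have ts: "t - (t0 + s) \<in> \<int>" by (simp add: s_def)
      then have "h z = h (of_real s)" using f_eq_mod[OF ts] that(2) hs by simp
      then have "z = of_real s" using r0(2) z0 realb(1)[OF s0] by (meson inj_onD)
      then show ?thesis using ts that(1) by auto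
    next
      assume "\<tau> - t1 \<in> \<int>"
      then have ts: "t - (t1 + s) \<in> \<int>" by (simp add: s_def)
      then have "h z = h (\<i> * of_real s)" using f_eq_mod[OF ts] that(2) hu by simp
      then have "z = \<i> * of_real s" using r0(2) z0 realb(2)[OF s0] by (meson inj_onD)
      then show ?thesis using ts that(1) by (auto simp: norm_mult)
    qed
  qed
  have opn: "open (h ` (ball 0 r \<inter> S))" if "open S" for S
    using invariance_of_domain[of "ball 0 r \<inter> S" h] hcont inj that
    by (meson continuous_on_subset inj_on_subset inf_le1 open_Int open_ball subset_UNIV)
  have opnRe: "open {z. s * Re z > 0}" and opnIm: "open {z. s * Im z > 0}" for s
    by (intro open_Collect_less continuous_intros)+
  have quad: "h ` (ball 0 r \<inter> A) \<inter> h ` (ball 0 r \<inter> B) \<subseteq> h ` (ball 0 r \<inter> (A \<inter> B))" for A B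
    using inj by (auto simp: inj_on_def)
  have sideg: "plane_det (Dg s) (\<i> * velocity f (t0 + s)) > 0" for s
    unfolding Dg_def by (rule velocity_left)
  have sidek: "plane_det (Dk s) (\<i> * velocity f (t1 + s)) > 0" for s
    unfolding Dk_def by (rule velocity_left)
  \<comment> \<open>\<open>chart_side\<close> locates nearby points relative to their own strand
    only. That they also stay on one side of the other strand follows by openness: the point itself
    lies in the image of an open half plane bounded by that strand.\<close>
  have ReS: "f (t0 + s) \<in> h ` (ball 0 r \<inter> {z. s * Re z > 0})" if "\<bar>s\<bar> < r" "s \<noteq> 0" for s
    using realb(1)[OF that(1)] that(2) hs[of s] by (intro image_eqI[of _ _ "of_real s"]) (auto simp: zero_less_mult_iff)
  have ImS: "f (t1 + s) \<in> h ` (ball 0 r \<inter> {z. s * Im z > 0})" if "\<bar>s\<bar> < r" "s \<noteq> 0" for s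
    using realb(2)[OF that(1)] that(2) hu[of s] by (intro image_eqI[of _ _ "\<i> * of_real s"]) (auto simp: zero_less_mult_iff)
  have lg: "on_left (t0 + s) (h ` (ball 0 r \<inter> {z. Im z > 0}))"
    and rg: "on_right (t0 + s) (h ` (ball 0 r \<inter> {z. Im z < 0}))"
    and lk: "on_left (t1 + s) (h ` (ball 0 r \<inter> {z. Re z < 0}))"
    and rk: "on_right (t1 + s) (h ` (ball 0 r \<inter> {z. Re z > 0}))" if "\<bar>s\<bar> < r" for s
    using chart_side[of r s "\<i> * velocity f (t0 + s)"] chart_side_imag[of r s "\<i> * velocity f (t1 + s)"]
      inj that r0(3)[of s 0] r0(3)[of 0 s] r sideg sidek
    by (simp_all add: on_right_def on_left_def g_def k_def h_def)
  have "is_double_chart t0 t1 r h"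
    unfolding is_double_chart_def
  proof (intro conjI allI impI; (elim conjE)?)
    show "h z \<in> range f \<longleftrightarrow> Re z = 0 \<or> Im z = 0" if "z \<in> ball 0 r" for z
    proof
      assume "h z \<in> range f"
      then obtain t where t: "f t = h z" by auto
      show "Re z = 0 \<or> Im z = 0" using key[OF that t] by auto
    next
      assume "Re z = 0 \<or> Im z = 0"
      then have "z = of_real (Re z) \<or> z = \<i> * of_real (Im z)" by (auto simp: complex_eq_iff)
      then show "h z \<in> range f" using hs hu by (metis rangeI)
    qed
    show "\<exists>s. \<bar>s\<bar> < r \<and> (t - (t0 + s) \<in> \<int> \<or> t - (t1 + s) \<in> \<int>)" if "f t \<in> h ` ball 0 r" for t
      using that key by fastforce
    show "f (t0 + s) \<in> h ` ball 0 r" "f (t1 + s) \<in> h ` ball 0 r" if "\<bar>s\<bar> < r" "s \<noteq> 0" for s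
      using realb[OF that(1)] hs hu by (metis imageI)+
    show "simple (t0 + s)" if "\<bar>s\<bar> < r" "s \<noteq> 0" for s
      unfolding simple_def
    proof (intro allI impI)
      fix t assume "f t = f (t0 + s)"
      then have "f t = h (of_real s)" by (simp add: hs)
      from key[OF realb(1)[OF that(1)] this] show "t - (t0 + s) \<in> \<int>"
        using that(2) by (auto simp: complex_eq_iff)
    qed
    show "simple (t1 + s)" if "\<bar>s\<bar> < r" "s \<noteq> 0" for s
      unfolding simple_def
    proof (intro allI impI)
      fix t assume "f t = f (t1 + s)"
      then have "f t = h (\<i> * of_real s)" by (simp add: hu)
      from key[OF realb(2)[OF that(1)] this] show "t - (t1 + s) \<in> \<int>"
        using that(2) by (auto simp: complex_eq_iff)
    qed
    show "on_left (t0 + s) (h ` (ball 0 r \<inter> {z. s * Re z > 0 \<and> Im z > 0}))" if "\<bar>s\<bar> < r" "s \<noteq> 0" for s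
      using on_left_mono[OF on_left_Int[OF on_left_open[OF opn[OF opnRe] ReS[OF that]] lg[OF that(1)]] quad]
      by (simp add: Collect_conj_eq)
    show "on_right (t0 + s) (h ` (ball 0 r \<inter> {z. s * Re z > 0 \<and> Im z < 0}))" if "\<bar>s\<bar> < r" "s \<noteq> 0" for s
      using on_right_mono[OF on_right_Int[OF on_right_open[OF opn[OF opnRe] ReS[OF that]] rg[OF that(1)]] quad]
      by (simp add: Collect_conj_eq)
    show "on_left (t1 + s) (h ` (ball 0 r \<inter> {z. Re z < 0 \<and> s * Im z > 0}))" if "\<bar>s\<bar> < r" "s \<noteq> 0" for s
      using on_left_mono[OF on_left_Int[OF lk[OF that(1)] on_left_open[OF opn[OF opnIm] ImS[OF that]]] quad]
      by (simp add: Collect_conj_eq)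
    show "on_right (t1 + s) (h ` (ball 0 r \<inter> {z. Re z > 0 \<and> s * Im z > 0}))" if "\<bar>s\<bar> < r" "s \<noteq> 0" for s
      using on_right_mono[OF on_right_Int[OF rk[OF that(1)] on_right_open[OF opn[OF opnIm] ImS[OF that]]] quad]
      by (simp add: Collect_conj_eq)
  qed (use h0 hcont inj in auto)
  then show thesis using that r hUN by blast
qed

end

section \<open>Functions that are locally constant off the curve, and uniqueness across it\<close>

lemma connected_locally_constant:
  assumes "connected S" and loc: "\<And>z. z \<in> S \<Longrightarrow> \<forall>\<^sub>F z' in nhds z. Q z' = Q z"
    and "x \<in> S" "y \<in> S"
  shows "Q x = Q y"
proof (rule connected_induction_simple[OF assms(1,3,4), of "\<lambda>y. Q x = Q y"])
  fix a assume "a \<in> S"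
  then obtain T where T: "open T" "a \<in> T" "\<And>z. z \<in> T \<Longrightarrow> Q z = Q a"
    using loc[OF \<open>a \<in> S\<close>, unfolded eventually_nhds] by metis
  show "\<exists>T. openin (top_of_set S) T \<and> a \<in> T \<and> (\<forall>u\<in>T. \<forall>v\<in>T. Q x = Q u \<longrightarrow> Q x = Q v)"
  proof (intro exI[of _ "S \<inter> T"] conjI ballI impI)
    show "openin (top_of_set S) (S \<inter> T)" using T(1) by (rule openin_open_Int)
    show "a \<in> S \<inter> T" using T(2) \<open>a \<in> S\<close> by simp
    show "Q x = Q v" if "u \<in> S \<inter> T" "v \<in> S \<inter> T" "Q x = Q u" for u v
      using T(3)[of u] T(3)[of v] that by simp
  qed
qed simp

context generic_curve
begin

lemma range_closed: "closed (range f)"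
  using range_compact compact_imp_closed by blast

lemma simple_sides:
  assumes "simple t"
  shows "on_left t (- range f)" "on_right t (- range f)"
proof -
  obtain r h where h: "0 < r" "is_simple_chart t r h"
    using simple_chart[OF assms open_UNIV UNIV_I zero_less_one] by metis
  have s: "on_left t (h ` (ball 0 r \<inter> {z. Im z > 0}))" "on_right t (h ` (ball 0 r \<inter> {z. Im z < 0}))"
    using h by (auto simp: is_simple_chart_def dest: spec[of _ 0])
  have "h ` (ball 0 r \<inter> {z. Im z > 0}) \<subseteq> - range f" "h ` (ball 0 r \<inter> {z. Im z < 0}) \<subseteq> - range f"
    using h(2) unfolding is_simple_chart_def by fastforce+
  then show "on_left t (- range f)" "on_right t (- range f)"
    using on_left_mono[OF s(1)] on_right_mono[OF s(2)] by simp_all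
qed

definition locally_const :: "complex set \<Rightarrow> (complex \<Rightarrow> 'c) \<Rightarrow> bool" where
  "locally_const U Q \<longleftrightarrow> (\<forall>z\<in>U - range f. \<forall>\<^sub>F z' in nhds z. Q z' = Q z)"

text \<open>Double points carry no condition. The four quadrants around one are compared across the
  simple points next to it.\<close>

definition jump_free :: "complex set \<Rightarrow> (complex \<Rightarrow> 'c) \<Rightarrow> bool" where
  "jump_free U Q \<longleftrightarrow> locally_const U Q \<and>
     (\<forall>t. simple t \<and> f t \<in> U \<longrightarrow> (\<exists>q. on_left t {z. Q z = q} \<and> on_right t {z. Q z = q}))"

lemma locally_const_connected:
  assumes "locally_const U Q" "connected S" "S \<subseteq> U - range f"
  shows "\<exists>q. \<forall>z\<in>S. Q z = q"
proof (cases "S = {}")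
  case False
  then obtain x where x: "x \<in> S" by blast
  have "Q y = Q x" if "y \<in> S" for y
    using connected_locally_constant[OF assms(2) _ that x] assms(1,3)
    unfolding locally_const_def by blast
  then show ?thesis by blast
qed simp

lemma jump_free_sides:
  assumes Q: "jump_free U Q" and t: "simple t" "f t \<in> U"
    and S: "connected S" "S \<subseteq> U - range f" "on_left t S"
    and S': "connected S'" "S' \<subseteq> U - range f" "on_right t S'"
  shows "\<exists>q. \<forall>z\<in>S \<union> S'. Q z = q"
proof -
  have lc: "locally_const U Q" using Q by (simp add: jump_free_def)
  obtain q where q: "on_left t {z. Q z = q}" "on_right t {z. Q z = q}"
    using Q t unfolding jump_free_def by blast
  obtain a where a: "\<forall>z\<in>S. Q z = a" using locally_const_connected[OF lc S(1,2)] by blast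
  obtain b where b: "\<forall>z\<in>S'. Q z = b" using locally_const_connected[OF lc S'(1,2)] by blast
  have "a = q" using on_left_ex[OF on_left_Int[OF S(3) q(1)]] a by auto
  moreover have "b = q" using on_right_ex[OF on_right_Int[OF S'(3) q(2)]] b by auto
  ultimately show ?thesis using a b by blast
qed

text \<open>By transversality one of the two orders of the passages has positive determinant, so a
  single picture of a crossing suffices, whichever strand is the upper one.\<close>

lemma not_simpleE:
  assumes "\<not> simple t"
  obtains t0 t1 where "f t0 = f t" "f t1 = f t0" "t1 - t0 \<notin> \<int>"
    "plane_det (velocity f t0) (velocity f t1) > 0"
proof -
  obtain s where s: "f s = f t" "s - t \<notin> \<int>" using assms by (auto simp: simple_def)
  have "plane_det (velocity f s) (velocity f t) \<noteq> 0" by (rule double_transverse[OF s])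
  moreover have "plane_det (velocity f s) (velocity f t) = - plane_det (velocity f t) (velocity f s)"
    by (simp add: plane_det_def)
  ultimately consider "plane_det (velocity f s) (velocity f t) > 0" | "plane_det (velocity f t) (velocity f s) > 0"
    by linarith
  then show thesis
  proof cases
    case 1
    moreover have "t - s \<notin> \<int>" using s(2) Ints_diff_commute by blast
    ultimately show thesis using that[of s t] s by metis
  next
    case 2
    then show thesis using that[of t s] s by metis
  qed
qed

definition quadrant :: "(complex \<Rightarrow> complex) \<Rightarrow> real \<Rightarrow> real \<Rightarrow> real \<Rightarrow> complex set" where
  "quadrant h r a b = h ` (ball 0 r \<inter> {z. a * Re z > 0 \<and> b * Im z > 0})"

lemma quadrant_connected:
  assumes "continuous_on UNIV h"
  shows "connected (quadrant h r a b)"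
proof -
  have "{z. a * Re z > 0 \<and> b * Im z > 0} =
      {z. inner (of_real a) z > 0} \<inter> {z. inner (\<i> * of_real b) z > 0}"
    by (auto simp: inner_complex_def)
  then have "convex (ball 0 r \<inter> {z. a * Re z > 0 \<and> b * Im z > 0})"
    by (simp add: convex_Int convex_halfspace_gt)
  then show ?thesis
    using assms unfolding quadrant_def
    by (meson connected_continuous_image continuous_on_subset convex_connected subset_UNIV)
qed

lemma half_connected:
  assumes "continuous_on UNIV h"
  shows "connected (h ` (ball 0 r \<inter> {z. Im z > 0}))" "connected (h ` (ball 0 r \<inter> {z. Im z < 0}))"
  by (rule connected_continuous_image[OF continuous_on_subset[OF assms subset_UNIV]]
      convex_connected convex_Int convex_ball convex_halfspace_Im_gt convex_halfspace_Im_lt)+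

text \<open>The chart is forgotten; what remains are the two sides as connected open sets, all that
  the arguments about locally constant functions use.\<close>

definition is_simple_nbhd :: "real \<Rightarrow> real \<Rightarrow> complex set \<Rightarrow> complex set \<Rightarrow> complex set \<Rightarrow> bool" where
  "is_simple_nbhd t r W L R \<longleftrightarrow> open W \<and> open L \<and> open R \<and> L \<inter> R = {} \<and>
     connected L \<and> connected R \<and> W - range f = L \<union> R \<and>
     (\<forall>u. f u \<in> W \<longrightarrow> (\<exists>s. \<bar>s\<bar> < r \<and> u - (t + s) \<in> \<int>)) \<and>
     (\<forall>s. \<bar>s\<bar> < r \<longrightarrow> simple (t + s) \<and> f (t + s) \<in> W \<and> on_left (t + s) L \<and> on_right (t + s) R)"

text \<open>\<open>A\<close>, \<open>B\<close>, \<open>C\<close>, \<open>D\<close> are the four quadrants in counterclockwise order, \<open>A\<close> lying between the two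
  outgoing strands; the strand through \<open>t1\<close> crosses the one through \<open>t0\<close> from right to left.\<close>

definition is_double_nbhd :: "real \<Rightarrow> real \<Rightarrow> real \<Rightarrow> complex set \<Rightarrow>
    complex set \<Rightarrow> complex set \<Rightarrow> complex set \<Rightarrow> complex set \<Rightarrow> bool" where
  "is_double_nbhd t0 t1 r W A B C D \<longleftrightarrow> open W \<and> f t0 \<in> W \<and>
     open A \<and> open B \<and> open C \<and> open D \<and>
     A \<inter> B = {} \<and> A \<inter> C = {} \<and> A \<inter> D = {} \<and> B \<inter> C = {} \<and> B \<inter> D = {} \<and> C \<inter> D = {} \<and>
     connected A \<and> connected B \<and> connected C \<and> connected D \<and>
     W - range f = A \<union> B \<union> C \<union> D \<and>
     (\<forall>u. f u \<in> W \<longrightarrow> simple u \<longrightarrow> (\<exists>s. 0 < s \<and> s < r \<and>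
       (u - (t0 + s) \<in> \<int> \<or> u - (t0 - s) \<in> \<int> \<or> u - (t1 + s) \<in> \<int> \<or> u - (t1 - s) \<in> \<int>))) \<and>
     (\<forall>s. 0 < s \<and> s < r \<longrightarrow>
       simple (t0 + s) \<and> f (t0 + s) \<in> W \<and> on_left (t0 + s) A \<and> on_right (t0 + s) D) \<and>
     (\<forall>s. 0 < s \<and> s < r \<longrightarrow>
       simple (t0 - s) \<and> f (t0 - s) \<in> W \<and> on_left (t0 - s) B \<and> on_right (t0 - s) C) \<and>
     (\<forall>s. 0 < s \<and> s < r \<longrightarrow>
       simple (t1 + s) \<and> f (t1 + s) \<in> W \<and> on_left (t1 + s) B \<and> on_right (t1 + s) A) \<and>
     (\<forall>s. 0 < s \<and> s < r \<longrightarrow>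
       simple (t1 - s) \<and> f (t1 - s) \<in> W \<and> on_left (t1 - s) C \<and> on_right (t1 - s) D)"

lemma simple_nbhd:
  assumes t: "simple t" and U: "open U" "f t \<in> U" and \<rho>: "\<rho> > 0"
  obtains r W L R where "0 < r" "r \<le> \<rho>" "W \<subseteq> U" "f t \<in> W" "is_simple_nbhd t r W L R"
proof -
  obtain r h where r: "0 < r" "r \<le> \<rho>" "h ` ball 0 r \<subseteq> U" and ch: "is_simple_chart t r h"
    using simple_chart[OF t U \<rho>] by metis
  note h = ch[unfolded is_simple_chart_def, THEN conjunct1]
    ch[unfolded is_simple_chart_def, THEN conjunct2, THEN conjunct1]
  have curve: "h z \<in> range f \<longleftrightarrow> Im z = 0" if "z \<in> ball 0 r" for z
    using ch that unfolding is_simple_chart_def by blast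
  have opn: "open (h ` (ball 0 r \<inter> S))" if "open S" for S
    using invariance_of_domain[of "ball 0 r \<inter> S" h] h that
    by (meson continuous_on_subset inj_on_subset inf_le1 open_Int open_ball subset_UNIV)
  have "is_simple_nbhd t r (h ` ball 0 r) (h ` (ball 0 r \<inter> {z. Im z > 0})) (h ` (ball 0 r \<inter> {z. Im z < 0}))"
    unfolding is_simple_nbhd_def
  proof (intro conjI)
    show "open (h ` ball 0 r)" using opn[of UNIV] by simp
    show "open (h ` (ball 0 r \<inter> {z. Im z > 0}))" "open (h ` (ball 0 r \<inter> {z. Im z < 0}))"
      using opn open_halfspace_Im_gt open_halfspace_Im_lt by blast+
    show "h ` (ball 0 r \<inter> {z. Im z > 0}) \<inter> h ` (ball 0 r \<inter> {z. Im z < 0}) = {}"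
      using h(2) by (fastforce simp: inj_on_def)
    show "h ` ball 0 r - range f = h ` (ball 0 r \<inter> {z. Im z > 0}) \<union> h ` (ball 0 r \<inter> {z. Im z < 0})"
      (is "?A = ?B")
    proof
      show "?A \<subseteq> ?B"
      proof
        fix z assume "z \<in> ?A"
        then obtain x where x: "x \<in> ball 0 r" "z = h x" "Im x \<noteq> 0" using curve by blast
        then have "Im x > 0 \<or> Im x < 0" by linarith
        then show "z \<in> ?B" using x by blast
      qed
      show "?B \<subseteq> ?A"
      proof
        fix z assume "z \<in> ?B"
        then obtain x where x: "x \<in> ball 0 r" "z = h x" "Im x \<noteq> 0" by auto
        then have "h x \<notin> range f" using curve[OF x(1)] by simp
        then show "z \<in> ?A" unfolding x(2) by (intro DiffI imageI x(1))
      qed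
    qed
    show "\<forall>u. f u \<in> h ` ball 0 r \<longrightarrow> (\<exists>s. \<bar>s\<bar> < r \<and> u - (t + s) \<in> \<int>)"
      using ch unfolding is_simple_chart_def by blast
    show "\<forall>s. \<bar>s\<bar> < r \<longrightarrow> simple (t + s) \<and> f (t + s) \<in> h ` ball 0 r \<and>
       on_left (t + s) (h ` (ball 0 r \<inter> {z. Im z > 0})) \<and> on_right (t + s) (h ` (ball 0 r \<inter> {z. Im z < 0}))"
      using ch unfolding is_simple_chart_def by blast
    show "connected (h ` (ball 0 r \<inter> {z. Im z > 0}))" "connected (h ` (ball 0 r \<inter> {z. Im z < 0}))"
      by (rule half_connected[OF h(1)])+
  qed
  moreover have "f t \<in> h ` ball 0 r"
  proof -
    have "\<forall>s. \<bar>s\<bar> < r \<longrightarrow> f (t + s) \<in> h ` ball 0 r"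
      using ch unfolding is_simple_chart_def by blast
    from spec[OF this, of 0] show ?thesis using r(1) by simp
  qed
  ultimately show thesis using that r by blast
qed

lemma double_nbhd:
  assumes eq: "f t1 = f t0" and ne: "t1 - t0 \<notin> \<int>"
    and det: "plane_det (velocity f t0) (velocity f t1) > 0"
    and U: "open U" "f t0 \<in> U" and \<rho>: "\<rho> > 0"
  obtains r W A B C D where "0 < r" "r \<le> \<rho>" "W \<subseteq> U" "is_double_nbhd t0 t1 r W A B C D"
proof -
  obtain r h where r: "0 < r" "r \<le> \<rho>" "h ` ball 0 r \<subseteq> U" and ch: "is_double_chart t0 t1 r h"
    using double_chart[OF eq ne det U \<rho>] by metis
  note h = ch[unfolded is_double_chart_def, THEN conjunct1]
    ch[unfolded is_double_chart_def, THEN conjunct2, THEN conjunct1]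
  have curve: "h z \<in> range f \<longleftrightarrow> Re z = 0 \<or> Im z = 0" if "z \<in> ball 0 r" for z
    using ch that unfolding is_double_chart_def by blast
  have strand0: "f (t0 + s) \<in> h ` ball 0 r" "simple (t0 + s)"
    and strand1: "f (t1 + s) \<in> h ` ball 0 r" "simple (t1 + s)" if "\<bar>s\<bar> < r" "s \<noteq> 0" for s
    using ch that unfolding is_double_chart_def by blast+
  have opn: "open (h ` (ball 0 r \<inter> S))" if "open S" for S
    using invariance_of_domain[of "ball 0 r \<inter> S" h] h that
    by (meson continuous_on_subset inj_on_subset inf_le1 open_Int open_ball subset_UNIV)
  have opnq: "open (quadrant h r a b)" for a b
    unfolding quadrant_def by (intro opn open_Collect_conj open_Collect_less continuous_intros)
  have disj: "quadrant h r a b \<inter> quadrant h r a' b' = {}" if "a * a' < 0 \<or> b * b' < 0" for a b a' b'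
  proof (rule ccontr)
    assume "quadrant h r a b \<inter> quadrant h r a' b' \<noteq> {}"
    then obtain x y where xy: "x \<in> ball 0 r" "y \<in> ball 0 r" "h x = h y"
      "a * Re x > 0" "b * Im x > 0" "a' * Re y > 0" "b' * Im y > 0"
      unfolding quadrant_def by fastforce
    then have "x = y" using h(2) by (meson inj_onD)
    then show False using xy that by (auto simp: zero_less_mult_iff mult_less_0_iff)
  qed
  have avoid: "quadrant h r a b \<subseteq> h ` ball 0 r - range f" for a b
  proof
    fix z assume "z \<in> quadrant h r a b"
    then obtain x where x: "x \<in> ball 0 r" "z = h x" "a * Re x > 0" "b * Im x > 0"
      unfolding quadrant_def by blast
    then have "Re x \<noteq> 0" "Im x \<noteq> 0" by auto
    then have "h x \<notin> range f" using curve[OF x(1)] by simp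
    then show "z \<in> h ` ball 0 r - range f"
      unfolding x(2) by (intro DiffI imageI x(1))
  qed
  \<comment> \<open>Only the signs of the coefficients matter, so the signed parameter occurring in
    \<open>is_double_chart\<close> may be replaced by 1 or -1.\<close>
  have norm: "quadrant h r (s * a) b = quadrant h r a b" "quadrant h r a (s * b) = quadrant h r a b" if "s > 0" for s a b
  proof -
    have "0 < s * x * y \<longleftrightarrow> 0 < x * y" for x y
      using that by (simp add: mult.assoc zero_less_mult_iff[of s])
    then show "quadrant h r (s * a) b = quadrant h r a b" "quadrant h r a (s * b) = quadrant h r a b"
      unfolding quadrant_def by simp_all
  qed
  have sides: "on_left (t0 + s) (quadrant h r s 1)" "on_right (t0 + s) (quadrant h r s (-1))"
      "on_left (t1 + s) (quadrant h r (-1) s)" "on_right (t1 + s) (quadrant h r 1 s)"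
    if "\<bar>s\<bar> < r" "s \<noteq> 0" for s
    using ch that unfolding is_double_chart_def quadrant_def by simp_all
  have "is_double_nbhd t0 t1 r (h ` ball 0 r) (quadrant h r 1 1) (quadrant h r (-1) 1)
      (quadrant h r (-1) (-1)) (quadrant h r 1 (-1))"
    unfolding is_double_nbhd_def
  proof (intro conjI allI impI; (elim conjE)?)
    show "open (h ` ball 0 r)" using opn[of UNIV] by simp
    show "h ` ball 0 r - range f = quadrant h r 1 1 \<union> quadrant h r (-1) 1 \<union>
      quadrant h r (-1) (-1) \<union> quadrant h r 1 (-1)" (is "?A = ?B")
    proof
      show "?A \<subseteq> ?B"
      proof
        fix z assume "z \<in> ?A"
        then obtain x where x: "x \<in> ball 0 r" "z = h x" "Re x \<noteq> 0" "Im x \<noteq> 0" using curve by blast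
        then have "Re x > 0 \<and> Im x > 0 \<or> Re x < 0 \<and> Im x > 0 \<or> Re x < 0 \<and> Im x < 0 \<or> Re x > 0 \<and> Im x < 0"
          by linarith
        then show "z \<in> ?B" using x unfolding quadrant_def by auto
      qed
      show "?B \<subseteq> ?A" using avoid by blast
    qed
    have "h 0 = f t0" using ch by (simp add: is_double_chart_def)
    then show "f t0 \<in> h ` ball 0 r" using r(1) by (metis centre_in_ball imageI)
    show "\<exists>s. 0 < s \<and> s < r \<and>
       (u - (t0 + s) \<in> \<int> \<or> u - (t0 - s) \<in> \<int> \<or> u - (t1 + s) \<in> \<int> \<or> u - (t1 - s) \<in> \<int>)"
      if u: "f u \<in> h ` ball 0 r" "simple u" for u
    proof -
      obtain s where s: "\<bar>s\<bar> < r" "u - (t0 + s) \<in> \<int> \<or> u - (t1 + s) \<in> \<int>" 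
        using ch u(1) unfolding is_double_chart_def by blast
      have "s \<noteq> 0"
      proof
        assume "s = 0"
        then have d: "u - t0 \<in> \<int> \<or> u - t1 \<in> \<int>" using s by simp
        then have "f u = f t0" using f_eq_mod eq by metis
        then have "t0 - u \<in> \<int>" "t1 - u \<in> \<int>" using u(2) eq by (auto simp: simple_def)
        then show False using ne Ints_diff_trans[of t1 u t0] Ints_diff_commute by blast
      qed
      then show ?thesis
        using s by (intro exI[of _ "\<bar>s\<bar>"]) (cases "s > 0"; auto)
    qed
    fix s assume s: "0 < s" "s < r"
    then have s': "\<bar>s\<bar> < r" "s \<noteq> 0" "\<bar>- s\<bar> < r" "- s \<noteq> 0" by auto
    note n = norm(1)[OF s(1), of 1] norm(1)[OF s(1), of "-1"] norm(2)[OF s(1), of _ 1] norm(2)[OF s(1), of _ "-1"]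
    show "simple (t0 + s)" "f (t0 + s) \<in> h ` ball 0 r" "simple (t1 + s)" "f (t1 + s) \<in> h ` ball 0 r"
      using strand0[OF s'(1,2)] strand1[OF s'(1,2)] by simp_all
    show "simple (t0 - s)" "f (t0 - s) \<in> h ` ball 0 r" "simple (t1 - s)" "f (t1 - s) \<in> h ` ball 0 r"
      using strand0[OF s'(3,4)] strand1[OF s'(3,4)] by simp_all
    show "on_left (t0 + s) (quadrant h r 1 1)" "on_right (t0 + s) (quadrant h r 1 (-1))"
      "on_left (t1 + s) (quadrant h r (-1) 1)" "on_right (t1 + s) (quadrant h r 1 1)"
      using sides[OF s'(1,2)] n by simp_all
    show "on_left (t0 - s) (quadrant h r (-1) 1)" "on_right (t0 - s) (quadrant h r (-1) (-1))"
      "on_left (t1 - s) (quadrant h r (-1) (-1))" "on_right (t1 - s) (quadrant h r 1 (-1))"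
      using sides[OF s'(3,4)] n by simp_all
  qed (use disj opnq quadrant_connected[OF h(1)] in simp_all)
  then show thesis using that r by blast
qed

text \<open>At a simple point the two sides share their value. At a double point three of the four
  half-strands already connect the quadrants: \<open>A\<close> to \<open>D\<close>, \<open>B\<close>
  to \<open>C\<close>, and \<open>B\<close> to \<open>A\<close>.\<close>

lemma jump_free_local:
  assumes Q: "jump_free U Q" and U: "open U" "p \<in> U"
  shows "\<exists>W q. open W \<and> p \<in> W \<and> (\<forall>z\<in>W - range f. Q z = q)"
proof (cases "p \<in> range f")
  case False
  then have "\<forall>\<^sub>F z' in nhds p. Q z' = Q p" using Q U(2) by (simp add: jump_free_def locally_const_def)
  then show ?thesis unfolding eventually_nhds by blast
next
  case True
  then obtain t where p: "p = f t" by blast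
  show ?thesis
  proof (cases "simple t")
    case True
    have tU: "f t \<in> U" using U(2) p by simp
    obtain r W L R where r: "0 < r" "r \<le> 1" "W \<subseteq> U" "f t \<in> W" and nb: "is_simple_nbhd t r W L R"
      by (rule simple_nbhd[OF True U(1) tU zero_less_one])
    have W: "open W" "connected L" "connected R" "W - range f = L \<union> R"
      using nb by (simp_all add: is_simple_nbhd_def)
    have "\<forall>s. \<bar>s\<bar> < r \<longrightarrow> simple (t + s) \<and> f (t + s) \<in> W \<and> on_left (t + s) L \<and> on_right (t + s) R"
      using nb unfolding is_simple_nbhd_def by blast
    from spec[OF this, of 0] have "on_left t L" "on_right t R" using r(1) by simp_all
    then have "\<exists>q. \<forall>z\<in>L \<union> R. Q z = q"
      using jump_free_sides[OF Q True tU W(2) _ _ W(3)] r(3) W(4) by auto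
    then show ?thesis using W r(4) p by metis
  next
    case False
    then obtain t0 t1 where tt: "f t0 = f t" "f t1 = f t0" "t1 - t0 \<notin> \<int>"
      "plane_det (velocity f t0) (velocity f t1) > 0" by (rule not_simpleE)
    have U0: "f t0 \<in> U" using tt(1) U(2) p by simp
    obtain r W A B C D where r: "0 < r" "r \<le> 1" "W \<subseteq> U" and nb: "is_double_nbhd t0 t1 r W A B C D"
      by (rule double_nbhd[OF tt(2-4) U(1) U0 zero_less_one])
    have W: "open W" "f t0 \<in> W" "connected A" "connected B" "connected C" "connected D"
      "W - range f = A \<union> B \<union> C \<union> D"
      using nb by (simp_all add: is_double_nbhd_def)
    define s where "s = r / 2"
    have s: "0 < s \<and> s < r" using r(1) by (auto simp: s_def)
    have sides: "simple (t0 + s) \<and> f (t0 + s) \<in> W \<and> on_left (t0 + s) A \<and> on_right (t0 + s) D"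
      "simple (t0 - s) \<and> f (t0 - s) \<in> W \<and> on_left (t0 - s) B \<and> on_right (t0 - s) C"
      "simple (t1 + s) \<and> f (t1 + s) \<in> W \<and> on_left (t1 + s) B \<and> on_right (t1 + s) A"
      using nb s unfolding is_double_nbhd_def by simp_all
    have sub: "A \<subseteq> U - range f" "B \<subseteq> U - range f" "C \<subseteq> U - range f" "D \<subseteq> U - range f"
      using r(3) W(7) by auto
    have "\<exists>q. \<forall>z\<in>A \<union> D. Q z = q"
      using jump_free_sides[OF Q _ _ W(3) sub(1) _ W(6) sub(4)] sides(1) r(3) by blast
    moreover have "\<exists>q. \<forall>z\<in>B \<union> C. Q z = q"
      using jump_free_sides[OF Q _ _ W(4) sub(2) _ W(5) sub(3)] sides(2) r(3) by blast
    moreover have "\<exists>q. \<forall>z\<in>B \<union> A. Q z = q"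
      using jump_free_sides[OF Q _ _ W(4) sub(2) _ W(3) sub(1)] sides(3) r(3) by blast
    \<comment> \<open>Nonempty common members are needed to equate the three constants.\<close>
    moreover have "\<exists>z. z \<in> A" "\<exists>z. z \<in> B"
      using sides on_left_ex by blast+
    ultimately have "\<exists>q. \<forall>z\<in>A \<union> B \<union> C \<union> D. Q z = q" by (metis UnE UnI1 UnI2)
    then show ?thesis using W p tt(1) by metis
  qed
qed

text \<open>The quotient of two solutions of a jump problem has no jump, hence this is the uniqueness statement.\<close>

lemma jump_free_const:
  assumes Q: "jump_free U Q" and U: "open U" "connected U"
    and xy: "x \<in> U - range f" "y \<in> U - range f"
  shows "Q x = Q y"
\<comment> \<open>The complement of the curve is not connected, so the induction runs over the
  connected set \<open>U\<close> itself and skips the points of the curve. This is legitimate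
  because the complement is dense and each point of \<open>U\<close>, on the curve or not, has a
  neighbourhood on whose complement points \<open>Q\<close> is constant.\<close>
proof (rule connected_induction[where S = U and P = "\<lambda>z. z \<notin> range f" and Q = "\<lambda>z. Q x = Q z" and a = x])
  show "\<exists>z. z \<in> T \<and> z \<notin> range f" if "openin (top_of_set U) T" "a \<in> T" for T a
    using dense_complement[of T] that U(1) openin_open_trans by blast
  show "\<exists>T. openin (top_of_set U) T \<and> a \<in> T \<and>
      (\<forall>x'\<in>T. \<forall>y'\<in>T. x' \<notin> range f \<and> y' \<notin> range f \<and> Q x = Q x' \<longrightarrow> Q x = Q y')" if "a \<in> U" for a
  proof -
    obtain W q where W: "open W" "a \<in> W" "\<And>z. z \<in> W - range f \<Longrightarrow> Q z = q"
      using jump_free_local[OF Q U(1) \<open>a \<in> U\<close>] by blast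
    then show ?thesis using that
      by (intro exI[of _ "U \<inter> W"]) (simp add: openin_open_Int)
  qed
qed (use U xy in auto)

end

section \<open>Quandles\<close>

locale quandle_target =
  fixes T :: "'b quandle_struct"
  assumes quandle: "quandle T"
begin

abbreviation Q :: "'b set" where "Q \<equiv> qcarrier T"
abbreviation op :: "'b \<Rightarrow> 'b \<Rightarrow> 'b" (infixl "\<triangleright>" 65) where "a \<triangleright> b \<equiv> qop T a b"

lemma op_closed: "a \<in> Q \<Longrightarrow> b \<in> Q \<Longrightarrow> a \<triangleright> b \<in> Q"
  and op_idem: "a \<in> Q \<Longrightarrow> a \<triangleright> a = a"
  and op_solve: "a \<in> Q \<Longrightarrow> b \<in> Q \<Longrightarrow> \<exists>!c. c \<in> Q \<and> a = c \<triangleright> b"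
  and op_dist: "a \<in> Q \<Longrightarrow> b \<in> Q \<Longrightarrow> c \<in> Q \<Longrightarrow> (a \<triangleright> b) \<triangleright> c = (a \<triangleright> c) \<triangleright> (b \<triangleright> c)"
proof -
  note q = quandle[unfolded quandle_def]
  show "a \<in> Q \<Longrightarrow> b \<in> Q \<Longrightarrow> a \<triangleright> b \<in> Q" using q[THEN conjunct1] by blast
  show "a \<in> Q \<Longrightarrow> a \<triangleright> a = a" using q[THEN conjunct2, THEN conjunct1] by blast
  show "a \<in> Q \<Longrightarrow> b \<in> Q \<Longrightarrow> \<exists>!c. c \<in> Q \<and> a = c \<triangleright> b"
    using q[THEN conjunct2, THEN conjunct2, THEN conjunct1, THEN bspec, THEN bspec] .
  show "a \<in> Q \<Longrightarrow> b \<in> Q \<Longrightarrow> c \<in> Q \<Longrightarrow> (a \<triangleright> b) \<triangleright> c = (a \<triangleright> c) \<triangleright> (b \<triangleright> c)"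
    using q[THEN conjunct2, THEN conjunct2, THEN conjunct2, THEN bspec, THEN bspec, THEN bspec] .
qed

lemma op_cancel:
  assumes "a \<in> Q" "a' \<in> Q" "b \<in> Q" "a \<triangleright> b = a' \<triangleright> b"
  shows "a = a'"
proof -
  obtain c where c: "\<And>c'. c' \<in> Q \<and> a \<triangleright> b = c' \<triangleright> b \<Longrightarrow> c' = c"
    using op_solve[OF op_closed[OF assms(1,3)] assms(3)] by (elim ex1E) metis
  show ?thesis using c[of a] c[of a'] assms by simp
qed

definition quot :: "'b \<Rightarrow> 'b \<Rightarrow> 'b" (infixl "\<triangleleft>" 65) where
  "a \<triangleleft> b = (THE c. c \<in> Q \<and> a = c \<triangleright> b)"

lemma quot_closed: "a \<in> Q \<Longrightarrow> b \<in> Q \<Longrightarrow> a \<triangleleft> b \<in> Q"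
  and quot_op: "a \<in> Q \<Longrightarrow> b \<in> Q \<Longrightarrow> (a \<triangleleft> b) \<triangleright> b = a"
  using theI'[OF op_solve[of a b]] unfolding quot_def by (simp, metis)

lemma op_quot: "a \<in> Q \<Longrightarrow> b \<in> Q \<Longrightarrow> (a \<triangleright> b) \<triangleleft> b = a"
  using op_cancel op_closed quot_closed quot_op by metis

lemma quot_unique: "c \<in> Q \<Longrightarrow> b \<in> Q \<Longrightarrow> c \<triangleright> b = a \<Longrightarrow> a \<triangleleft> b = c"
  using op_quot by blast

text \<open>Automorphisms are bijections of the whole type that preserve \<open>Q\<close>, so that
  \<open>\<circ>\<close> and \<open>inv\<close> are the group operations. Accordingly
  \<open>rtrans\<close> is continued by the identity outside \<open>Q\<close>.\<close>

definition auts :: "('b \<Rightarrow> 'b) set" where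
  "auts = {g. bij g \<and> (\<forall>x. g x \<in> Q \<longleftrightarrow> x \<in> Q) \<and> (\<forall>a\<in>Q. \<forall>b\<in>Q. g (a \<triangleright> b) = g a \<triangleright> g b)}"

lemma auts_bij: "g \<in> auts \<Longrightarrow> bij g"
  and auts_carrier: "g \<in> auts \<Longrightarrow> g x \<in> Q \<longleftrightarrow> x \<in> Q"
  and auts_op: "g \<in> auts \<Longrightarrow> a \<in> Q \<Longrightarrow> b \<in> Q \<Longrightarrow> g (a \<triangleright> b) = g a \<triangleright> g b"
  by (simp_all add: auts_def)

lemma auts_id: "id \<in> auts"
  by (simp add: auts_def)

lemma auts_comp: "g \<in> auts \<Longrightarrow> g' \<in> auts \<Longrightarrow> g \<circ> g' \<in> auts"
  by (simp add: auts_def bij_comp)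

lemma auts_inv:
  assumes g: "g \<in> auts"
  shows "inv g \<in> auts"
proof -
  have gi: "g (inv g x) = x" for x using auts_bij[OF g] by (simp add: bij_is_surj surj_f_inv_f)
  have ig: "inv g (g x) = x" for x using auts_bij[OF g] by (simp add: bij_is_inj)
  have c: "inv g x \<in> Q \<longleftrightarrow> x \<in> Q" for x using auts_carrier[OF g, of "inv g x"] gi by simp
  have "inv g (a \<triangleright> b) = inv g a \<triangleright> inv g b" if "a \<in> Q" "b \<in> Q" for a b
    using auts_op[OF g, of "inv g a" "inv g b"] that c ig[of "inv g a \<triangleright> inv g b"] gi by simp
  then show ?thesis using c auts_bij[OF g] by (simp add: auts_def bij_imp_bij_inv)
qed

definition rtrans :: "'b \<Rightarrow> 'b \<Rightarrow> 'b" where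
  "rtrans y = (\<lambda>x. if x \<in> Q then x \<triangleright> y else x)"

lemma rtrans_eq: "x \<in> Q \<Longrightarrow> rtrans y x = x \<triangleright> y"
  by (simp add: rtrans_def)

text \<open>Unique solvability makes right translation bijective, and self-distributivity makes it a
  homomorphism.\<close>

lemma rtrans_auts:
  assumes y: "y \<in> Q"
  shows "rtrans y \<in> auts"
proof -
  have c: "rtrans y x \<in> Q \<longleftrightarrow> x \<in> Q" for x using y op_closed by (simp add: rtrans_def)
  have "bij (rtrans y)"
  proof (rule bijI)
    show "inj (rtrans y)"
    proof (rule injI)
      fix a b assume eq: "rtrans y a = rtrans y b"
      then have "a \<in> Q \<longleftrightarrow> b \<in> Q" using c by metis
      then show "a = b" using eq op_cancel[of a b y] y by (auto simp: rtrans_def split: if_splits)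
    qed
    have "\<exists>b. rtrans y b = a" for a
    proof (cases "a \<in> Q")
      case True
      then show ?thesis using quot_op[OF True y] quot_closed[OF True y] rtrans_eq by metis
    qed (auto simp: rtrans_def)
    then show "surj (rtrans y)" by (metis surjI surj_def)
  qed
  moreover have "rtrans y (a \<triangleright> b) = rtrans y a \<triangleright> rtrans y b" if "a \<in> Q" "b \<in> Q" for a b
    by (simp add: rtrans_def op_closed that y op_dist[OF that y])
  ultimately show ?thesis using c by (simp add: auts_def)
qed

text \<open>Translations are natural under automorphisms. This one fact gives the flatness of the
  jumps at a crossing and also makes the inverse of a solution a solution.\<close>

lemma auts_rtrans:
  assumes g: "g \<in> auts" and y: "y \<in> Q"
  shows "g \<circ> rtrans y = rtrans (g y) \<circ> g"
  by (rule ext) (simp add: rtrans_def auts_carrier[OF g] auts_op[OF g _ y])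

lemma rtrans_op:
  assumes "x \<in> Q" "y \<in> Q"
  shows "rtrans y \<circ> rtrans x = rtrans (x \<triangleright> y) \<circ> rtrans y"
  using auts_rtrans[OF rtrans_auts[OF assms(2)] assms(1)] by (simp add: rtrans_eq assms)

end

section \<open>Automorphism-valued functions jumping across a curve\<close>

definition rect :: "real \<Rightarrow> real \<Rightarrow> real \<Rightarrow> real \<Rightarrow> complex set" where
  "rect a b c d = box (Complex a c) (Complex b d)"

lemma mem_rect: "z \<in> rect a b c d \<longleftrightarrow> a < Re z \<and> Re z < b \<and> c < Im z \<and> Im z < d"
  by (auto simp: rect_def in_box_complex_iff)

lemma open_rect: "open (rect a b c d)" and convex_rect: "convex (rect a b c d)"
  by (simp_all add: rect_def open_box convex_box)

lemma rect_mono: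
  "a' \<le> a \<Longrightarrow> b \<le> b' \<Longrightarrow> c' \<le> c \<Longrightarrow> d \<le> d' \<Longrightarrow> rect a b c d \<subseteq> rect a' b' c' d'"
  unfolding rect_def by (intro subsetI) (simp add: in_box_complex_iff)

context generic_curve
begin

lemma locally_const_open_cover:
  assumes "W - range f \<subseteq> \<Union>\<S>" "\<And>S. S \<in> \<S> \<Longrightarrow> open S \<and> (\<exists>c. \<forall>z\<in>S. \<phi> z = c)"
  shows "locally_const W \<phi>"
  unfolding locally_const_def
proof
  fix z assume "z \<in> W - range f"
  then obtain S where S: "S \<in> \<S>" "z \<in> S" using assms(1) by blast
  obtain c where c: "open S" "\<And>z. z \<in> S \<Longrightarrow> \<phi> z = c" using assms(2)[OF S(1)] by metis
  have "\<forall>\<^sub>F z' in nhds z. z' \<in> S" using c(1) S(2) by (rule eventually_nhds_in_open)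
  then show "\<forall>\<^sub>F z' in nhds z. \<phi> z' = \<phi> z" by (rule eventually_mono) (simp add: c(2) S(2))
qed

end

text \<open>Group and jumps are kept abstract because two systems occur: one with the translations
  by a colouring, and one with the inverse translations by the transported colouring.\<close>

locale jump_system = generic_curve f for f +
  fixes G :: "('b \<Rightarrow> 'b) set" and J :: "real \<Rightarrow> 'b \<Rightarrow> 'b"
  assumes G_bij: "g \<in> G \<Longrightarrow> bij g" and G_id: "id \<in> G"
    and G_comp: "g \<in> G \<Longrightarrow> g' \<in> G \<Longrightarrow> g \<circ> g' \<in> G"
    and G_inv: "g \<in> G \<Longrightarrow> inv g \<in> G"
    and J_in_G: "J t \<in> G"
begin

text \<open>Here \<open>a\<close> is the limit of \<open>\<phi>\<close> from the left. The values of \<open>\<phi>\<close> on the curve itself are irrelevant.\<close>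

definition sol :: "complex set \<Rightarrow> (complex \<Rightarrow> 'b \<Rightarrow> 'b) \<Rightarrow> bool" where
  "sol U \<phi> \<longleftrightarrow> (\<forall>z. \<phi> z \<in> G) \<and> locally_const U \<phi> \<and>
     (\<forall>t. simple t \<and> f t \<in> U \<longrightarrow>
       (\<exists>a. on_left t {z. \<phi> z = a} \<and> on_right t {z. \<phi> z = a \<circ> J t}))"

lemma inv_comp_G: "g \<in> G \<Longrightarrow> inv g \<circ> g = id" "g \<in> G \<Longrightarrow> g \<circ> inv g = id"
  using inv_o_cancel[OF bij_is_inj[OF G_bij]] surj_iff[THEN iffD1, OF bij_is_surj[OF G_bij]] by simp_all

lemma sol_subset: "sol U \<phi> \<Longrightarrow> V \<subseteq> U \<Longrightarrow> sol V \<phi>"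
  unfolding sol_def locally_const_def by blast

text \<open>Jumps act from the right, so a constant factor on the left does not disturb
  them.\<close>

lemma sol_mult:
  assumes "sol U \<phi>" "q \<in> G"
  shows "sol U (\<lambda>z. q \<circ> \<phi> z)"
  unfolding sol_def
proof (intro conjI allI impI)
  show "q \<circ> \<phi> z \<in> G" for z using assms G_comp by (simp add: sol_def)
  show "locally_const U (\<lambda>z. q \<circ> \<phi> z)"
    unfolding locally_const_def
  proof
    fix z assume "z \<in> U - range f"
    then have "\<forall>\<^sub>F z' in nhds z. \<phi> z' = \<phi> z" using assms(1) by (simp add: sol_def locally_const_def)
    then show "\<forall>\<^sub>F z' in nhds z. q \<circ> \<phi> z' = q \<circ> \<phi> z" by (rule eventually_mono) simp
  qed
  fix t assume "simple t \<and> f t \<in> U"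
  then obtain a where a: "on_left t {z. \<phi> z = a}" "on_right t {z. \<phi> z = a \<circ> J t}"
    using assms(1) unfolding sol_def by blast
  show "\<exists>a. on_left t {z. q \<circ> \<phi> z = a} \<and> on_right t {z. q \<circ> \<phi> z = a \<circ> J t}"
  proof (intro exI conjI)
    show "on_left t {z. q \<circ> \<phi> z = q \<circ> a}" by (rule on_left_mono[OF a(1)]) auto
    show "on_right t {z. q \<circ> \<phi> z = q \<circ> a \<circ> J t}" by (rule on_right_mono[OF a(2)]) (auto simp: comp_assoc)
  qed
qed

text \<open>The common jump cancels in
  \<open>(a \<circ> J t) \<circ> inv (b \<circ> J t)\<close>.\<close>

lemma sol_quotient:
  assumes \<phi>: "sol U \<phi>" and \<psi>: "sol U \<psi>"
  shows "jump_free U (\<lambda>z. \<phi> z \<circ> inv (\<psi> z))"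
  unfolding jump_free_def
proof (intro conjI allI impI)
  show "locally_const U (\<lambda>z. \<phi> z \<circ> inv (\<psi> z))"
    unfolding locally_const_def
  proof
    fix z assume z: "z \<in> U - range f"
    have 1: "\<forall>\<^sub>F z' in nhds z. \<phi> z' = \<phi> z" and 2: "\<forall>\<^sub>F z' in nhds z. \<psi> z' = \<psi> z"
      using \<phi> \<psi> z unfolding sol_def locally_const_def by blast+
    show "\<forall>\<^sub>F z' in nhds z. \<phi> z' \<circ> inv (\<psi> z') = \<phi> z \<circ> inv (\<psi> z)"
      using 1 2 by eventually_elim simp
  qed
  fix t assume t: "simple t \<and> f t \<in> U"
  obtain a where a: "on_left t {z. \<phi> z = a}" "on_right t {z. \<phi> z = a \<circ> J t}"
    using \<phi> t unfolding sol_def by blast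
  obtain b where b: "on_left t {z. \<psi> z = b}" "on_right t {z. \<psi> z = b \<circ> J t}"
    using \<psi> t unfolding sol_def by blast
  obtain z where "\<psi> z = b" using on_left_ex[OF b(1)] by blast
  then have bG: "b \<in> G" using \<psi> unfolding sol_def by blast
  have "a \<circ> J t \<circ> inv (b \<circ> J t) = a \<circ> (J t \<circ> inv (J t)) \<circ> inv b"
    using o_inv_distrib[OF G_bij[OF bG] G_bij[OF J_in_G]] by (simp add: comp_assoc)
  then have *: "a \<circ> J t \<circ> inv (b \<circ> J t) = a \<circ> inv b"
    using inv_comp_G(2)[OF J_in_G] by simp
  show "\<exists>q. on_left t {z. \<phi> z \<circ> inv (\<psi> z) = q} \<and> on_right t {z. \<phi> z \<circ> inv (\<psi> z) = q}"
  proof (intro exI conjI)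
    show "on_left t {z. \<phi> z \<circ> inv (\<psi> z) = a \<circ> inv b}"
      by (rule on_left_mono[OF on_left_Int[OF a(1) b(1)]]) auto
    show "on_right t {z. \<phi> z \<circ> inv (\<psi> z) = a \<circ> inv b}"
      unfolding *[symmetric] by (rule on_right_mono[OF on_right_Int[OF a(2) b(2)]]) auto
  qed
qed

lemma sol_unique:
  assumes \<phi>: "sol U \<phi>" and \<psi>: "sol U \<psi>" and U: "open U" "connected U"
  obtains q where "q \<in> G" "\<And>z. z \<in> U - range f \<Longrightarrow> \<phi> z = q \<circ> \<psi> z"
proof (cases "U - range f = {}")
  case True
  then show thesis using that[OF G_id] by blast
next
  case False
  then obtain x where x: "x \<in> U - range f" by blast
  define q where "q = \<phi> x \<circ> inv (\<psi> x)"
  have "q \<in> G" using \<phi> \<psi> unfolding q_def sol_def by (simp add: G_comp G_inv)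
  moreover have "\<phi> z = q \<circ> \<psi> z" if "z \<in> U - range f" for z
  proof -
    have "q = \<phi> z \<circ> inv (\<psi> z)"
      unfolding q_def by (rule jump_free_const[OF sol_quotient[OF \<phi> \<psi>] U x that])
    then have "q \<circ> \<psi> z = \<phi> z \<circ> (inv (\<psi> z) \<circ> \<psi> z)" by (simp add: comp_assoc)
    then show ?thesis using inv_comp_G(1)[of "\<psi> z"] \<psi> by (simp add: sol_def)
  qed
  ultimately show thesis by (rule that)
qed

text \<open>On the connected overlap the two solutions differ by one left factor; multiplying
  \<open>\<psi>\<close> by it makes them agree there.\<close>

lemma sol_glue:
  assumes \<phi>: "sol U \<phi>" and \<psi>: "sol V \<psi>" and UV: "open U" "open V" "connected (U \<inter> V)"
  shows "\<exists>\<theta>. sol (U \<union> V) \<theta>"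
proof -
  obtain q where q: "q \<in> G" "\<And>z. z \<in> U \<inter> V - range f \<Longrightarrow> \<phi> z = q \<circ> \<psi> z"
    using sol_unique[OF sol_subset[OF \<phi>] sol_subset[OF \<psi>] open_Int[OF UV(1,2)] UV(3)] by blast
  define \<psi>' where "\<psi>' = (\<lambda>z. q \<circ> \<psi> z)"
  have \<psi>': "sol V \<psi>'" unfolding \<psi>'_def by (rule sol_mult[OF \<psi> q(1)])
  define \<theta> where "\<theta> = (\<lambda>z. if z \<in> U then \<phi> z else \<psi>' z)"
  have \<theta>U: "\<theta> z = \<phi> z" if "z \<in> U" for z using that by (simp add: \<theta>_def)
  \<comment> \<open>On the curve \<open>\<phi>\<close> and \<open>\<psi>'\<close> may disagree even
    inside the overlap. Every argument on \<open>V\<close> is therefore restricted to the complement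
    of the curve, where the sides of a simple point lie anyway.\<close>
  have \<theta>V: "\<theta> z = \<psi>' z" if "z \<in> V - range f" for z using that q(2)[of z] by (auto simp: \<theta>_def \<psi>'_def)
  have lU: "locally_const U \<phi>" and lV: "locally_const V \<psi>'" using \<phi> \<psi>' by (simp_all add: sol_def)
  have "sol (U \<union> V) \<theta>"
    unfolding sol_def
  proof (intro conjI allI impI)
    show "\<theta> z \<in> G" for z using \<phi> \<psi>' by (simp add: \<theta>_def sol_def)
    show "locally_const (U \<union> V) \<theta>"
      unfolding locally_const_def
    proof
      fix z assume z: "z \<in> U \<union> V - range f"
      show "\<forall>\<^sub>F z' in nhds z. \<theta> z' = \<theta> z"
      proof (cases "z \<in> U")
        case True
        have "\<forall>\<^sub>F z' in nhds z. z' \<in> U" using UV(1) True by (rule eventually_nhds_in_open)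
        moreover have "\<forall>\<^sub>F z' in nhds z. \<phi> z' = \<phi> z" using lU z True unfolding locally_const_def by blast
        ultimately show ?thesis by eventually_elim (simp add: \<theta>U True)
      next
        case False
        then have zV: "z \<in> V - range f" using z by blast
        have "\<forall>\<^sub>F z' in nhds z. z' \<in> V - range f"
          using open_Diff[OF UV(2) range_closed] zV by (rule eventually_nhds_in_open)
        moreover have "\<forall>\<^sub>F z' in nhds z. \<psi>' z' = \<psi>' z" using lV zV unfolding locally_const_def by blast
        ultimately show ?thesis by eventually_elim (simp only: \<theta>V[OF zV] \<theta>V)
      qed
    qed
    fix t assume t: "simple t \<and> f t \<in> U \<union> V"
    show "\<exists>a. on_left t {z. \<theta> z = a} \<and> on_right t {z. \<theta> z = a \<circ> J t}"
    proof (cases "f t \<in> U")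
      case True
      then obtain a where a: "on_left t {z. \<phi> z = a}" "on_right t {z. \<phi> z = a \<circ> J t}"
        using \<phi> t unfolding sol_def by blast
      have "on_left t {z. \<theta> z = a}"
        by (rule on_left_mono[OF on_left_Int[OF on_left_open[OF UV(1) True] a(1)]]) (auto simp: \<theta>U)
      moreover have "on_right t {z. \<theta> z = a \<circ> J t}"
        by (rule on_right_mono[OF on_right_Int[OF on_right_open[OF UV(1) True] a(2)]]) (auto simp: \<theta>U)
      ultimately show ?thesis by blast
    next
      case False
      then have tV: "f t \<in> V" using t by blast
      then obtain a where a: "on_left t {z. \<psi>' z = a}" "on_right t {z. \<psi>' z = a \<circ> J t}"
        using \<psi>' t unfolding sol_def by blast
      have s: "simple t" using t by blast
      have "on_left t {z. \<theta> z = a}"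
        by (rule on_left_mono[OF on_left_Int[OF on_left_Int[OF on_left_open[OF UV(2) tV] simple_sides(1)[OF s]] a(1)]])
          (auto simp: \<theta>V)
      moreover have "on_right t {z. \<theta> z = a \<circ> J t}"
        by (rule on_right_mono[OF on_right_Int[OF on_right_Int[OF on_right_open[OF UV(2) tV] simple_sides(2)[OF s]] a(2)]])
          (auto simp: \<theta>V)
      ultimately show ?thesis by blast
    qed
  qed
  then show ?thesis by blast
qed

end

text \<open>The equation in \<open>J_double\<close> says that the four jumps around a crossing compose to the identity.\<close>

locale flat_jump_system = jump_system f G J for f G and J :: "real \<Rightarrow> 'b \<Rightarrow> 'b" +
  assumes J_simple: "simple t \<Longrightarrow> \<exists>\<delta>>0. \<forall>s. \<bar>s\<bar> < \<delta> \<longrightarrow> J (t + s) = J t"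
    and J_periodic: "s - t \<in> \<int> \<Longrightarrow> J s = J t"
    and J_double: "f t1 = f t0 \<Longrightarrow> t1 - t0 \<notin> \<int> \<Longrightarrow> plane_det (velocity f t0) (velocity f t1) > 0 \<Longrightarrow>
      \<exists>\<delta>>0. \<exists>a0 b0 a1 b1. b1 \<circ> b0 = a0 \<circ> a1 \<and>
        (\<forall>s. 0 < s \<and> s < \<delta> \<longrightarrow> J (t0 - s) = a0 \<and> J (t0 + s) = b0 \<and> J (t1 - s) = a1 \<and> J (t1 + s) = b1)"
begin

section \<open>Existence of solutions: local models, then subdivision of rectangles\<close>

lemma sol_local: "\<exists>W \<phi>. open W \<and> p \<in> W \<and> sol W \<phi>"
proof (cases "p \<in> range f")
  case False
  have "sol (- range f) (\<lambda>_. id)"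
    unfolding sol_def locally_const_def using G_id by auto
  moreover have "open (- range f)" using range_closed by (rule open_Compl)
  ultimately show ?thesis using False by blast
next
  case True
  then obtain t where p: "p = f t" by blast
  show ?thesis
  proof (cases "simple t")
    case True
    obtain \<delta> where \<delta>: "\<delta> > 0" "\<And>s. \<bar>s\<bar> < \<delta> \<Longrightarrow> J (t + s) = J t" using J_simple[OF True] by blast
    obtain r W L R where r: "0 < r" "r \<le> \<delta>" "W \<subseteq> UNIV" "f t \<in> W" and nb: "is_simple_nbhd t r W L R"
      by (rule simple_nbhd[OF True open_UNIV UNIV_I \<delta>(1)])
    have W: "open W" "open L" "open R" "L \<inter> R = {}" "W - range f = L \<union> R"
      using nb by (simp_all add: is_simple_nbhd_def)
    have params: "\<And>u. f u \<in> W \<Longrightarrow> \<exists>s. \<bar>s\<bar> < r \<and> u - (t + s) \<in> \<int>"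
      and sides: "\<And>s. \<bar>s\<bar> < r \<Longrightarrow> on_left (t + s) L \<and> on_right (t + s) R"
      using nb unfolding is_simple_nbhd_def by blast+
    define \<phi> where "\<phi> = (\<lambda>z. if z \<in> R then J t else id)"
    have \<phi>: "\<And>z. z \<in> L \<Longrightarrow> \<phi> z = id" "\<And>z. z \<in> R \<Longrightarrow> \<phi> z = J t"
      using W(4) by (auto simp: \<phi>_def)
    have "sol W \<phi>"
      unfolding sol_def
    proof (intro conjI allI impI)
      show "\<phi> z \<in> G" for z using G_id J_in_G by (simp add: \<phi>_def)
      show "locally_const W \<phi>"
        by (rule locally_const_open_cover[of _ "{L, R}"]) (use W \<phi> in auto)
      fix u assume u: "simple u \<and> f u \<in> W"
      then obtain s where s: "\<bar>s\<bar> < r" "u - (t + s) \<in> \<int>" using params by blast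
      have Ju: "J u = J t" using J_periodic[OF s(2)] \<delta>(2)[of s] s(1) r(2) by simp
      have "on_left u {z. \<phi> z = id}"
        unfolding on_left_periodic[OF s(2)]
        by (rule on_left_mono[OF conjunct1[OF sides[OF s(1)]]]) (use \<phi>(1) in auto)
      moreover have "on_right u {z. \<phi> z = id \<circ> J u}"
        unfolding on_right_periodic[OF s(2)] Ju
        by (rule on_right_mono[OF conjunct2[OF sides[OF s(1)]]]) (use \<phi>(2) in auto)
      ultimately show "\<exists>a. on_left u {z. \<phi> z = a} \<and> on_right u {z. \<phi> z = a \<circ> J u}" by blast
    qed
    then show ?thesis using W(1) r(4) p by blast
  next
    case False
    then obtain t0 t1 where tt: "f t0 = f t" "f t1 = f t0" "t1 - t0 \<notin> \<int>"
      "plane_det (velocity f t0) (velocity f t1) > 0" by (rule not_simpleE)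
    obtain \<delta> a0 b0 a1 b1 where \<delta>: "\<delta> > 0" and flat: "b1 \<circ> b0 = a0 \<circ> a1"
      and J_eq: "\<forall>s. 0 < s \<and> s < \<delta> \<longrightarrow> J (t0 - s) = a0 \<and> J (t0 + s) = b0 \<and> J (t1 - s) = a1 \<and> J (t1 + s) = b1"
      using J_double[OF tt(2-4)] by blast
    have J: "J (t0 - s) = a0" "J (t0 + s) = b0" "J (t1 - s) = a1" "J (t1 + s) = b1" if "0 < s" "s < \<delta>" for s
      using J_eq that by simp_all
    have half: "0 < \<delta> / 2" "\<delta> / 2 < \<delta>" using \<delta> by simp_all
    have G: "a0 \<in> G" "b0 \<in> G" "a1 \<in> G" "b1 \<in> G"
      using J_in_G J[OF half] by metis+
    obtain r W A B C D where r: "0 < r" "r \<le> \<delta>" "W \<subseteq> UNIV" and nb: "is_double_nbhd t0 t1 r W A B C D"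
      by (rule double_nbhd[OF tt(2-4) open_UNIV UNIV_I \<delta>])
    have W: "open W" "f t0 \<in> W" "open A" "open B" "open C" "open D"
      "A \<inter> B = {}" "A \<inter> C = {}" "A \<inter> D = {}" "B \<inter> C = {}" "B \<inter> D = {}" "C \<inter> D = {}"
      "W - range f = A \<union> B \<union> C \<union> D"
      using nb by (simp_all add: is_double_nbhd_def)
    have params: "\<And>u. f u \<in> W \<Longrightarrow> simple u \<Longrightarrow> \<exists>s. 0 < s \<and> s < r \<and>
       (u - (t0 + s) \<in> \<int> \<or> u - (t0 - s) \<in> \<int> \<or> u - (t1 + s) \<in> \<int> \<or> u - (t1 - s) \<in> \<int>)"
      and sides: "\<And>s. 0 < s \<Longrightarrow> s < r \<Longrightarrow> on_left (t0 + s) A \<and> on_right (t0 + s) D"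
        "\<And>s. 0 < s \<Longrightarrow> s < r \<Longrightarrow> on_left (t0 - s) B \<and> on_right (t0 - s) C"
        "\<And>s. 0 < s \<Longrightarrow> s < r \<Longrightarrow> on_left (t1 + s) B \<and> on_right (t1 + s) A"
        "\<And>s. 0 < s \<Longrightarrow> s < r \<Longrightarrow> on_left (t1 - s) C \<and> on_right (t1 - s) D"
      using nb unfolding is_double_nbhd_def by blast+
    \<comment> \<open>The value on \<open>B\<close> is chosen to be \<open>id\<close>. Crossing the
      outgoing half of \<open>t1\<close> gives \<open>b1\<close> on \<open>A\<close>, and crossing
      the incoming half of \<open>t0\<close> gives \<open>a0\<close> on \<open>C\<close>. Then
      \<open>D\<close> is reached from \<open>A\<close> with value \<open>b1 \<circ> b0\<close> and
      from \<open>C\<close> with value \<open>a0 \<circ> a1\<close>; these agree by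
      \<open>flat\<close>.\<close>
    define \<phi> where "\<phi> = (\<lambda>z. if z \<in> A then b1 else if z \<in> C then a0 else if z \<in> D then b1 \<circ> b0 else id)"
    have \<phi>: "\<And>z. z \<in> A \<Longrightarrow> \<phi> z = b1" "\<And>z. z \<in> B \<Longrightarrow> \<phi> z = id" "\<And>z. z \<in> C \<Longrightarrow> \<phi> z = a0"
      "\<And>z. z \<in> D \<Longrightarrow> \<phi> z = b1 \<circ> b0"
      using W(7-12) by (auto simp: \<phi>_def)
    have jump: "\<exists>a. on_left u {z. \<phi> z = a} \<and> on_right u {z. \<phi> z = a \<circ> J u}"
      if "u - v \<in> \<int>" "on_left v X" "on_right v Y" "J v = j" "\<And>z. z \<in> X \<Longrightarrow> \<phi> z = a" "\<And>z. z \<in> Y \<Longrightarrow> \<phi> z = a \<circ> j"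
      for u v X Y a j
    proof -
      have "J u = j" using J_periodic[OF that(1)] that(4) by simp
      moreover have "on_left u {z. \<phi> z = a}"
        unfolding on_left_periodic[OF that(1)] by (rule on_left_mono[OF that(2)]) (use that(5) in auto)
      moreover have "on_right u {z. \<phi> z = a \<circ> j}"
        unfolding on_right_periodic[OF that(1)] by (rule on_right_mono[OF that(3)]) (use that(6) in auto)
      ultimately show ?thesis by blast
    qed
    have "sol W \<phi>"
      unfolding sol_def
    proof (intro conjI allI impI)
      show "\<phi> z \<in> G" for z using G_id G G_comp by (simp add: \<phi>_def)
      show "locally_const W \<phi>"
        by (rule locally_const_open_cover[of _ "{A, B, C, D}"]) (use W \<phi> in auto)
      fix u assume u: "simple u \<and> f u \<in> W"
      then obtain s where s: "0 < s" "s < r"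
        "u - (t0 + s) \<in> \<int> \<or> u - (t0 - s) \<in> \<int> \<or> u - (t1 + s) \<in> \<int> \<or> u - (t1 - s) \<in> \<int>"
        using params by blast
      have s\<delta>: "s < \<delta>" using s(2) r(2) by simp
      show "\<exists>a. on_left u {z. \<phi> z = a} \<and> on_right u {z. \<phi> z = a \<circ> J u}"
        using s(3)
      proof (elim disjE)
        assume d: "u - (t0 + s) \<in> \<int>"
        show ?thesis
          by (rule jump[OF d _ _ J(2)[OF s(1) s\<delta>], of A D b1]) (use sides(1)[OF s(1,2)] \<phi> in auto)
      next
        assume d: "u - (t0 - s) \<in> \<int>"
        show ?thesis
          by (rule jump[OF d _ _ J(1)[OF s(1) s\<delta>], of B C id]) (use sides(2)[OF s(1,2)] \<phi> in auto)
      next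
        assume d: "u - (t1 + s) \<in> \<int>"
        show ?thesis
          by (rule jump[OF d _ _ J(4)[OF s(1) s\<delta>], of B A id]) (use sides(3)[OF s(1,2)] \<phi> in auto)
      next
        assume d: "u - (t1 - s) \<in> \<int>"
        show ?thesis
          by (rule jump[OF d _ _ J(3)[OF s(1) s\<delta>], of C D a0]) (use sides(4)[OF s(1,2)] \<phi> flat in auto)
      qed
    qed
    then show ?thesis using W(1,2) tt(1) p by metis
  qed
qed

text \<open>Solutions on rectangles are glued together by two applications of Bolzano's bisection principle;
  the rectangles are thickened so that neighbours overlap in an open rectangle.\<close>

definition thick_sol :: "real \<Rightarrow> real \<Rightarrow> real \<Rightarrow> real \<Rightarrow> bool" where
  "thick_sol a b c d \<longleftrightarrow> (\<exists>\<delta>>0. \<exists>\<phi>. sol (rect (a - \<delta>) (b + \<delta>) (c - \<delta>) (d + \<delta>)) \<phi>)"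

text \<open>The overlap of two open rectangles is convex, hence connected, so solutions on them can
  be glued.\<close>

lemma thick_sol_split:
  assumes "thick_sol a b c d" "thick_sol a' b' c' d'"
    and "\<And>\<delta>. \<delta> > 0 \<Longrightarrow> rect (a'' - \<delta>) (b'' + \<delta>) (c'' - \<delta>) (d'' + \<delta>) \<subseteq>
      rect (a - \<delta>) (b + \<delta>) (c - \<delta>) (d + \<delta>) \<union> rect (a' - \<delta>) (b' + \<delta>) (c' - \<delta>) (d' + \<delta>)"
  shows "thick_sol a'' b'' c'' d''"
proof -
  obtain \<delta>1 \<phi> where 1: "\<delta>1 > 0" "sol (rect (a - \<delta>1) (b + \<delta>1) (c - \<delta>1) (d + \<delta>1)) \<phi>"
    using assms(1) unfolding thick_sol_def by blast
  obtain \<delta>2 \<psi> where 2: "\<delta>2 > 0" "sol (rect (a' - \<delta>2) (b' + \<delta>2) (c' - \<delta>2) (d' + \<delta>2)) \<psi>"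
    using assms(2) unfolding thick_sol_def by blast
  define \<delta> where "\<delta> = min \<delta>1 \<delta>2"
  have \<delta>: "\<delta> > 0" "\<delta> \<le> \<delta>1" "\<delta> \<le> \<delta>2" using 1(1) 2(1) by (auto simp: \<delta>_def)
  have s1: "sol (rect (a - \<delta>) (b + \<delta>) (c - \<delta>) (d + \<delta>)) \<phi>"
    by (rule sol_subset[OF 1(2) rect_mono]) (use \<delta> in auto)
  have s2: "sol (rect (a' - \<delta>) (b' + \<delta>) (c' - \<delta>) (d' + \<delta>)) \<psi>"
    by (rule sol_subset[OF 2(2) rect_mono]) (use \<delta> in auto)
  obtain \<theta> where "sol (rect (a - \<delta>) (b + \<delta>) (c - \<delta>) (d + \<delta>) \<union>
      rect (a' - \<delta>) (b' + \<delta>) (c' - \<delta>) (d' + \<delta>)) \<theta>"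
    using sol_glue[OF s1 s2 open_rect open_rect convex_connected[OF convex_Int[OF convex_rect convex_rect]]]
    by metis
  then have "sol (rect (a'' - \<delta>) (b'' + \<delta>) (c'' - \<delta>) (d'' + \<delta>)) \<theta>"
    by (rule sol_subset) (rule assms(3)[OF \<delta>(1)])
  then show ?thesis unfolding thick_sol_def using \<delta>(1) by metis
qed

lemma thick_sol_vertical:
  assumes "c \<le> d"
  shows "thick_sol x x c d"
  using assms
proof (induction rule: Bolzano)
  case (trans a b c)
  show ?case by (rule thick_sol_split[OF trans(1,2)]) (use trans(3,4) in \<open>auto simp: mem_rect\<close>)
next
  case (local y)
  obtain W \<phi> where W: "open W" "Complex x y \<in> W" "sol W \<phi>" using sol_local by blast
  then obtain e where e: "e > 0" "ball (Complex x y) e \<subseteq> W" using open_contains_ball by metis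
  \<comment> \<open>Both the height and the thickening are bounded by \<open>d\<close>, so points of
    the thickened rectangle differ from the centre by less than \<open>d\<close> horizontally and
    \<open>2 * d\<close> vertically, which keeps them within distance \<open>e\<close>.\<close>
  define d where "d = e / 4"
  have "d > 0" using e(1) by (simp add: d_def)
  moreover have "thick_sol x x a b" if "a \<le> y \<and> y \<le> b \<and> b - a < d" for a b
  proof -
    have "rect (x - d) (x + d) (a - d) (b + d) \<subseteq> ball (Complex x y) e"
    proof
      fix z assume "z \<in> rect (x - d) (x + d) (a - d) (b + d)"
      then have "x - e / 4 < Re z" "Re z < x + e / 4" "a - e / 4 < Im z" "Im z < b + e / 4"
        by (simp_all add: mem_rect d_def)
      then have "\<bar>x - Re z\<bar> < e / 2" "\<bar>y - Im z\<bar> < e / 2"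
        using that e(1) unfolding d_def by linarith+
      then have "\<bar>Re (Complex x y - z)\<bar> < e / 2" "\<bar>Im (Complex x y - z)\<bar> < e / 2"
        by simp_all
      then have "cmod (Complex x y - z) < e" using cmod_le[of "Complex x y - z"] by linarith
      then show "z \<in> ball (Complex x y) e" by (simp add: dist_norm)
    qed
    then show ?thesis
      unfolding thick_sol_def using \<open>d > 0\<close> sol_subset[OF W(3) subset_trans[OF _ e(2)]] by metis
  qed
  ultimately show ?case by blast
qed

lemma thick_sol_all:
  assumes "a \<le> b" "c \<le> d"
  shows "thick_sol a b c d"
  using assms(1)
proof (induction rule: Bolzano)
  case (trans u v w)
  show ?case by (rule thick_sol_split[OF trans(1,2)]) (use trans(3,4) in \<open>auto simp: mem_rect\<close>)
next
  case (local x)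
  obtain \<delta> \<phi> where \<delta>: "\<delta> > 0" "sol (rect (x - \<delta>) (x + \<delta>) (c - \<delta>) (d + \<delta>)) \<phi>"
    using thick_sol_vertical[OF assms(2), of x] unfolding thick_sol_def by blast
  have "thick_sol u v c d" if "u \<le> x \<and> x \<le> v \<and> v - u < \<delta> / 2" for u v
    unfolding thick_sol_def
  proof (intro exI conjI)
    \<comment> \<open>One half of \<open>\<delta>\<close> is spent on the width of the strip, the
      other on its thickening.\<close>
    show "\<delta> / 2 > 0" using \<delta>(1) by simp
    show "sol (rect (u - \<delta> / 2) (v + \<delta> / 2) (c - \<delta> / 2) (d + \<delta> / 2)) \<phi>"
      by (rule sol_subset[OF \<delta>(2) rect_mono]) (use that \<delta>(1) in \<open>auto simp: field_simps\<close>)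
  qed
  then show ?case using \<delta>(1) by (intro exI[of _ "\<delta> / 2"]) auto
qed

end

section \<open>Transporting colourings\<close>

lemma plane_det_swap: "plane_det a b = - plane_det b a"
  by (simp add: plane_det_def)

context jump_system
begin

section \<open>One-sided limits of a solution along the curve\<close>

definition left_val :: "(complex \<Rightarrow> 'b \<Rightarrow> 'b) \<Rightarrow> real \<Rightarrow> 'b \<Rightarrow> 'b" where
  "left_val \<phi> t = (THE a. on_left t {z. \<phi> z = a})"

lemma left_valI:
  assumes "on_left t S" "\<And>z. z \<in> S \<Longrightarrow> \<phi> z = a"
  shows "left_val \<phi> t = a"
  unfolding left_val_def
proof (rule the_equality)
  show a: "on_left t {z. \<phi> z = a}" by (rule on_left_mono[OF assms(1)]) (use assms(2) in auto)
  show "b = a" if "on_left t {z. \<phi> z = b}" for b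
    using on_left_ex[OF on_left_Int[OF a that]] by auto
qed

lemma left_val:
  assumes "sol U \<phi>" "simple t" "f t \<in> U"
  shows "on_left t {z. \<phi> z = left_val \<phi> t}" "on_right t {z. \<phi> z = left_val \<phi> t \<circ> J t}"
proof -
  obtain a where a: "on_left t {z. \<phi> z = a}" "on_right t {z. \<phi> z = a \<circ> J t}"
    using assms unfolding sol_def by blast
  have "left_val \<phi> t = a" by (rule left_valI[OF a(1)]) simp
  then show "on_left t {z. \<phi> z = left_val \<phi> t}" "on_right t {z. \<phi> z = left_val \<phi> t \<circ> J t}"
    using a by simp_all
qed

lemma left_val_in_G:
  assumes "sol U \<phi>" "simple t" "f t \<in> U"
  shows "left_val \<phi> t \<in> G"
proof -
  obtain z where "\<phi> z = left_val \<phi> t" using on_left_ex[OF left_val(1)[OF assms]] by blast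
  then show ?thesis using assms(1) unfolding sol_def by metis
qed

lemma right_valI:
  assumes "sol U \<phi>" "simple t" "f t \<in> U" "on_right t S" "\<And>z. z \<in> S \<Longrightarrow> \<phi> z = a"
  shows "left_val \<phi> t \<circ> J t = a"
proof -
  obtain z where "z \<in> S" "\<phi> z = left_val \<phi> t \<circ> J t"
    using on_right_ex[OF on_right_Int[OF assms(4) left_val(2)[OF assms(1-3)]]] by blast
  then show ?thesis using assms(5) by simp
qed

lemma left_val_periodic: "s - t \<in> \<int> \<Longrightarrow> left_val \<phi> s = left_val \<phi> t"
  unfolding left_val_def using on_left_periodic by simp

lemma left_val_simple:
  assumes \<phi>: "sol U \<phi>" and U: "open U" and t: "simple t" "f t \<in> U"
  shows "\<exists>\<delta>>0. \<forall>s. \<bar>s\<bar> < \<delta> \<longrightarrow> simple (t + s) \<and> left_val \<phi> (t + s) = left_val \<phi> t"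
proof -
  obtain r W L R where r: "0 < r" "r \<le> 1" "W \<subseteq> U" "f t \<in> W" and nb: "is_simple_nbhd t r W L R"
    by (rule simple_nbhd[OF t(1) U t(2) zero_less_one])
  have "connected L" "L \<subseteq> U - range f" using nb r(3) by (auto simp: is_simple_nbhd_def)
  then obtain c where c: "\<And>z. z \<in> L \<Longrightarrow> \<phi> z = c"
    using locally_const_connected[of U \<phi> L] \<phi> by (auto simp: sol_def)
  have nbs: "simple (t + s)" "on_left (t + s) L" if "\<bar>s\<bar> < r" for s
    using nb that unfolding is_simple_nbhd_def by simp_all
  have lv: "left_val \<phi> (t + s) = c" if "\<bar>s\<bar> < r" for s
    by (rule left_valI[OF nbs(2)[OF that] c])
  show ?thesis
    using lv[of 0] lv nbs(1) r(1) by (intro exI[of _ r]) simp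
qed

text \<open>The value \<open>c\<close> belongs to the quadrant \<open>B\<close>, which lies to the
  left of the incoming half of \<open>t0\<close> and of the outgoing half of \<open>t1\<close>. The
  quadrants to the left of the other two half-strands are its neighbours, so their values are
  \<open>c\<close> followed by a single jump.\<close>

lemma left_val_double:
  assumes \<phi>: "sol U \<phi>" and U: "open U" and t: "f t0 \<in> U" "f t1 = f t0" "t1 - t0 \<notin> \<int>"
    "plane_det (velocity f t0) (velocity f t1) > 0"
  shows "\<exists>\<delta>>0. \<exists>c. \<forall>s. 0 < s \<and> s < \<delta> \<longrightarrow>
    left_val \<phi> (t0 - s) = c \<and> left_val \<phi> (t1 + s) = c \<and>
    left_val \<phi> (t0 + s) = c \<circ> J (t1 + s) \<and> left_val \<phi> (t1 - s) = c \<circ> J (t0 - s) \<and> c \<in> G \<and>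
    simple (t0 - s) \<and> simple (t0 + s) \<and> simple (t1 - s) \<and> simple (t1 + s)"
proof -
  obtain r W A B C D where r: "0 < r" "r \<le> 1" "W \<subseteq> U" and nb: "is_double_nbhd t0 t1 r W A B C D"
    by (rule double_nbhd[OF t(2-4) U t(1) zero_less_one])
  have con: "connected A" "connected B" "connected C" "A \<subseteq> U - range f" "B \<subseteq> U - range f" "C \<subseteq> U - range f"
    using nb r(3) by (auto simp: is_double_nbhd_def)
  have lc: "locally_const U \<phi>" using \<phi> by (simp add: sol_def)
  obtain a where a: "\<And>z. z \<in> A \<Longrightarrow> \<phi> z = a" using locally_const_connected[OF lc con(1,4)] by auto
  obtain b where b: "\<And>z. z \<in> B \<Longrightarrow> \<phi> z = b" using locally_const_connected[OF lc con(2,5)] by auto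
  obtain c where c: "\<And>z. z \<in> C \<Longrightarrow> \<phi> z = c" using locally_const_connected[OF lc con(3,6)] by auto
  have "left_val \<phi> (t0 - s) = b \<and> left_val \<phi> (t1 + s) = b \<and>
    left_val \<phi> (t0 + s) = b \<circ> J (t1 + s) \<and> left_val \<phi> (t1 - s) = b \<circ> J (t0 - s) \<and> b \<in> G \<and>
    simple (t0 - s) \<and> simple (t0 + s) \<and> simple (t1 - s) \<and> simple (t1 + s)" if "0 < s \<and> s < r" for s
  proof -
    have s0p: "simple (t0 + s)" "on_left (t0 + s) A"
      and s0m: "simple (t0 - s)" "f (t0 - s) \<in> W" "on_left (t0 - s) B" "on_right (t0 - s) C"
      and s1p: "simple (t1 + s)" "f (t1 + s) \<in> W" "on_left (t1 + s) B" "on_right (t1 + s) A"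
      and s1m: "simple (t1 - s)" "on_left (t1 - s) C"
      using nb that unfolding is_double_nbhd_def by simp_all
    have l: "left_val \<phi> (t0 - s) = b" "left_val \<phi> (t1 + s) = b" "left_val \<phi> (t0 + s) = a" "left_val \<phi> (t1 - s) = c"
      using left_valI[OF s0m(3) b] left_valI[OF s1p(3) b] left_valI[OF s0p(2) a] left_valI[OF s1m(2) c]
      by simp_all
    have fU: "f (t0 - s) \<in> U" "f (t1 + s) \<in> U" using s0m(2) s1p(2) r(3) by auto
    have "b \<circ> J (t0 - s) = c" using right_valI[OF \<phi> s0m(1) fU(1) s0m(4) c] l(1) by simp
    moreover have "b \<circ> J (t1 + s) = a" using right_valI[OF \<phi> s1p(1) fU(2) s1p(4) a] l(2) by simp
    moreover have "b \<in> G" using left_val_in_G[OF \<phi> s0m(1) fU(1)] l(1) by simp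
    ultimately show ?thesis using l s0p s0m s1p s1m by simp
  qed
  then show ?thesis using r(1) by metis
qed

end

text \<open>Left multiplication is the only freedom off the curve, and prescribing the value at one
  point uses it up. Thickness is only a device of the construction and is dropped here.\<close>

lemma (in flat_jump_system) sol_normalized:
  assumes "M > 0"
  shows "\<exists>\<phi>. sol (rect (- M) M (- M) M) \<phi> \<and> \<phi> z0 = id"
proof -
  have "thick_sol (- M) M (- M) M" using thick_sol_all assms by simp
  then obtain \<delta> \<phi> where "\<delta> > 0" and \<phi>: "sol (rect (- M - \<delta>) (M + \<delta>) (- M - \<delta>) (M + \<delta>)) \<phi>"
    unfolding thick_sol_def by metis
  have \<phi>': "sol (rect (- M) M (- M) M) \<phi>"
    by (rule sol_subset[OF \<phi> rect_mono]) (use \<open>\<delta> > 0\<close> in auto)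
  have G0: "\<phi> z0 \<in> G" using \<phi> by (simp add: sol_def)
  show ?thesis
    using sol_mult[OF \<phi>' G_inv[OF G0]] inv_comp_G(1)[OF G0]
    by (intro exI[of _ "\<lambda>z. inv (\<phi> z0) \<circ> \<phi> z"]) simp
qed

section \<open>Colourings of the parameter line and their transport\<close>

locale curve_quandle = generic_curve f + quandle_target T for f and T :: "'b quandle_struct"
begin

text \<open>The strand through \<open>t\<close> passes over the one through \<open>u\<close>, and \<open>\<sigma>\<close> holds iff the crossing is positive.\<close>

definition crossing_rule :: "bool \<Rightarrow> (real \<Rightarrow> 'b) \<Rightarrow> real \<Rightarrow> real \<Rightarrow> bool" where
  "crossing_rule \<sigma> C t u \<longleftrightarrow> (\<exists>\<delta>>0. \<exists>y x x'.
     (\<forall>s. 0 < s \<and> s < \<delta> \<longrightarrow> C (t - s) = y \<and> C (t + s) = y \<and> C (u - s) = x \<and> C (u + s) = x') \<and>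
     (if \<sigma> then x \<triangleright> y = x' else x' \<triangleright> y = x))"

text \<open>At double parameters only periodicity and membership in \<open>Q\<close> are required.
  The crossing rules speak of the values just before and just after, so the value at the crossing
  itself may be chosen freely.\<close>

definition param_colouring :: "(real \<Rightarrow> 'b) \<Rightarrow> bool" where
  "param_colouring C \<longleftrightarrow> (\<forall>t. C t \<in> Q) \<and> (\<forall>s t. s - t \<in> \<int> \<longrightarrow> C s = C t) \<and>
     (\<forall>t. simple t \<longrightarrow> (\<exists>\<delta>>0. \<forall>s. \<bar>s\<bar> < \<delta> \<longrightarrow> C (t + s) = C t))"

definition upper_colouring :: "real set \<Rightarrow> (real \<Rightarrow> 'b) \<Rightarrow> bool" where
  "upper_colouring Ov C \<longleftrightarrow> param_colouring C \<and>
     (\<forall>t u. f t = f u \<and> t - u \<notin> \<int> \<and> frac t \<in> Ov \<longrightarrow>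
        crossing_rule (plane_det (velocity f t) (velocity f u) > 0) C t u)"

text \<open>The two strands exchange roles, but the sign remains that of the original crossing, in
  accordance with the lower quandle.\<close>

definition lower_colouring :: "real set \<Rightarrow> (real \<Rightarrow> 'b) \<Rightarrow> bool" where
  "lower_colouring Ov D \<longleftrightarrow> param_colouring D \<and>
     (\<forall>t u. f t = f u \<and> t - u \<notin> \<int> \<and> frac t \<in> Ov \<longrightarrow>
        crossing_rule (plane_det (velocity f t) (velocity f u) > 0) D u t)"

lemma crossing_ruleE:
  assumes "crossing_rule \<sigma> C t u" "\<And>t. C t \<in> Q"
  obtains \<delta> y x x' where "\<delta> > 0"
    "\<forall>s. 0 < s \<and> s < \<delta> \<longrightarrow> C (t - s) = y \<and> C (t + s) = y \<and> C (u - s) = x \<and> C (u + s) = x'"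
    "y \<in> Q" "x \<in> Q" "x' \<in> Q" "if \<sigma> then x \<triangleright> y = x' else x' \<triangleright> y = x"
proof -
  obtain \<delta> y x x' where \<delta>: "\<delta> > 0"
    and C: "\<forall>s. 0 < s \<and> s < \<delta> \<longrightarrow> C (t - s) = y \<and> C (t + s) = y \<and> C (u - s) = x \<and> C (u + s) = x'"
    and rel: "if \<sigma> then x \<triangleright> y = x' else x' \<triangleright> y = x"
    using assms(1) unfolding crossing_rule_def by blast
  have "C (t - \<delta> / 2) = y \<and> C (t + \<delta> / 2) = y \<and> C (u - \<delta> / 2) = x \<and> C (u + \<delta> / 2) = x'"
    using C \<delta> by simp
  then have "y \<in> Q" "x \<in> Q" "x' \<in> Q" using assms(2) by metis+
  then show thesis using that[of \<delta> y x x'] \<delta> C rel by blast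
qed

text \<open>The colouring rule enters through \<open>rtrans_op\<close>: with
  \<open>x \<triangleright> y = x'\<close> the translations satisfy
  \<open>rtrans x' \<circ> rtrans y = rtrans y \<circ> rtrans x\<close>, which is the equation
  required of the four half-strands. At a negative crossing the underpass is the first strand of the
  positively oriented pair, and the same identity is read with \<open>x\<close> and
  \<open>x'\<close> exchanged.\<close>

lemma flat_jumps:
  assumes C: "upper_colouring Ov C"
    and Ov: "\<And>t u. f t = f u \<Longrightarrow> t - u \<notin> \<int> \<Longrightarrow> frac t \<in> Ov \<longleftrightarrow> frac u \<notin> Ov"
  shows "flat_jump_system f auts (\<lambda>t. rtrans (C t))"
proof
  have CQ: "\<And>t. C t \<in> Q" and Cp: "\<And>s t. s - t \<in> \<int> \<Longrightarrow> C s = C t"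
    and Cs: "\<And>t. simple t \<Longrightarrow> \<exists>\<delta>>0. \<forall>s. \<bar>s\<bar> < \<delta> \<longrightarrow> C (t + s) = C t"
    using C by (simp_all add: upper_colouring_def param_colouring_def)
  show "rtrans (C t) \<in> auts" for t by (rule rtrans_auts[OF CQ])
  show "\<exists>\<delta>>0. \<forall>s. \<bar>s\<bar> < \<delta> \<longrightarrow> rtrans (C (t + s)) = rtrans (C t)" if "simple t" for t
    using Cs[OF that] by metis
  show "rtrans (C s) = rtrans (C t)" if "s - t \<in> \<int>" for s t
    using Cp[OF that] by simp
  fix t1 t0 assume t: "f t1 = f t0" "t1 - t0 \<notin> \<int>" and det: "plane_det (velocity f t0) (velocity f t1) > 0"
  show "\<exists>\<delta>>0. \<exists>a0 b0 a1 b1. b1 \<circ> b0 = a0 \<circ> a1 \<and>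
        (\<forall>s. 0 < s \<and> s < \<delta> \<longrightarrow> rtrans (C (t0 - s)) = a0 \<and> rtrans (C (t0 + s)) = b0 \<and>
          rtrans (C (t1 - s)) = a1 \<and> rtrans (C (t1 + s)) = b1)"
  proof (cases "frac t0 \<in> Ov")
    case True
    have "crossing_rule True C t0 t1"
      using C t det True Ints_diff_commute[of t0 t1] unfolding upper_colouring_def by metis
    then obtain \<delta> y x x' where \<delta>: "\<delta> > 0"
      and Cv: "\<forall>s. 0 < s \<and> s < \<delta> \<longrightarrow> C (t0 - s) = y \<and> C (t0 + s) = y \<and> C (t1 - s) = x \<and> C (t1 + s) = x'"
      and yx: "y \<in> Q" "x \<in> Q" "x' \<in> Q" and rel: "if True then x \<triangleright> y = x' else x' \<triangleright> y = x"
      using CQ by (rule crossing_ruleE)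
    have "rtrans x' \<circ> rtrans y = rtrans y \<circ> rtrans x"
      using rtrans_op[of x y] yx rel by simp
    then show ?thesis
      using \<delta> Cv by (intro exI[of _ \<delta>] conjI exI[of _ "rtrans y"] exI[of _ "rtrans x"] exI[of _ "rtrans x'"]) auto
  next
    case False
    then have ov: "frac t1 \<in> Ov" using Ov[OF t] by simp
    have "\<not> plane_det (velocity f t1) (velocity f t0) > 0"
      using det plane_det_swap[of "velocity f t1"] by simp
    then have "crossing_rule False C t1 t0"
      using C t ov unfolding upper_colouring_def by metis
    then obtain \<delta> y x x' where \<delta>: "\<delta> > 0"
      and Cv: "\<forall>s. 0 < s \<and> s < \<delta> \<longrightarrow> C (t1 - s) = y \<and> C (t1 + s) = y \<and> C (t0 - s) = x \<and> C (t0 + s) = x'"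
      and yx: "y \<in> Q" "x \<in> Q" "x' \<in> Q" and rel: "if False then x \<triangleright> y = x' else x' \<triangleright> y = x"
      using CQ by (rule crossing_ruleE)
    have "rtrans y \<circ> rtrans x' = rtrans x \<circ> rtrans y"
      using rtrans_op[of x' y] yx rel by simp
    then show ?thesis
      using \<delta> Cv by (intro exI[of _ \<delta>] conjI exI[of _ "rtrans x"] exI[of _ "rtrans x'"] exI[of _ "rtrans y"]) auto
  qed
qed (use auts_bij auts_id auts_comp auts_inv in auto)

text \<open>The description is \<open>left_val\<close>, spelled out because the definition is made
  outside a jump system. At double parameters \<open>C t\<close> is merely a periodic value in
  \<open>Q\<close>.\<close>

definition transport :: "(complex \<Rightarrow> 'b \<Rightarrow> 'b) \<Rightarrow> (real \<Rightarrow> 'b) \<Rightarrow> real \<Rightarrow> 'b" where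
  "transport \<phi> C t = (if simple t then (THE a. on_left t {z. \<phi> z = a}) (C t) else C t)"

text \<open>Let \<open>c\<close> be the value from \<open>left_val_double\<close>. At a positive
  crossing the underpass receives \<open>c (x \<triangleright> y)\<close> before and
  \<open>c x'\<close> after, which are equal, while the overpass changes from \<open>c y\<close> to
  \<open>c (y \<triangleright> x')\<close>. Since \<open>c\<close> is an automorphism, this is the
  lower rule.\<close>

lemma transport_lower:
  assumes C: "upper_colouring Ov C"
    and Ov: "\<And>t u. f t = f u \<Longrightarrow> t - u \<notin> \<int> \<Longrightarrow> frac t \<in> Ov \<longleftrightarrow> frac u \<notin> Ov"
    and U: "open U" "range f \<subseteq> U"
    and \<phi>: "jump_system.sol f auts (\<lambda>t. rtrans (C t)) U \<phi>"
  shows "lower_colouring Ov (transport \<phi> C)"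
proof -
  interpret flat_jump_system f auts "\<lambda>t. rtrans (C t)" by (rule flat_jumps[OF C Ov])
  have CQ: "\<And>t. C t \<in> Q" and Cp: "\<And>s t. s - t \<in> \<int> \<Longrightarrow> C s = C t"
    and Cs: "\<And>t. simple t \<Longrightarrow> \<exists>\<delta>>0. \<forall>s. \<bar>s\<bar> < \<delta> \<longrightarrow> C (t + s) = C t"
    using C by (simp_all add: upper_colouring_def param_colouring_def)
  have fU: "f t \<in> U" for t using U(2) by blast
  define D where "D = transport \<phi> C"
  have Ds: "D t = left_val \<phi> t (C t)" if "simple t" for t
    using that by (simp add: D_def transport_def left_val_def)
  have "param_colouring D"
    unfolding param_colouring_def
  proof (intro conjI allI impI)
    show "D t \<in> Q" for t
      using left_val_in_G[OF \<phi> _ fU] auts_carrier CQ Ds by (cases "simple t") (auto simp: D_def transport_def)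
    show "D s = D t" if "s - t \<in> \<int>" for s t
      using simple_periodic[OF that] left_val_periodic[OF that] Cp[OF that]
      by (simp add: D_def transport_def left_val_def)
    fix t assume t: "simple t"
    obtain \<delta> where \<delta>: "\<delta> > 0" "\<forall>s. \<bar>s\<bar> < \<delta> \<longrightarrow> simple (t + s) \<and> left_val \<phi> (t + s) = left_val \<phi> t"
      using left_val_simple[OF \<phi> U(1) t fU] by blast
    obtain \<delta>' where \<delta>': "\<delta>' > 0" "\<forall>s. \<bar>s\<bar> < \<delta>' \<longrightarrow> C (t + s) = C t" using Cs[OF t] by blast
    show "\<exists>\<delta>>0. \<forall>s. \<bar>s\<bar> < \<delta> \<longrightarrow> D (t + s) = D t"
      using \<delta> \<delta>' t by (intro exI[of _ "min \<delta> \<delta>'"]) (simp add: Ds)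
  qed
  moreover have "crossing_rule (plane_det (velocity f t) (velocity f u) > 0) D u t"
    if tu: "f t = f u" "t - u \<notin> \<int>" "frac t \<in> Ov" for t u
  proof (cases "plane_det (velocity f t) (velocity f u) > 0")
    case True
    have "crossing_rule True C t u" using C tu True unfolding upper_colouring_def by metis
    then obtain \<delta> y x x' where \<delta>: "\<delta> > 0"
      and Cv: "\<forall>s. 0 < s \<and> s < \<delta> \<longrightarrow> C (t - s) = y \<and> C (t + s) = y \<and> C (u - s) = x \<and> C (u + s) = x'"
      and yx: "y \<in> Q" "x \<in> Q" "x' \<in> Q" and rel: "if True then x \<triangleright> y = x' else x' \<triangleright> y = x"
      using CQ by (rule crossing_ruleE)
    have ut: "u - t \<notin> \<int>" using tu(2) Ints_diff_commute by blast
    obtain \<delta>' c where \<delta>': "\<delta>' > 0" and lv: "\<forall>s. 0 < s \<and> s < \<delta>' \<longrightarrow>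
        left_val \<phi> (t - s) = c \<and> left_val \<phi> (u + s) = c \<and>
        left_val \<phi> (t + s) = c \<circ> rtrans (C (u + s)) \<and> left_val \<phi> (u - s) = c \<circ> rtrans (C (t - s)) \<and> c \<in> auts \<and>
        simple (t - s) \<and> simple (t + s) \<and> simple (u - s) \<and> simple (u + s)"
      using left_val_double[OF \<phi> U(1) fU tu(1)[symmetric] ut True] by blast
    have c: "c \<in> auts" using lv[rule_format, of "\<delta>' / 2"] \<delta>' by simp
    have rel': "x \<triangleright> y = x'" using rel by simp
    have "crossing_rule True D u t"
      unfolding crossing_rule_def
    proof (intro exI conjI allI impI)
      show "0 < min \<delta> \<delta>'" using \<delta> \<delta>' by simp
      fix s assume s: "0 < s \<and> s < min \<delta> \<delta>'"
      then have s': "0 < s \<and> s < \<delta>" "0 < s \<and> s < \<delta>'" by auto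
      note l = lv[rule_format, OF s'(2)] Cv[rule_format, OF s'(1)]
      show "D (u - s) = c x'" using l yx rel' by (simp add: Ds rtrans_eq)
      show "D (u + s) = c x'" using l by (simp add: Ds)
      show "D (t - s) = c y" using l by (simp add: Ds)
      show "D (t + s) = c (y \<triangleright> x')" using l yx by (simp add: Ds rtrans_eq)
    next
      show "if True then c y \<triangleright> c x' = c (y \<triangleright> x') else c (y \<triangleright> x') \<triangleright> c x' = c y"
        using auts_op[OF c yx(1,3)] by simp
    qed
    then show ?thesis using True by simp
  next
    case False
    have "crossing_rule False C t u" using C tu False unfolding upper_colouring_def by metis
    then obtain \<delta> y x x' where \<delta>: "\<delta> > 0"
      and Cv: "\<forall>s. 0 < s \<and> s < \<delta> \<longrightarrow> C (t - s) = y \<and> C (t + s) = y \<and> C (u - s) = x \<and> C (u + s) = x'"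
      and yx: "y \<in> Q" "x \<in> Q" "x' \<in> Q" and rel: "if False then x \<triangleright> y = x' else x' \<triangleright> y = x"
      using CQ by (rule crossing_ruleE)
    have "plane_det (velocity f t) (velocity f u) \<noteq> 0" by (rule double_transverse[OF tu(1,2)])
    \<comment> \<open>At a negative crossing \<open>u\<close> takes the role of the first strand in
      \<open>left_val_double\<close>. Now the underpass receives \<open>c x\<close> on both sides,
      and the overpass changes from \<open>c (y \<triangleright> x)\<close> to
      \<open>c y\<close>.\<close>
    then have det: "plane_det (velocity f u) (velocity f t) > 0"
      using False plane_det_swap[of "velocity f u"] by simp
    obtain \<delta>' c where \<delta>': "\<delta>' > 0" and lv: "\<forall>s. 0 < s \<and> s < \<delta>' \<longrightarrow>
        left_val \<phi> (u - s) = c \<and> left_val \<phi> (t + s) = c \<and>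
        left_val \<phi> (u + s) = c \<circ> rtrans (C (t + s)) \<and> left_val \<phi> (t - s) = c \<circ> rtrans (C (u - s)) \<and> c \<in> auts \<and>
        simple (u - s) \<and> simple (u + s) \<and> simple (t - s) \<and> simple (t + s)"
      using left_val_double[OF \<phi> U(1) fU tu(1,2) det] by blast
    have c: "c \<in> auts" using lv[rule_format, of "\<delta>' / 2"] \<delta>' by simp
    have rel': "x' \<triangleright> y = x" using rel by simp
    have "crossing_rule False D u t"
      unfolding crossing_rule_def
    proof (intro exI conjI allI impI)
      show "0 < min \<delta> \<delta>'" using \<delta> \<delta>' by simp
      fix s assume s: "0 < s \<and> s < min \<delta> \<delta>'"
      then have s': "0 < s \<and> s < \<delta>" "0 < s \<and> s < \<delta>'" by auto
      note l = lv[rule_format, OF s'(2)] Cv[rule_format, OF s'(1)]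
      show "D (u - s) = c x" using l by (simp add: Ds)
      show "D (u + s) = c x" using l yx rel' by (simp add: Ds rtrans_eq)
      show "D (t - s) = c (y \<triangleright> x)" using l yx by (simp add: Ds rtrans_eq)
      show "D (t + s) = c y" using l by (simp add: Ds)
    next
      show "if False then c (y \<triangleright> x) \<triangleright> c x = c y else c y \<triangleright> c x = c (y \<triangleright> x)"
        using auts_op[OF c yx(1,2)] by simp
    qed
    then show ?thesis using False by simp
  qed
  ultimately show ?thesis unfolding lower_colouring_def D_def by blast
qed

text \<open>With \<open>l\<close> the limit from the left and \<open>D t = l (C t)\<close>,
  naturality turns the limit from the right, \<open>l \<circ> rtrans (C t)\<close>, into
  \<open>rtrans (D t) \<circ> l\<close>. Its inverse is \<open>inv l\<close> followed by a jump
  depending on \<open>D\<close> alone. \<open>D\<close> is prescribed only at simple parameters, so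
  that one and the same \<open>D\<close> can serve two colourings with equal transports.\<close>

lemma transport_inverse_sol:
  assumes C: "upper_colouring Ov C"
    and Ov: "\<And>t u. f t = f u \<Longrightarrow> t - u \<notin> \<int> \<Longrightarrow> frac t \<in> Ov \<longleftrightarrow> frac u \<notin> Ov"
    and U: "range f \<subseteq> U"
    and \<phi>: "jump_system.sol f auts (\<lambda>t. rtrans (C t)) U \<phi>"
    and D: "\<And>t. D t \<in> Q" "\<And>t. simple t \<Longrightarrow> D t = transport \<phi> C t"
  shows "jump_system f auts (\<lambda>t. inv (rtrans (D t)))"
    and "jump_system.sol f auts (\<lambda>t. inv (rtrans (D t))) U (\<lambda>z. inv (\<phi> z))"
proof -
  interpret flat_jump_system f auts "\<lambda>t. rtrans (C t)" by (rule flat_jumps[OF C Ov])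
  interpret K: jump_system f auts "\<lambda>t. inv (rtrans (D t))"
    by unfold_locales (use auts_bij auts_id auts_comp auts_inv rtrans_auts D(1) in auto)
  show "jump_system f auts (\<lambda>t. inv (rtrans (D t)))" ..
  have CQ: "\<And>t. C t \<in> Q" using C by (simp add: upper_colouring_def param_colouring_def)
  have fU: "f t \<in> U" for t using U by blast
  show "K.sol U (\<lambda>z. inv (\<phi> z))"
    unfolding K.sol_def
  proof (intro conjI allI impI)
    show "inv (\<phi> z) \<in> auts" for z using \<phi> G_inv by (simp add: sol_def)
    show "locally_const U (\<lambda>z. inv (\<phi> z))"
      unfolding locally_const_def
    proof
      fix z assume "z \<in> U - range f"
      then have "\<forall>\<^sub>F z' in nhds z. \<phi> z' = \<phi> z" using \<phi> by (simp add: sol_def locally_const_def)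
      then show "\<forall>\<^sub>F z' in nhds z. inv (\<phi> z') = inv (\<phi> z)" by (rule eventually_mono) simp
    qed
    fix t assume t: "simple t \<and> f t \<in> U"
    then have st: "simple t" by simp
    define l where "l = left_val \<phi> t"
    have l: "on_left t {z. \<phi> z = l}" "on_right t {z. \<phi> z = l \<circ> rtrans (C t)}"
      unfolding l_def by (rule left_val[OF \<phi> st fU])+
    have lG: "l \<in> auts" unfolding l_def by (rule left_val_in_G[OF \<phi> st fU])
    have "D t = l (C t)" using D(2)[OF st] st by (simp add: transport_def l_def left_val_def)
    then have "l \<circ> rtrans (C t) = rtrans (D t) \<circ> l" using auts_rtrans[OF lG CQ] by simp
    then have inv: "inv (l \<circ> rtrans (C t)) = inv l \<circ> inv (rtrans (D t))"
      using o_inv_distrib[OF auts_bij[OF rtrans_auts[OF D(1)]] auts_bij[OF lG]] by simp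
    have "on_left t {z. inv (\<phi> z) = inv l}" by (rule on_left_mono[OF l(1)]) auto
    moreover have "on_right t {z. inv (\<phi> z) = inv l \<circ> inv (rtrans (D t))}"
      unfolding inv[symmetric] by (rule on_right_mono[OF l(2)]) auto
    ultimately show "\<exists>a. on_left t {z. inv (\<phi> z) = a} \<and> on_right t {z. inv (\<phi> z) = a \<circ> inv (rtrans (D t))}"
      by blast
  qed
qed

text \<open>The inverse of a solution solves the jump problem determined by the transported colouring, so
  the latter determines the solution, and with it the original colouring.\<close>

lemma transport_inj:
  assumes C: "upper_colouring Ov C" and C': "upper_colouring Ov C'"
    and Ov: "\<And>t u. f t = f u \<Longrightarrow> t - u \<notin> \<int> \<Longrightarrow> frac t \<in> Ov \<longleftrightarrow> frac u \<notin> Ov"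
    and U: "open U" "connected U" "range f \<subseteq> U" "z0 \<in> U - range f"
    and \<phi>: "jump_system.sol f auts (\<lambda>t. rtrans (C t)) U \<phi>" "\<phi> z0 = id"
    and \<phi>': "jump_system.sol f auts (\<lambda>t. rtrans (C' t)) U \<phi>'" "\<phi>' z0 = id"
    and eq: "\<And>t. simple t \<Longrightarrow> transport \<phi> C t = transport \<phi>' C' t"
    and t: "simple t"
  shows "C t = C' t"
proof -
  interpret J: flat_jump_system f auts "\<lambda>t. rtrans (C t)" by (rule flat_jumps[OF C Ov])
  interpret J': flat_jump_system f auts "\<lambda>t. rtrans (C' t)" by (rule flat_jumps[OF C' Ov])
  define D where "D = transport \<phi> C"
  have DQ: "D t \<in> Q" for t
    using transport_lower[OF C Ov U(1,3) \<phi>(1)] by (simp add: D_def lower_colouring_def param_colouring_def)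
  interpret K: jump_system f auts "\<lambda>t. inv (rtrans (D t))"
    by (rule transport_inverse_sol(1)[OF C Ov U(3) \<phi>(1) DQ]) (simp_all add: D_def)
  have 1: "K.sol U (\<lambda>z. inv (\<phi> z))"
    by (rule transport_inverse_sol(2)[OF C Ov U(3) \<phi>(1) DQ]) (simp_all add: D_def)
  have 2: "K.sol U (\<lambda>z. inv (\<phi>' z))"
    by (rule transport_inverse_sol(2)[OF C' Ov U(3) \<phi>'(1) DQ]) (simp_all add: D_def eq)
  obtain q where q: "\<And>z. z \<in> U - range f \<Longrightarrow> inv (\<phi> z) = q \<circ> inv (\<phi>' z)"
    using K.sol_unique[OF 1 2 U(1,2)] by blast
  \<comment> \<open>The normalisation at \<open>z0\<close> enters here.\<close>
  have "q = id" using q[OF U(4)] \<phi>(2) \<phi>'(2) by simp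
  then have same: "\<phi> z = \<phi>' z" if "z \<in> U - range f" for z
  proof -
    have "inv (inv (\<phi> z)) = inv (inv (\<phi>' z))" using q[OF that] \<open>q = id\<close> by simp
    moreover have "bij (\<phi> z)" "bij (\<phi>' z)"
      using \<phi>(1) \<phi>'(1) auts_bij unfolding J.sol_def J'.sol_def by blast+
    ultimately show ?thesis by (simp add: inv_inv_eq)
  qed
  have ft: "f t \<in> U" using U(3) by blast
  define l where "l = J.left_val \<phi> t"
  have l: "on_left t {z. \<phi> z = l}" unfolding l_def by (rule J.left_val(1)[OF \<phi>(1) t ft])
  have lG: "l \<in> auts" unfolding l_def by (rule J.left_val_in_G[OF \<phi>(1) t ft])
  have "on_left t ({z. \<phi> z = l} \<inter> (U \<inter> - range f))"
    by (rule on_left_Int[OF l on_left_Int[OF on_left_open[OF U(1) ft] simple_sides(1)[OF t]]])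
  then have "J'.left_val \<phi>' t = l"
    by (rule J'.left_valI) (use same in auto)
  then have "l (C t) = l (C' t)"
    using eq[OF t] t by (simp add: transport_def l_def J.left_val_def J'.left_val_def)
  then show ?thesis using auts_bij[OF lG] by (meson bij_is_inj injD)
qed

end

section \<open>Colourings of codes and of diagrams\<close>

text \<open>\<open>E p\<close> is the colour just before position \<open>p\<close>, so \<open>E 0\<close> and \<open>E (length w)\<close> belong to the same arc.\<close>

definition colourings :: "'b quandle_struct \<Rightarrow> code \<Rightarrow> (nat \<Rightarrow> 'b) set" where
  "colourings T w = {E \<in> {..length w} \<rightarrow>\<^sub>E qcarrier T. E 0 = E (length w) \<and>
     (\<forall>p<length w. is_over (w ! p) \<longrightarrow> E (Suc p) = E p) \<and>
     (\<forall>p<length w. \<forall>q<length w. \<forall>X.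
        (w ! p = Under X 1 \<and> w ! q = Over X 1 \<longrightarrow> qop T (E p) (E q) = E (Suc p)) \<and>
        (w ! p = Under X (-1) \<and> w ! q = Over X (-1) \<longrightarrow> qop T (E (Suc p)) (E q) = E p))}"

lemma is_over_swap: "is_over (swap_letter l) \<longleftrightarrow> \<not> is_over l"
  by (cases l) auto

lemma finite_colourings: "finite (qcarrier T) \<Longrightarrow> finite (colourings T w)"
  by (rule finite_subset[of _ "{..length w} \<rightarrow>\<^sub>E qcarrier T"]) (auto simp: colourings_def intro: finite_PiE)

lemma generic_curve_bounded_rect:
  assumes "generic_curve f"
  obtains M z0 where "M > 0" "range f \<subseteq> rect (- M) M (- M) M" "z0 \<in> rect (- M) M (- M) M - range f"
proof -
  interpret generic_curve f by fact
  obtain b where b: "b > 0" "\<forall>z\<in>range f. cmod z < b"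
    using compact_imp_bounded[OF range_compact] bounded_pos_less by metis
  have "range f \<subseteq> rect (- b) b (- b) b"
  proof
    fix z assume "z \<in> range f"
    then have "cmod z < b" using b(2) by blast
    then have "\<bar>Re z\<bar> < b" "\<bar>Im z\<bar> < b"
      using abs_Re_le_cmod[of z] abs_Im_le_cmod[of z] by linarith+
    then show "z \<in> rect (- b) b (- b) b" by (auto simp: mem_rect abs_less_iff)
  qed
  moreover have "0 \<in> rect (- b) b (- b) b" using b(1) by (simp add: mem_rect)
  then obtain z0 where "z0 \<in> rect (- b) b (- b) b - range f"
    using dense_complement[OF open_rect] by (metis ex_in_conv)
  ultimately show thesis using that b(1) by blast
qed

text \<open>A nonempty code guarantees double parameters, which cut a period into gaps. The empty
  word equals its own swap and is treated apart.\<close>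

locale coded_diagram = curve_quandle f T for f and T :: "'b quandle_struct" +
  fixes Ov :: "real set" and w :: code
  assumes diagram: "knot_diagram f Ov" and coded: "gauss_code_of f Ov w"
    and code: "gauss_code w" and nonempty: "w \<noteq> []"
begin

section \<open>Double parameters and positions in the code\<close>

definition ts :: "real list" where "ts = sorted_list_of_set (double_params f)"

lemma finite_doubles: "finite (double_params f)"
  using generic by (simp add: generic_closed_curve_def)

lemma set_ts: "set ts = double_params f" and distinct_ts: "distinct ts" and sorted_ts: "sorted ts"
  using finite_doubles by (simp_all add: ts_def)

lemma length_ts: "length ts = length w"
  using coded by (simp add: gauss_code_of_def Let_def ts_def)

lemma n_pos: "length w > 0"
  using nonempty by simp

lemma ts_double: "i < length w \<Longrightarrow> ts ! i \<in> double_params f"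
  using set_ts length_ts by (metis nth_mem)

lemma doubles_bounds: "x \<in> double_params f \<Longrightarrow> 0 \<le> x \<and> x < 1"
  by (simp add: double_params_def)

lemma ts_bounds: "i < length w \<Longrightarrow> 0 \<le> ts ! i \<and> ts ! i < 1"
  using ts_double doubles_bounds by blast

lemma frac_ts: "i < length w \<Longrightarrow> frac (ts ! i) = ts ! i"
  using ts_bounds by (simp add: frac_eq)

lemma ts_less: "i < j \<Longrightarrow> j < length w \<Longrightarrow> ts ! i < ts ! j"
  using sorted_wrt_nth_less[of "(<)" ts i j] sorted_ts distinct_ts length_ts by (simp add: strict_sorted_iff)

lemma ts_less_iff: "i < length w \<Longrightarrow> j < length w \<Longrightarrow> ts ! i < ts ! j \<longleftrightarrow> i < j"
  using ts_less by (metis linorder_neqE_nat order_less_asym order_less_irrefl)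

lemma double_ts: "x \<in> double_params f \<Longrightarrow> \<exists>i<length w. x = ts ! i"
  using set_ts length_ts by (metis in_set_conv_nth)

text \<open>Together with \<open>cntle\<close> this translates a parameter of one period into a
  position: at the double parameter of the letter \<open>i\<close> the two counts are
  \<open>i\<close> and \<open>Suc i\<close>, the positions before and after that letter.\<close>

definition cnt :: "real \<Rightarrow> nat" where "cnt x = card {s \<in> double_params f. s < x}"

definition cntle :: "real \<Rightarrow> nat" where "cntle x = card {s \<in> double_params f. s \<le> x}"

lemma card_ts_prefix:
  assumes "i \<le> length w"
  shows "card ((!) ts ` {..<i}) = i"
proof -
  have "inj_on ((!) ts) {..<i}"
    using distinct_ts assms length_ts by (auto simp: inj_on_def nth_eq_iff_index_eq)
  then show ?thesis by (simp add: card_image)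
qed

lemma cnt_ts: "i < length w \<Longrightarrow> cnt (ts ! i) = i"
proof -
  assume i: "i < length w"
  have "{s \<in> double_params f. s < ts ! i} = (!) ts ` {..<i}"
  proof
    show "{s \<in> double_params f. s < ts ! i} \<subseteq> (!) ts ` {..<i}"
    proof
      fix s assume "s \<in> {s \<in> double_params f. s < ts ! i}"
      then obtain j where j: "j < length w" "s = ts ! j" "ts ! j < ts ! i" using double_ts by blast
      then show "s \<in> (!) ts ` {..<i}" using ts_less_iff[OF j(1) i] by blast
    qed
    show "(!) ts ` {..<i} \<subseteq> {s \<in> double_params f. s < ts ! i}"
      using ts_less[OF _ i] ts_double i by auto
  qed
  then show ?thesis using card_ts_prefix[of i] i by (simp add: cnt_def)
qed

lemma cntle_ts: "i < length w \<Longrightarrow> cntle (ts ! i) = Suc i"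
proof -
  assume i: "i < length w"
  have "{s \<in> double_params f. s \<le> ts ! i} = (!) ts ` {..<Suc i}"
  proof
    show "{s \<in> double_params f. s \<le> ts ! i} \<subseteq> (!) ts ` {..<Suc i}"
    proof
      fix s assume "s \<in> {s \<in> double_params f. s \<le> ts ! i}"
      then obtain j where j: "j < length w" "s = ts ! j" "\<not> ts ! i < ts ! j" using double_ts by fastforce
      then have "j < Suc i" using ts_less_iff[OF i j(1)] by simp
      then show "s \<in> (!) ts ` {..<Suc i}" using j(2) by blast
    qed
    show "(!) ts ` {..<Suc i} \<subseteq> {s \<in> double_params f. s \<le> ts ! i}"
    proof
      fix s assume "s \<in> (!) ts ` {..<Suc i}"
      then obtain j where j: "j < Suc i" "s = ts ! j" by blast
      then have jn: "j < length w" using i by simp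
      have "\<not> ts ! i < ts ! j" using ts_less_iff[OF i jn] j(1) by simp
      then show "s \<in> {s \<in> double_params f. s \<le> ts ! i}" using j(2) ts_double[OF jn] by simp
    qed
  qed
  then show ?thesis using card_ts_prefix[of "Suc i"] i by (simp add: cntle_def)
qed

lemma card_doubles: "card (double_params f) = length w"
  using set_ts distinct_ts length_ts distinct_card by metis

lemma cnt_le: "cnt x \<le> length w"
  unfolding cnt_def card_doubles[symmetric] by (rule card_mono[OF finite_doubles]) blast

lemma cntle_eq_cnt: "x \<notin> double_params f \<Longrightarrow> cntle x = cnt x"
  unfolding cntle_def cnt_def by (rule arg_cong[of _ _ card]) (auto simp: le_less)

lemma gap: "\<exists>\<delta>>0. \<forall>s\<in>double_params f. s \<noteq> x \<longrightarrow> \<delta> \<le> \<bar>s - x\<bar>"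
  using finite_set_avoid[OF finite_doubles, of x] by (auto simp: dist_real_def abs_minus_commute)

section \<open>From colours of positions to colours of parameters\<close>

definition pcol :: "(nat \<Rightarrow> 'b) \<Rightarrow> real \<Rightarrow> 'b" where "pcol E t = E (cnt (frac t))"

lemma pcol_right: "\<exists>\<delta>>0. \<forall>s. 0 < s \<and> s < \<delta> \<longrightarrow> pcol E (t + s) = E (cntle (frac t))"
proof -
  obtain \<delta> where \<delta>: "\<delta> > 0" "\<forall>s\<in>double_params f. s \<noteq> frac t \<longrightarrow> \<delta> \<le> \<bar>s - frac t\<bar>"
    using gap by blast
  have "pcol E (t + s) = E (cntle (frac t))" if s: "0 < s \<and> s < min \<delta> (1 - frac t)" for s
  proof -
    have "t + s - (frac t + s) \<in> \<int>" using frac_diff_Ints(2)[of t] by simp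
    then have fr: "frac (t + s) = frac t + s"
      using s frac_mem[of t] by (intro frac_unique_iff[THEN iffD2]) auto
    have "x < frac t + s \<longleftrightarrow> x \<le> frac t" if "x \<in> double_params f" for x
      using \<delta>(2)[rule_format, OF that] s by (cases "x = frac t") (auto simp: abs_if split: if_splits)
    then have "{x \<in> double_params f. x < frac t + s} = {x \<in> double_params f. x \<le> frac t}" by blast
    then show ?thesis by (simp add: pcol_def fr cnt_def cntle_def)
  qed
  moreover have "0 < min \<delta> (1 - frac t)" using \<delta>(1) frac_mem[of t] by simp
  ultimately show ?thesis by blast
qed

text \<open>Away from integers the strict count does not change just before \<open>t\<close>. At an
  integer the points just before lie at the end of the preceding period and carry
  \<open>E (length w)\<close>, whence the hypothesis.\<close>

lemma pcol_left:
  assumes "E 0 = E (length w)"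
  shows "\<exists>\<delta>>0. \<forall>s. 0 < s \<and> s < \<delta> \<longrightarrow> pcol E (t - s) = pcol E t"
proof -
  obtain \<delta> where \<delta>: "\<delta> > 0" "\<forall>s\<in>double_params f. s \<noteq> frac t \<longrightarrow> \<delta> \<le> \<bar>s - frac t\<bar>"
    using gap by blast
  show ?thesis
  proof (cases "frac t = 0")
    case False
    then have pos: "frac t > 0" using frac_mem[of t] by simp
    have "pcol E (t - s) = pcol E t" if s: "0 < s \<and> s < min \<delta> (frac t)" for s
    proof -
      have "t - s - (frac t - s) \<in> \<int>" using frac_diff_Ints(2)[of t] by simp
      then have fr: "frac (t - s) = frac t - s"
        using s frac_mem[of t] by (intro frac_unique_iff[THEN iffD2]) auto
      have "x < frac t - s \<longleftrightarrow> x < frac t" if "x \<in> double_params f" for x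
        using \<delta>(2)[rule_format, OF that] s by (cases "x = frac t") (auto simp: abs_if split: if_splits)
      then have "{x \<in> double_params f. x < frac t - s} = {x \<in> double_params f. x < frac t}" by blast
      then show ?thesis by (simp add: pcol_def fr cnt_def)
    qed
    moreover have "0 < min \<delta> (frac t)" using \<delta>(1) pos by simp
    ultimately show ?thesis by blast
  next
    case True
    \<comment> \<open>Just before an integer the fractional part is just below 1, so the gap that
      counts is the one around 1; there all double parameters have been passed.\<close>
    obtain \<delta>' where \<delta>': "\<delta>' > 0" "\<forall>s\<in>double_params f. s \<noteq> 1 \<longrightarrow> \<delta>' \<le> \<bar>s - 1\<bar>"
      using gap by blast
    have "{s \<in> double_params f. s < 0} = {}" using doubles_bounds by fastforce
    then have "cnt 0 = 0" by (simp only: cnt_def card.empty)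
    then have p0: "pcol E t = E 0" by (simp add: pcol_def True)
    have "pcol E (t - s) = pcol E t" if s: "0 < s \<and> s < min \<delta>' 1" for s
    proof -
      have "t \<in> \<int>" using True frac_diff_Ints(2)[of t] by simp
      then have "t - s - (1 - s) \<in> \<int>" by simp
      then have fr: "frac (t - s) = 1 - s"
        using s by (intro frac_unique_iff[THEN iffD2]) auto
      have "x < 1 - s" if x: "x \<in> double_params f" for x
      proof -
        have "x < 1" using doubles_bounds[OF x] by simp
        then show ?thesis using \<delta>'(2)[rule_format, OF x] s by simp
      qed
      then have "{x \<in> double_params f. x < 1 - s} = double_params f" by blast
      then show ?thesis using card_doubles assms p0 by (simp add: pcol_def fr cnt_def)
    qed
    then show ?thesis using \<delta>'(1) by (intro exI[of _ "min \<delta>' 1"]) auto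
  qed
qed

lemma pcol_periodic: "s - t \<in> \<int> \<Longrightarrow> pcol E s = pcol E t"
  by (simp add: pcol_def frac_eq_Ints[THEN iffD2])

lemma pcol_limits:
  assumes "E 0 = E (length w)" "p < length w" "t - ts ! p \<in> \<int>"
  shows "\<exists>\<delta>>0. \<forall>s. 0 < s \<and> s < \<delta> \<longrightarrow> pcol E (t - s) = E p \<and> pcol E (t + s) = E (Suc p)"
proof -
  have fr: "frac t = ts ! p" using assms(3) frac_eq_Ints frac_ts[OF assms(2)] by metis
  obtain \<delta> where \<delta>: "\<delta> > 0" "\<forall>s. 0 < s \<and> s < \<delta> \<longrightarrow> pcol E (t - s) = E p"
    using pcol_left[OF assms(1), of t] by (auto simp: pcol_def fr cnt_ts[OF assms(2)])
  obtain \<delta>' where \<delta>': "\<delta>' > 0" "\<forall>s. 0 < s \<and> s < \<delta>' \<longrightarrow> pcol E (t + s) = E (Suc p)"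
    using pcol_right[of E t] by (auto simp: fr cntle_ts[OF assms(2)])
  show ?thesis using \<delta> \<delta>' by (intro exI[of _ "min \<delta> \<delta>'"]) auto
qed

lemma pcol_simple:
  assumes "E 0 = E (length w)" "simple t"
  shows "\<exists>\<delta>>0. \<forall>s. \<bar>s\<bar> < \<delta> \<longrightarrow> pcol E (t + s) = pcol E t"
proof -
  have "cntle (frac t) = cnt (frac t)"
    using assms(2) cntle_eq_cnt simple_iff_double_params by blast
  then obtain \<delta> where \<delta>: "\<delta> > 0" "\<forall>s. 0 < s \<and> s < \<delta> \<longrightarrow> pcol E (t + s) = pcol E t"
    using pcol_right[of E t] by (auto simp: pcol_def)
  obtain \<delta>' where \<delta>': "\<delta>' > 0" "\<forall>s. 0 < s \<and> s < \<delta>' \<longrightarrow> pcol E (t - s) = pcol E t"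
    using pcol_left[OF assms(1), of t] by blast
  have "pcol E (t + s) = pcol E t" if "\<bar>s\<bar> < min \<delta> \<delta>'" for s
  proof -
    consider "s = 0" | "s > 0" | "s < 0" by linarith
    then show ?thesis
      using that \<delta>(2)[rule_format, of s] \<delta>'(2)[rule_format, of "- s"] by cases auto
  qed
  then show ?thesis using \<delta>(1) \<delta>'(1) by (intro exI[of _ "min \<delta> \<delta>'"]) auto
qed

lemma pcol_param:
  assumes "E \<in> {..length w} \<rightarrow>\<^sub>E Q" "E 0 = E (length w)"
  shows "param_colouring (pcol E)"
  unfolding param_colouring_def
proof (intro conjI allI impI)
  show "pcol E t \<in> Q" for t
    unfolding pcol_def by (rule PiE_mem[OF assms(1)]) (simp add: cnt_le)
qed (fact pcol_periodic, fact pcol_simple[OF assms(2)])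

lemma over_iff: "p < length w \<Longrightarrow> is_over (w ! p) \<longleftrightarrow> ts ! p \<in> Ov"
  and label_iff: "p < length w \<Longrightarrow> q < length w \<Longrightarrow> label (w ! p) = label (w ! q) \<longleftrightarrow> f (ts ! p) = f (ts ! q)"
  and sign_eq: "p < length w \<Longrightarrow> q < length w \<Longrightarrow> f (ts ! p) = f (ts ! q) \<Longrightarrow> ts ! p \<in> Ov \<Longrightarrow> ts ! q \<notin> Ov \<Longrightarrow>
     real_of_int (lsign (w ! p)) = sgn (plane_det (velocity f (ts ! p)) (velocity f (ts ! q))) \<and>
     lsign (w ! q) = lsign (w ! p)"
proof -
  note c = coded[unfolded gauss_code_of_def Let_def, folded ts_def]
  show "p < length w \<Longrightarrow> is_over (w ! p) \<longleftrightarrow> ts ! p \<in> Ov"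
    using c[THEN conjunct2, THEN conjunct1] by blast
  show "p < length w \<Longrightarrow> q < length w \<Longrightarrow> label (w ! p) = label (w ! q) \<longleftrightarrow> f (ts ! p) = f (ts ! q)"
    using c[THEN conjunct2, THEN conjunct2, THEN conjunct1] by blast
  show "p < length w \<Longrightarrow> q < length w \<Longrightarrow> f (ts ! p) = f (ts ! q) \<Longrightarrow> ts ! p \<in> Ov \<Longrightarrow> ts ! q \<notin> Ov \<Longrightarrow>
     real_of_int (lsign (w ! p)) = sgn (plane_det (velocity f (ts ! p)) (velocity f (ts ! q))) \<and>
     lsign (w ! q) = lsign (w ! p)"
    using c[THEN conjunct2, THEN conjunct2, THEN conjunct2] by blast
qed

lemma over_alternates:
  assumes "f t = f u" "t - u \<notin> \<int>"
  shows "frac t \<in> Ov \<longleftrightarrow> frac u \<notin> Ov"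
proof -
  have "f (frac t) = f (frac u)" "frac t \<noteq> frac u"
    using assms by (simp_all add: f_frac frac_eq_Ints)
  then show ?thesis using diagram frac_mem unfolding knot_diagram_def by blast
qed

lemma crossing_letters:
  assumes "f t = f u" "t - u \<notin> \<int>" "frac t \<in> Ov"
  obtains p q X e where "p < length w" "q < length w" "u - ts ! p \<in> \<int>" "t - ts ! q \<in> \<int>"
    "w ! p = Under X e" "w ! q = Over X e" "e = 1 \<or> e = -1"
    "plane_det (velocity f t) (velocity f u) > 0 \<longleftrightarrow> e = 1"
proof -
  have "\<not> simple t" "\<not> simple u"
    using assms(1,2) Ints_diff_commute unfolding simple_def by metis+
  then obtain p q where pq: "p < length w" "frac u = ts ! p" "q < length w" "frac t = ts ! q"
    using double_ts simple_iff_double_params by meson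
  have d: "u - ts ! p \<in> \<int>" "t - ts ! q \<in> \<int>"
    using frac_diff_Ints(2) pq(2,4) by metis+
  have ff: "f (ts ! q) = f (ts ! p)" using assms(1) f_frac pq(2,4) by metis
  have ov: "ts ! q \<in> Ov" "ts ! p \<notin> Ov" using over_alternates[OF assms(1,2)] assms(3) pq(2,4) by auto
  have lab: "label (w ! q) = label (w ! p)" using label_iff[OF pq(3,1)] ff by simp
  have det: "plane_det (velocity f (ts ! q)) (velocity f (ts ! p)) = plane_det (velocity f t) (velocity f u)"
    using velocity_periodic[OF d(1)] velocity_periodic[OF d(2)] by simp
  have sg: "real_of_int (lsign (w ! q)) = sgn (plane_det (velocity f t) (velocity f u))"
    "lsign (w ! p) = lsign (w ! q)"
    using sign_eq[OF pq(3,1) ff ov] det by simp_all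
  define X where "X = label (w ! q)"
  define e where "e = lsign (w ! q)"
  have wq: "w ! q = Over X e" using over_iff[OF pq(3)] ov(1) by (cases "w ! q") (auto simp: X_def e_def)
  have wp: "w ! p = Under X e" using over_iff[OF pq(1)] ov(2) lab sg(2) by (cases "w ! p") (auto simp: X_def e_def)
  have "plane_det (velocity f t) (velocity f u) \<noteq> 0" by (rule double_transverse[OF assms(1,2)])
  then have e: "e = 1 \<or> e = -1" "plane_det (velocity f t) (velocity f u) > 0 \<longleftrightarrow> e = 1"
    using sg(1) by (auto simp: e_def sgn_if split: if_splits)
  show thesis by (rule that[OF pq(1,3) d wp wq e])
qed

lemma upper_pcol:
  assumes E: "E \<in> colourings T w"
  shows "upper_colouring Ov (pcol E)"
  unfolding upper_colouring_def
proof (intro conjI allI impI)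
  have E1: "E \<in> {..length w} \<rightarrow>\<^sub>E Q" and E2: "E 0 = E (length w)"
    and over: "\<And>p. p < length w \<Longrightarrow> is_over (w ! p) \<Longrightarrow> E (Suc p) = E p"
    and plus: "\<And>p q X. p < length w \<Longrightarrow> q < length w \<Longrightarrow> w ! p = Under X 1 \<Longrightarrow> w ! q = Over X 1 \<Longrightarrow> E p \<triangleright> E q = E (Suc p)"
    and minus: "\<And>p q X. p < length w \<Longrightarrow> q < length w \<Longrightarrow> w ! p = Under X (-1) \<Longrightarrow> w ! q = Over X (-1) \<Longrightarrow> E (Suc p) \<triangleright> E q = E p"
    using E by (simp_all add: colourings_def)
  show "param_colouring (pcol E)" by (rule pcol_param[OF E1 E2])
  fix t u assume tu: "f t = f u \<and> t - u \<notin> \<int> \<and> frac t \<in> Ov"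
  then obtain p q X e where pq: "p < length w" "q < length w" "u - ts ! p \<in> \<int>" "t - ts ! q \<in> \<int>"
    "w ! p = Under X e" "w ! q = Over X e" "e = 1 \<or> e = -1"
    "plane_det (velocity f t) (velocity f u) > 0 \<longleftrightarrow> e = 1"
    using crossing_letters[of t u] by metis
  obtain \<delta> where \<delta>: "\<delta> > 0" "\<forall>s. 0 < s \<and> s < \<delta> \<longrightarrow> pcol E (t - s) = E q \<and> pcol E (t + s) = E (Suc q)"
    using pcol_limits[OF E2 pq(2,4)] by metis
  obtain \<delta>' where \<delta>': "\<delta>' > 0" "\<forall>s. 0 < s \<and> s < \<delta>' \<longrightarrow> pcol E (u - s) = E p \<and> pcol E (u + s) = E (Suc p)"
    using pcol_limits[OF E2 pq(1,3)] by metis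
  have "E (Suc q) = E q" using over[OF pq(2)] pq(6) by simp
  moreover have "if plane_det (velocity f t) (velocity f u) > 0 then E p \<triangleright> E q = E (Suc p) else E (Suc p) \<triangleright> E q = E p"
    using plus[OF pq(1,2)] minus[OF pq(1,2)] pq(5-8) by auto
  ultimately show "crossing_rule (plane_det (velocity f t) (velocity f u) > 0) (pcol E) t u"
    unfolding crossing_rule_def using \<delta> \<delta>'
    by (intro exI[of _ "min \<delta> \<delta>'"] conjI exI[of _ "E q"] exI[of _ "E p"] exI[of _ "E (Suc p)"]) auto
qed

text \<open>The colour at position \<open>Suc p\<close> is visible at simple parameters just after
  the double parameter \<open>ts ! p\<close>, and position 0 carries the same colour as the last
  one.\<close>

lemma pcol_inj:
  assumes E: "E \<in> colourings T w" and E': "E' \<in> colourings T w"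
    and eq: "\<And>t. simple t \<Longrightarrow> pcol E t = pcol E' t"
  shows "E = E'"
proof -
  have E1: "E \<in> {..length w} \<rightarrow>\<^sub>E Q" and E2: "E 0 = E (length w)"
    and E1': "E' \<in> {..length w} \<rightarrow>\<^sub>E Q" and E2': "E' 0 = E' (length w)"
    using E E' by (simp_all add: colourings_def)
  have right: "E (Suc p) = E' (Suc p)" if p: "p < length w" for p
  proof -
    have z: "ts ! p - ts ! p \<in> \<int>" by simp
    obtain \<delta> where \<delta>: "\<delta> > 0" "\<forall>s. 0 < s \<and> s < \<delta> \<longrightarrow> pcol E (ts ! p - s) = E p \<and> pcol E (ts ! p + s) = E (Suc p)"
      using pcol_limits[OF E2 p z] by metis
    obtain \<delta>' where \<delta>': "\<delta>' > 0" "\<forall>s. 0 < s \<and> s < \<delta>' \<longrightarrow> pcol E' (ts ! p - s) = E' p \<and> pcol E' (ts ! p + s) = E' (Suc p)"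
      using pcol_limits[OF E2' p z] by metis
    obtain \<eta> where \<eta>: "\<eta> > 0" "\<forall>s\<in>double_params f. s \<noteq> ts ! p \<longrightarrow> \<eta> \<le> \<bar>s - ts ! p\<bar>" using gap by blast
    \<comment> \<open>Small enough to lie in the range of both limits, before the next double
      parameter and before the end of the period.\<close>
    define s where "s = min (min \<delta> \<delta>') (min \<eta> (1 - ts ! p)) / 2"
    have s: "0 < s" "s < \<delta>" "s < \<delta>'" "s < \<eta>" "s < 1 - ts ! p"
      using \<delta>(1) \<delta>'(1) \<eta>(1) ts_bounds[OF p] by (auto simp: s_def)
    have "frac (ts ! p + s) = ts ! p + s" using s ts_bounds[OF p] by (simp add: frac_eq)
    moreover have "ts ! p + s \<notin> double_params f" using \<eta>(2) s by fastforce
    ultimately have "simple (ts ! p + s)" by (simp add: simple_iff_double_params)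
    then show ?thesis using eq \<delta>(2) \<delta>'(2) s by metis
  qed
  have "E p = E' p" if "p \<le> length w" for p
  proof (cases p)
    case 0
    have "E (length w) = E' (length w)" using right[of "length w - 1"] n_pos by simp
    then show ?thesis using 0 E2 E2' by simp
  next
    case (Suc m)
    then show ?thesis using right[of m] that by simp
  qed
  then show ?thesis using PiE_ext[OF E1 E1'] by simp
qed

text \<open>The left end of the gap before the \<open>p\<close>-th double parameter; the gap before the first one starts in
  the preceding period.\<close>

definition lo :: "nat \<Rightarrow> real" where
  "lo p = (if p = 0 then ts ! (length w - 1) - 1 else ts ! (p - 1))"

lemma lo_less: "p < length w \<Longrightarrow> lo p < ts ! p"
  using ts_less[of "p - 1" p] ts_bounds[of 0] ts_bounds[of "length w - 1"] n_pos by (auto simp: lo_def)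

section \<open>From colours of parameters back to colours of positions\<close>

lemma cnt_less: "i < length w \<Longrightarrow> i < cnt x \<Longrightarrow> ts ! i < x"
proof (rule ccontr)
  assume i: "i < length w" "i < cnt x" "\<not> ts ! i < x"
  have "cnt x \<le> cnt (ts ! i)"
    unfolding cnt_def using finite_doubles i(3) by (intro card_mono) auto
  then show False using cnt_ts[OF i(1)] i(2) by simp
qed

lemma cnt_ge: "i < length w \<Longrightarrow> cnt x \<le> i \<Longrightarrow> x \<le> ts ! i"
proof (rule ccontr)
  assume i: "i < length w" "cnt x \<le> i" "\<not> x \<le> ts ! i"
  have "cntle (ts ! i) \<le> cnt x"
    unfolding cnt_def cntle_def using finite_doubles i(3) by (intro card_mono) auto
  then show False using cntle_ts[OF i(1)] i(2) by simp
qed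

lemma gap_simple:
  assumes p: "p < length w" and t: "lo p < t" "t < ts ! p"
  shows "simple t"
proof -
  have main: "x \<notin> double_params f" if "\<And>i. i < length w \<Longrightarrow> i < p \<Longrightarrow> ts ! i < x"
      "\<And>i. i < length w \<Longrightarrow> p \<le> i \<Longrightarrow> x < ts ! i" for x
    using double_ts[of x] that by (metis linorder_not_less order_less_irrefl)
  have pth: "ts ! p \<le> ts ! i" if "p \<le> i" "i < length w" for i
    using ts_less[of p i] that by (cases "p = i") auto
  show ?thesis
  proof (cases "0 \<le> t")
    case True
    have "frac t = t" using True t(2) ts_bounds[OF p] by (simp add: frac_eq)
    moreover have "t \<notin> double_params f"
    proof (rule main)
      show "ts ! i < t" if i: "i < length w" "i < p" for i
      proof -
        have "i < p - 1 \<or> i = p - 1" using i(2) by linarith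
        moreover have "p - 1 < length w" using p by simp
        ultimately have "ts ! i \<le> ts ! (p - 1)" using ts_less[of i "p - 1"] by auto
        then show ?thesis using t(1) i(2) by (simp add: lo_def)
      qed
      show "t < ts ! i" if "i < length w" "p \<le> i" for i using pth[OF that(2,1)] t(2) by simp
    qed
    ultimately show ?thesis by (simp add: simple_iff_double_params)
  next
    case False
    \<comment> \<open>Only the gap before the first double parameter extends below 0; there
      \<open>frac t = t + 1\<close> lies beyond the last double parameter.\<close>
    have p0: "p = 0"
    proof (rule ccontr)
      assume "p \<noteq> 0"
      then have "0 \<le> lo p" using ts_bounds[of "p - 1"] p by (simp add: lo_def)
      then show False using False t(1) by simp
    qed
    have lot: "ts ! (length w - 1) < t + 1" using t(1) p0 by (simp add: lo_def)
    have "0 \<le> ts ! (length w - 1)" using ts_bounds n_pos by simp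
    then have "frac t = t + 1"
      using False lot by (intro frac_unique_iff[THEN iffD2]) auto
    moreover have "t + 1 \<notin> double_params f"
    proof
      assume "t + 1 \<in> double_params f"
      then obtain i where i: "i < length w" "t + 1 = ts ! i" using double_ts by blast
      have "ts ! i \<le> ts ! (length w - 1)"
        using sorted_nth_mono[OF sorted_ts, of i "length w - 1"] i(1) length_ts by simp
      then show False using lot i(2) by simp
    qed
    ultimately show ?thesis by (simp add: simple_iff_double_params)
  qed
qed

lemma param_gap_const:
  assumes D: "param_colouring D" and p: "p < length w"
    and x: "lo p < x" "x < ts ! p" and y: "lo p < y" "y < ts ! p"
  shows "D x = D y"
proof (rule connected_locally_constant[of "{lo p<..<ts ! p}" D])
  fix z assume "z \<in> {lo p<..<ts ! p}"
  then have "simple z" using gap_simple[OF p] by simp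
  then obtain \<delta> where \<delta>: "\<delta> > 0" "\<forall>s. \<bar>s\<bar> < \<delta> \<longrightarrow> D (z + s) = D z"
    using D unfolding param_colouring_def by blast
  show "\<forall>\<^sub>F z' in nhds z. D z' = D z"
    unfolding eventually_nhds_metric
  proof (intro exI conjI allI impI)
    show "\<delta> > 0" by fact
    show "D z' = D z" if "dist z' z < \<delta>" for z'
      using \<delta>(2)[rule_format, of "z' - z"] that by (simp add: dist_real_def)
  qed
qed (use x y in auto)

text \<open>A colouring is constant on each gap, so any sample point would do. The gap after the
  last letter is the one before the first letter, a period later; hence the reduction modulo
  \<open>length w\<close>.\<close>

definition decode :: "(real \<Rightarrow> 'b) \<Rightarrow> nat \<Rightarrow> 'b" where
  "decode D = restrict (\<lambda>p. D ((lo (p mod length w) + ts ! (p mod length w)) / 2)) {..length w}"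

lemma decode_eq:
  assumes D: "param_colouring D" and p: "p \<le> length w" and x: "lo (p mod length w) < x" "x < ts ! (p mod length w)"
  shows "D x = decode D p"
proof -
  have pm: "p mod length w < length w" using n_pos by simp
  have "D x = D ((lo (p mod length w) + ts ! (p mod length w)) / 2)"
    by (rule param_gap_const[OF D pm x]) (use lo_less[OF pm] in auto)
  then show ?thesis using p by (simp add: decode_def)
qed

lemma decode_ends: "decode D 0 = decode D (length w)"
  by (simp add: decode_def)

lemma decode_PiE: "param_colouring D \<Longrightarrow> decode D \<in> {..length w} \<rightarrow>\<^sub>E Q"
  by (simp add: decode_def param_colouring_def)

lemma decode_left:
  assumes D: "param_colouring D" and p: "p < length w"
  shows "\<exists>\<delta>>0. \<forall>s. 0 < s \<and> s < \<delta> \<longrightarrow> D (ts ! p - s) = decode D p"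
proof (intro exI[of _ "ts ! p - lo p"] conjI allI impI)
  show "0 < ts ! p - lo p" using lo_less[OF p] by simp
  show "D (ts ! p - s) = decode D p" if "0 < s \<and> s < ts ! p - lo p" for s
    by (rule decode_eq[OF D]) (use that p in auto)
qed

lemma decode_right:
  assumes D: "param_colouring D" and p: "p < length w"
  shows "\<exists>\<delta>>0. \<forall>s. 0 < s \<and> s < \<delta> \<longrightarrow> D (ts ! p + s) = decode D (Suc p)"
proof (cases "Suc p < length w")
  case True
  show ?thesis
  proof (intro exI[of _ "ts ! Suc p - ts ! p"] conjI allI impI)
    show "0 < ts ! Suc p - ts ! p" using ts_less[of p "Suc p"] True by simp
    show "D (ts ! p + s) = decode D (Suc p)" if "0 < s \<and> s < ts ! Suc p - ts ! p" for s
      by (rule decode_eq[OF D]) (use that True in \<open>auto simp: lo_def\<close>)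
  qed
next
  case False
  then have pn: "Suc p = length w" using p by simp
  then have lo0: "lo 0 = ts ! p - 1" by (simp add: lo_def flip: pn)
  show ?thesis
  proof (intro exI[of _ "ts ! 0 - lo 0"] conjI allI impI)
    show "0 < ts ! 0 - lo 0" using lo_less[of 0] n_pos by simp
    fix s assume s: "0 < s \<and> s < ts ! 0 - lo 0"
    have "D (ts ! p + s) = D (ts ! p + s - 1)"
      using D unfolding param_colouring_def by simp
    also have "\<dots> = decode D (Suc p)"
      by (rule decode_eq[OF D]) (use s pn lo0 in auto)
    finally show "D (ts ! p + s) = decode D (Suc p)" .
  qed
qed

text \<open>Nothing is lost by decoding as far as simple parameters are concerned. This carries
  injectivity of the transport over to colourings of codes.\<close>

lemma pcol_decode:
  assumes D: "param_colouring D" and t: "simple t"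
  shows "D t = pcol (decode D) t"
proof -
  define x where "x = frac t"
  have x: "0 \<le> x" "x < 1" "x \<notin> double_params f"
    using frac_mem[of t] t by (auto simp: x_def simple_iff_double_params)
  have Dx: "D t = D x" using D frac_diff_Ints(2)[of t] unfolding param_colouring_def x_def by blast
  have "D x = decode D (cnt x)"
  proof (cases "cnt x < length w")
    case True
    have "x \<noteq> ts ! cnt x" using x(3) ts_double[OF True] by auto
    then have up: "x < ts ! cnt x" using cnt_ge[OF True order_refl] by simp
    have "lo (cnt x) < x"
    proof (cases "cnt x = 0")
      case True
      then show ?thesis using ts_bounds[of "length w - 1"] n_pos x(1) by (simp add: lo_def)
    next
      case False
      then show ?thesis using cnt_less[of "cnt x - 1" x] True by (simp add: lo_def)
    qed
    then show ?thesis using decode_eq[OF D cnt_le] up True by simp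
  next
    case False
    then have c: "cnt x = length w" using cnt_le[of x] by simp
    have "D x = D (x - 1)" using D unfolding param_colouring_def by simp
    also have "\<dots> = decode D (cnt x)"
    proof (rule decode_eq[OF D cnt_le])
      have "ts ! (length w - 1) < x" using cnt_less[of "length w - 1" x] c n_pos by simp
      then show "lo (cnt x mod length w) < x - 1" using c by (simp add: lo_def)
      show "x - 1 < ts ! (cnt x mod length w)" using c ts_bounds[of 0] n_pos x(2) by simp
    qed
    finally show ?thesis .
  qed
  then show ?thesis using Dx by (simp add: pcol_def x_def)
qed

lemma decode_crossing:
  assumes D: "lower_colouring Ov D" and pq: "p < length w" "q < length w"
    and ff: "f (ts ! q) = f (ts ! p)" and ov: "ts ! q \<in> Ov" "p \<noteq> q"
  shows "decode D (Suc p) = decode D p"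
    "if plane_det (velocity f (ts ! q)) (velocity f (ts ! p)) > 0
     then decode D q \<triangleright> decode D p = decode D (Suc q)
     else decode D (Suc q) \<triangleright> decode D p = decode D q"
proof -
  have Dp: "param_colouring D" using D by (simp add: lower_colouring_def)
  have ne: "ts ! q \<noteq> ts ! p" using ov(2) pq distinct_ts length_ts by (simp add: nth_eq_iff_index_eq)
  then have "ts ! q - ts ! p \<notin> \<int>" using frac_ts[OF pq(1)] frac_ts[OF pq(2)] frac_eq_Ints by metis
  then have "crossing_rule (plane_det (velocity f (ts ! q)) (velocity f (ts ! p)) > 0) D (ts ! p) (ts ! q)"
    using D ff ov(1) frac_ts[OF pq(2)] unfolding lower_colouring_def by metis
  then obtain \<delta> y x x' where \<delta>: "\<delta> > 0" and v: "\<forall>s. 0 < s \<and> s < \<delta> \<longrightarrow>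
      D (ts ! p - s) = y \<and> D (ts ! p + s) = y \<and> D (ts ! q - s) = x \<and> D (ts ! q + s) = x'"
    and rel: "if plane_det (velocity f (ts ! q)) (velocity f (ts ! p)) > 0 then x \<triangleright> y = x' else x' \<triangleright> y = x"
    unfolding crossing_rule_def by metis
  have l: "decode D i = c" if i: "i < length w" and c: "\<forall>s. 0 < s \<and> s < \<delta> \<longrightarrow> D (ts ! i - s) = c" for i c
  proof -
    obtain \<eta> where \<eta>: "\<eta> > 0" "\<forall>s. 0 < s \<and> s < \<eta> \<longrightarrow> D (ts ! i - s) = decode D i"
      using decode_left[OF Dp i] by blast
    have "0 < min \<delta> \<eta> / 2 \<and> min \<delta> \<eta> / 2 < \<delta>" "0 < min \<delta> \<eta> / 2 \<and> min \<delta> \<eta> / 2 < \<eta>" using \<delta> \<eta>(1) by auto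
    then show ?thesis using c \<eta>(2) by metis
  qed
  have r: "decode D (Suc i) = c" if i: "i < length w" and c: "\<forall>s. 0 < s \<and> s < \<delta> \<longrightarrow> D (ts ! i + s) = c" for i c
  proof -
    obtain \<eta> where \<eta>: "\<eta> > 0" "\<forall>s. 0 < s \<and> s < \<eta> \<longrightarrow> D (ts ! i + s) = decode D (Suc i)"
      using decode_right[OF Dp i] by blast
    have "0 < min \<delta> \<eta> / 2 \<and> min \<delta> \<eta> / 2 < \<delta>" "0 < min \<delta> \<eta> / 2 \<and> min \<delta> \<eta> / 2 < \<eta>" using \<delta> \<eta>(1) by auto
    then show ?thesis using c \<eta>(2) by metis
  qed
  have "decode D p = y" "decode D (Suc p) = y" "decode D q = x" "decode D (Suc q) = x'"
    using l[OF pq(1), of y] r[OF pq(1), of y] l[OF pq(2), of x] r[OF pq(2), of x'] v by simp_all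
  then show "decode D (Suc p) = decode D p"
    "if plane_det (velocity f (ts ! q)) (velocity f (ts ! p)) > 0
     then decode D q \<triangleright> decode D p = decode D (Suc q)
     else decode D (Suc q) \<triangleright> decode D p = decode D q"
    using rel by simp_all
qed

lemma decode_lower:
  assumes D: "lower_colouring Ov D"
  shows "decode D \<in> colourings T (map swap_letter w)"
proof -
  have Dp: "param_colouring D" using D by (simp add: lower_colouring_def)
  \<comment> \<open>An over letter of the swapped word is an underpass of the diagram. The colour is
    unchanged there only by virtue of the crossing rule, so the overpass through the same point has
    to be found first.\<close>
  have over: "decode D (Suc p) = decode D p" if p: "p < length w" "is_over (map swap_letter w ! p)" for p
  proof -
    have nov: "ts ! p \<notin> Ov" using over_iff[OF p(1)] p by (simp add: is_over_swap)
    obtain s where s: "s \<in> {0..<1}" "s \<noteq> ts ! p" "f s = f (ts ! p)"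
      using ts_double[OF p(1)] by (auto simp: double_params_def)
    have "s \<in> double_params f"
      using s ts_bounds[OF p(1)] by (auto simp: double_params_def intro!: bexI[of _ "ts ! p"])
    then obtain q where q: "q < length w" "s = ts ! q" using double_ts by blast
    have fr: "frac s = s" using s(1) by (simp add: frac_eq)
    then have "s - ts ! p \<notin> \<int>" using s(2) frac_ts[OF p(1)] frac_eq_Ints by metis
    then have "s \<in> Ov" using over_alternates[OF s(3)] fr frac_ts[OF p(1)] nov by simp
    moreover have "p \<noteq> q" using s(2) q(2) by auto
    ultimately show ?thesis using decode_crossing(1)[OF D p(1) q(1)] s(3) q(2) by simp
  qed
  have under: "if e = 1 then decode D q \<triangleright> decode D p = decode D (Suc q) else decode D (Suc q) \<triangleright> decode D p = decode D q"
    if pq: "p < length w" "q < length w" "map swap_letter w ! q = Under X e" "map swap_letter w ! p = Over X e"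
      and e: "e = 1 \<or> e = -1" for p q X e
  proof -
    have wq: "w ! q = Over X e" and wp: "w ! p = Under X e"
      using pq by (cases "w ! q", simp_all, cases "w ! p", simp_all)
    have ff: "f (ts ! q) = f (ts ! p)" using label_iff[OF pq(2,1)] wq wp by simp
    have ov: "ts ! q \<in> Ov" "ts ! p \<notin> Ov" using over_iff[OF pq(2)] over_iff[OF pq(1)] wq wp by simp_all
    then have ne: "p \<noteq> q" by auto
    have "real_of_int e = sgn (plane_det (velocity f (ts ! q)) (velocity f (ts ! p)))"
      using sign_eq[OF pq(2,1) ff ov] wq by simp
    then have "plane_det (velocity f (ts ! q)) (velocity f (ts ! p)) > 0 \<longleftrightarrow> e = 1"
      using e by (auto simp: sgn_if split: if_splits)
    then show ?thesis using decode_crossing(2)[OF D pq(1,2) ff ov(1) ne] by simp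
  qed
  show ?thesis
    unfolding colourings_def
    using decode_PiE[OF Dp] decode_ends over under[of _ _ _ 1] under[of _ _ _ "-1"]
    by simp
qed

theorem card_colourings_swap_le:
  assumes fin: "finite Q"
  shows "card (colourings T w) \<le> card (colourings T (map swap_letter w))"
proof -
  obtain M z0 where M: "M > 0" "range f \<subseteq> rect (- M) M (- M) M" "z0 \<in> rect (- M) M (- M) M - range f"
    using generic_curve_bounded_rect[OF generic_curve_axioms] by metis
  define U where "U = rect (- M) M (- M) M"
  have U: "open U" "connected U" "range f \<subseteq> U" "z0 \<in> U - range f"
    unfolding U_def using M open_rect convex_connected[OF convex_rect] by simp_all
  have "\<exists>\<phi>. jump_system.sol f auts (\<lambda>t. rtrans (pcol E t)) U \<phi> \<and> \<phi> z0 = id"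
    if "E \<in> colourings T w" for E
    unfolding U_def
    by (rule flat_jump_system.sol_normalized[OF flat_jumps[OF upper_pcol[OF that] over_alternates] M(1)])
  \<comment> \<open>All solutions are normalised at the same \<open>z0\<close>, which is what allows
    the transports of two colourings to be compared.\<close>
  then obtain \<Phi> where \<Phi>: "\<And>E. E \<in> colourings T w \<Longrightarrow> jump_system.sol f auts (\<lambda>t. rtrans (pcol E t)) U (\<Phi> E)"
    "\<And>E. E \<in> colourings T w \<Longrightarrow> \<Phi> E z0 = id"
    by metis
  define F where "F E = decode (transport (\<Phi> E) (pcol E))" for E
  have low: "lower_colouring Ov (transport (\<Phi> E) (pcol E))" if "E \<in> colourings T w" for E
    by (rule transport_lower[OF upper_pcol[OF that] over_alternates U(1,3) \<Phi>(1)[OF that]])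
  have "inj_on F (colourings T w)"
  proof (rule inj_onI)
    fix E E' assume E: "E \<in> colourings T w" and E': "E' \<in> colourings T w" and FE: "F E = F E'"
    have eq: "transport (\<Phi> E) (pcol E) t = transport (\<Phi> E') (pcol E') t" if "simple t" for t
      using pcol_decode[OF _ that, of "transport (\<Phi> E) (pcol E)"] pcol_decode[OF _ that, of "transport (\<Phi> E') (pcol E')"]
        low[OF E] low[OF E'] FE by (simp add: F_def lower_colouring_def)
    show "E = E'"
      by (rule pcol_inj[OF E E'])
        (rule transport_inj[OF upper_pcol[OF E] upper_pcol[OF E'] over_alternates U \<Phi>[OF E] \<Phi>[OF E'] eq])
  qed
  moreover have "F ` colourings T w \<subseteq> colourings T (map swap_letter w)"
    using low decode_lower by (auto simp: F_def)
  ultimately show ?thesis by (rule card_inj_on_le) (rule finite_colourings[OF fin])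
qed

end

section \<open>Presented quandles\<close>

context quandle_target
begin

section \<open>Homomorphisms from a presented quandle\<close>

primrec qeval :: "('g \<Rightarrow> 'b) \<Rightarrow> 'g qterm \<Rightarrow> 'b" where
  "qeval g (Gen x) = g x"
| "qeval g (QOp s t) = qeval g s \<triangleright> qeval g t"
| "qeval g (QInv s t) = qeval g s \<triangleleft> qeval g t"

definition rel_maps :: "'g set \<Rightarrow> ('g qterm \<times> 'g qterm) set \<Rightarrow> ('g \<Rightarrow> 'b) set" where
  "rel_maps G R = {g \<in> G \<rightarrow>\<^sub>E Q. \<forall>s t. (s, t) \<in> R \<longrightarrow> s \<in> qterms G \<longrightarrow> t \<in> qterms G \<longrightarrow> qeval g s = qeval g t}"

lemma qterms_simps [simp]:
  "Gen x \<in> qterms G \<longleftrightarrow> x \<in> G"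
  "QOp s t \<in> qterms G \<longleftrightarrow> s \<in> qterms G \<and> t \<in> qterms G"
  "QInv s t \<in> qterms G \<longleftrightarrow> s \<in> qterms G \<and> t \<in> qterms G"
  by (auto simp: qterms_def)

lemma qeval_closed:
  assumes "g \<in> G \<rightarrow>\<^sub>E Q" "s \<in> qterms G"
  shows "qeval g s \<in> Q"
  using assms(2) by (induction s) (use assms(1) op_closed quot_closed in auto)

lemma qcong_qterms: "qcong G R s t \<Longrightarrow> s \<in> qterms G \<and> t \<in> qterms G"
  by (induction rule: qcong.induct) simp_all

lemma qcong_qeval:
  assumes g: "g \<in> rel_maps G R"
  shows "qcong G R s t \<Longrightarrow> qeval g s = qeval g t"
proof (induction rule: qcong.induct)
  have "g \<in> G \<rightarrow>\<^sub>E Q" using g by (simp add: rel_maps_def)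
  note cl = qeval_closed[OF this]
  {
    case (qcong_rel s t)
    then show ?case using g by (simp add: rel_maps_def)
  next
    case (qcong_idem s)
    from op_idem[OF cl[OF this]] show ?case by simp
  next
    case (qcong_inv_op s t)
    from op_quot[OF cl[OF this(1)] cl[OF this(2)]] show ?case by simp
  next
    case (qcong_op_inv s t)
    from quot_op[OF cl[OF this(1)] cl[OF this(2)]] show ?case by simp
  next
    case (qcong_dist s t u)
    from op_dist[OF cl[OF this(1)] cl[OF this(2)] cl[OF this(3)]] show ?case by simp
  }
qed simp_all

lemma qcong_set_iff: "(s, t) \<in> qcong_set G R \<longleftrightarrow> qcong G R s t"
  using qcong_qterms by (auto simp: qcong_set_def)

lemma equiv_qcong_set: "equiv (qterms G) (qcong_set G R)"
proof (rule equivI)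
  show "qcong_set G R \<subseteq> qterms G \<times> qterms G" by (auto simp: qcong_set_def)
  show "refl_on (qterms G) (qcong_set G R)" by (auto simp: refl_on_def qcong_set_iff intro: qcong_refl)
  show "sym (qcong_set G R)" by (auto simp: sym_def qcong_set_iff intro: qcong_sym)
  show "trans (qcong_set G R)" by (auto simp: trans_def qcong_set_iff intro: qcong_trans)
qed

lemma presented_carrier: "qcarrier (presented_quandle G R) = (\<lambda>s. qcong_set G R `` {s}) ` qterms G"
  by (auto simp: presented_quandle_def quotient_def)

lemma class_eq_iff:
  assumes "s \<in> qterms G" "t \<in> qterms G"
  shows "qcong_set G R `` {s} = qcong_set G R `` {t} \<longleftrightarrow> qcong G R s t"
  using eq_equiv_class_iff[OF equiv_qcong_set assms] by (simp add: qcong_set_iff)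

lemma presented_op:
  assumes s: "s \<in> qterms G" and t: "t \<in> qterms G"
  shows "qop (presented_quandle G R) (qcong_set G R `` {s}) (qcong_set G R `` {t}) = qcong_set G R `` {QOp s t}"
proof -
  have c: "qcong_set G R `` {QOp a b} = qcong_set G R `` {QOp s t}"
    if "a \<in> qcong_set G R `` {s}" "b \<in> qcong_set G R `` {t}" for a b
  proof -
    have "qcong G R a s" "qcong G R b t" using that qcong_sym by (auto simp: qcong_set_iff)
    then have "qcong G R (QOp a b) (QOp s t)" by (rule qcong_op)
    then show ?thesis using class_eq_iff qcong_qterms by metis
  qed
  have ne: "s \<in> qcong_set G R `` {s}" "t \<in> qcong_set G R `` {t}"
    using s t by (auto simp: qcong_set_iff intro: qcong_refl)
  have "(\<Union>a\<in>qcong_set G R `` {s}. \<Union>b\<in>qcong_set G R `` {t}. qcong_set G R `` {QOp a b})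
      = (\<Union>a\<in>qcong_set G R `` {s}. \<Union>b\<in>qcong_set G R `` {t}. qcong_set G R `` {QOp s t})"
    by (rule SUP_cong[OF refl], rule SUP_cong[OF refl], rule c)
  also have "\<dots> = qcong_set G R `` {QOp s t}"
    using ne by (metis UN_constant empty_iff)
  finally show ?thesis by (simp add: presented_quandle_def)
qed

text \<open>Preservation of the operation alone is assumed. That a homomorphism respects
  \<open>QInv\<close> as well follows from uniqueness of quotients in \<open>T\<close>.\<close>

lemma Hom_eval:
  assumes h: "h \<in> Hom (presented_quandle G R) T" and s: "s \<in> qterms G"
  shows "h (qcong_set G R `` {s}) = qeval (\<lambda>x\<in>G. h (qcong_set G R `` {Gen x})) s"
proof -
  have cl: "h (qcong_set G R `` {s}) \<in> Q" if "s \<in> qterms G" for s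
    using h that by (auto simp: Hom_def presented_carrier)
  have hom: "h (qcong_set G R `` {QOp s t}) = h (qcong_set G R `` {s}) \<triangleright> h (qcong_set G R `` {t})"
    if "s \<in> qterms G" "t \<in> qterms G" for s t
  proof -
    have "h (qop (presented_quandle G R) (qcong_set G R `` {s}) (qcong_set G R `` {t}))
        = h (qcong_set G R `` {s}) \<triangleright> h (qcong_set G R `` {t})"
      using h that unfolding Hom_def presented_carrier by blast
    then show ?thesis by (simp only: presented_op[OF that])
  qed
  show ?thesis
    using s
  proof (induction s)
    case (QInv s t)
    then have st: "s \<in> qterms G" "t \<in> qterms G" by simp_all
    have "qcong_set G R `` {QOp (QInv s t) t} = qcong_set G R `` {s}"
      using class_eq_iff qcong_op_inv[OF st] qcong_qterms by metis
    then have "h (qcong_set G R `` {QInv s t}) \<triangleright> h (qcong_set G R `` {t}) = h (qcong_set G R `` {s})"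
      using hom[of "QInv s t" t] st by simp
    then have "h (qcong_set G R `` {s}) \<triangleleft> h (qcong_set G R `` {t}) = h (qcong_set G R `` {QInv s t})"
      by (rule quot_unique[OF cl cl, rotated 2]) (simp_all add: st)
    then show ?case using QInv.IH st by simp
  qed (use hom in auto)
qed

text \<open>This is the universal property: a homomorphism is determined by its values on
  generators, and a map on generators that satisfies the relations extends by evaluating
  terms.\<close>

theorem card_Hom_presented: "card (Hom (presented_quandle G R) T) = card (rel_maps G R)"
proof (rule bij_betw_same_card)
  let ?c = "\<lambda>s. qcong_set G R `` {s}"
  let ?F = "\<lambda>h. \<lambda>x\<in>G. h (?c (Gen x))"
  show "bij_betw ?F (Hom (presented_quandle G R) T) (rel_maps G R)"
    unfolding bij_betw_def
  proof
    show "inj_on ?F (Hom (presented_quandle G R) T)"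
    proof (rule inj_onI)
      fix h h' assume h: "h \<in> Hom (presented_quandle G R) T" and h': "h' \<in> Hom (presented_quandle G R) T"
        and eq: "?F h = ?F h'"
      have "h \<in> extensional (qcarrier (presented_quandle G R))" "h' \<in> extensional (qcarrier (presented_quandle G R))"
        using h h' by (auto simp: Hom_def PiE_def)
      then show "h = h'"
      proof (rule extensionalityI)
        fix A assume "A \<in> qcarrier (presented_quandle G R)"
        then obtain s where "s \<in> qterms G" "A = ?c s" by (auto simp: presented_carrier)
        then show "h A = h' A" using Hom_eval[OF h] Hom_eval[OF h'] eq by metis
      qed
    qed
    show "?F ` Hom (presented_quandle G R) T = rel_maps G R"
    proof
      show "?F ` Hom (presented_quandle G R) T \<subseteq> rel_maps G R"
      proof
        fix g assume "g \<in> ?F ` Hom (presented_quandle G R) T"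
        then obtain h where h: "h \<in> Hom (presented_quandle G R) T" and g: "g = ?F h" by blast
        have "g \<in> G \<rightarrow>\<^sub>E Q" using h g by (auto simp: Hom_def presented_carrier)
        moreover have "qeval g s = qeval g t" if st: "(s, t) \<in> R" "s \<in> qterms G" "t \<in> qterms G" for s t
        proof -
          have "?c s = ?c t" using class_eq_iff[OF st(2,3)] qcong_rel[OF st] by simp
          then show ?thesis using Hom_eval[OF h st(2)] Hom_eval[OF h st(3)] g by simp
        qed
        ultimately show "g \<in> rel_maps G R" by (simp add: rel_maps_def)
      qed
      show "rel_maps G R \<subseteq> ?F ` Hom (presented_quandle G R) T"
      proof
        fix g assume g: "g \<in> rel_maps G R"
        then have gE: "g \<in> G \<rightarrow>\<^sub>E Q" by (simp add: rel_maps_def)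
        \<comment> \<open>Any representative may be evaluated, since \<open>qcong_qeval\<close>
          makes the value independent of the choice.\<close>
        define h where "h = (\<lambda>A\<in>qcarrier (presented_quandle G R). qeval g (SOME s. s \<in> A))"
        have hc: "h (?c s) = qeval g s" if s: "s \<in> qterms G" for s
        proof -
          have "s \<in> ?c s" using s by (auto simp: qcong_set_iff intro: qcong_refl)
          then have "(SOME s'. s' \<in> ?c s) \<in> ?c s" by (rule someI)
          then have "qcong G R s (SOME s'. s' \<in> ?c s)" by (simp add: qcong_set_iff)
          then have "qeval g s = qeval g (SOME s'. s' \<in> ?c s)" by (rule qcong_qeval[OF g])
          moreover have "?c s \<in> qcarrier (presented_quandle G R)" using s by (simp add: presented_carrier)
          ultimately show ?thesis by (simp add: h_def)
        qed
        have "h \<in> Hom (presented_quandle G R) T"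
          unfolding Hom_def
        proof (intro CollectI conjI ballI)
          show "h \<in> qcarrier (presented_quandle G R) \<rightarrow>\<^sub>E Q"
          proof (rule PiE_I)
            fix A assume "A \<in> qcarrier (presented_quandle G R)"
            then obtain s where "s \<in> qterms G" "A = ?c s" by (auto simp: presented_carrier)
            then show "h A \<in> Q" using hc qeval_closed[OF gE] by simp
          qed (simp add: h_def)
          fix A B assume "A \<in> qcarrier (presented_quandle G R)" "B \<in> qcarrier (presented_quandle G R)"
          then obtain s t where "s \<in> qterms G" "A = ?c s" "t \<in> qterms G" "B = ?c t"
            by (auto simp: presented_carrier)
          then show "h (qop (presented_quandle G R) A B) = h A \<triangleright> h B"
            by (simp add: presented_op hc)
        qed
        moreover have "?F h = g"
        proof (rule extensionalityI[of _ G])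
          show "g \<in> extensional G" using gE by (simp add: PiE_def)
          show "?F h x = g x" if "x \<in> G" for x using hc[of "Gen x"] that by simp
        qed simp
        ultimately show "g \<in> ?F ` Hom (presented_quandle G R) T" by blast
      qed
    qed
  qed
qed

end

section \<open>Arcs and positions of a code\<close>

lemma num_under_append: "num_under (u @ v) = num_under u + num_under v"
  by (simp add: num_under_def)

lemma num_under_take_Suc:
  assumes "p < length w"
  shows "num_under (take (Suc p) w) = num_under (take p w) + (if is_over (w ! p) then 0 else 1)"
  using assms by (simp add: take_Suc_conv_app_nth num_under_append) (simp add: num_under_def)

lemma num_under_take_le: "num_under (take p w) \<le> num_under w"
  using num_under_append[of "take p w" "drop p w"] by simp

lemma arc_at_arcs: "arc_at w p \<in> arcs w"
proof (cases "num_under w = 0")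
  case True
  then show ?thesis using num_under_take_le[of p w] by (simp add: arc_at_def arcs_def)
next
  case False
  then show ?thesis by (simp add: arc_at_def arcs_def less_max_iff_disj)
qed

lemma arc_at_ends: "arc_at w 0 = arc_at w (length w)"
  by (simp add: arc_at_def num_under_def)

lemma arc_at_over: "p < length w \<Longrightarrow> is_over (w ! p) \<Longrightarrow> arc_at w (Suc p) = arc_at w p"
  by (simp add: arc_at_def num_under_take_Suc)

text \<open>A discrete intermediate value argument: each further letter raises the count by at most
  one.\<close>

lemma num_under_take_surj:
  assumes "k \<le> num_under (take n w)" "n \<le> length w"
  shows "\<exists>p\<le>n. num_under (take p w) = k"
  using assms
proof (induction n)
  case 0
  then show ?case by (simp add: num_under_def)
next
  case (Suc n)
  show ?case
  proof (cases "k \<le> num_under (take n w)")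
    case True
    then show ?thesis using Suc by (metis Suc_leD le_SucI)
  next
    case False
    then have "k = num_under (take (Suc n) w)"
      using Suc.prems num_under_take_Suc[of n w] by (auto split: if_splits)
    then show ?thesis by blast
  qed
qed

lemma arc_at_surj:
  assumes "k \<in> arcs w"
  shows "\<exists>p\<le>length w. arc_at w p = k"
proof (cases "num_under w = 0")
  case True
  then have "k = 0" using assms by (simp add: arcs_def)
  then show ?thesis by (intro exI[of _ 0]) (simp add: arc_at_def num_under_def)
next
  case False
  then have k: "k < num_under w" using assms by (auto simp: arcs_def)
  then obtain p where "p \<le> length w" "num_under (take p w) = k"
    using num_under_take_surj[of k "length w" w] by auto
  then show ?thesis using k by (auto simp: arc_at_def)
qed

lemma colouring_same_arc:
  assumes E: "E \<in> colourings T w" and pq: "p \<le> length w" "q \<le> length w" "arc_at w p = arc_at w q"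
  shows "E p = E q"
proof -
  have ends: "E 0 = E (length w)" and over: "\<And>p. p < length w \<Longrightarrow> is_over (w ! p) \<Longrightarrow> E (Suc p) = E p"
    using E by (simp_all add: colourings_def)
  have step: "E q = E p" if "p \<le> q" "q \<le> length w" "num_under (take p w) = num_under (take q w)" for p q
    using that
  proof (induction q rule: dec_induct)
    case (step m)
    have le: "num_under (take p w) \<le> num_under (take m w)"
      using num_under_take_le[of p "take m w"] step.hyps by (simp add: min_absorb1)
    have m: "m < length w" using step.prems by simp
    have "is_over (w ! m)" "num_under (take p w) = num_under (take m w)"
      using num_under_take_Suc[OF m] step.prems le by (auto split: if_splits)
    then show ?case using step.IH over[OF m] m by simp
  qed simp
  have same: "E p = E q" if "p \<le> length w" "q \<le> length w" "num_under (take p w) = num_under (take q w)" for p q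
  proof (cases "p \<le> q")
    case True
    from step[OF this that(2,3)] show ?thesis by (rule sym)
  next
    case False
    then have "q \<le> p" by simp
    from step[OF this that(1) that(3)[symmetric]] show ?thesis .
  qed
  let ?N = "num_under w"
  have N0: "num_under (take 0 w) = 0" "num_under (take (length w) w) = ?N" by (simp_all add: num_under_def)
  \<comment> \<open>\<open>arc_at\<close> reduces a count only if it equals \<open>?N\<close>, that
    is, on the last stretch of the list; there the colour is that of position 0.\<close>
  have red: "\<exists>p'\<le>length w. E p' = E p \<and> num_under (take p' w) = arc_at w p" if "p \<le> length w" for p
  proof (cases "num_under (take p w) = ?N")
    case True
    then have "E p = E 0" using same[of p "length w"] that ends N0 by simp
    moreover have "arc_at w p = 0" using True by (simp add: arc_at_def)
    ultimately show ?thesis using N0 by (intro exI[of _ 0]) simp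
  next
    case False
    then have "num_under (take p w) < ?N" using num_under_take_le[of p w] by simp
    then show ?thesis using that by (intro exI[of _ p]) (simp add: arc_at_def)
  qed
  show ?thesis using red[OF pq(1)] red[OF pq(2)] pq(3) same by metis
qed

context quandle_target
begin

lemma rel_maps_upper:
  "c \<in> rel_maps (arcs w) (upper_relations w) \<longleftrightarrow> c \<in> arcs w \<rightarrow>\<^sub>E Q \<and>
     (\<forall>p<length w. \<forall>q<length w. \<forall>X.
        (w ! p = Under X 1 \<and> w ! q = Over X 1 \<longrightarrow> c (arc_at w p) \<triangleright> c (arc_at w q) = c (arc_at w (Suc p))) \<and>
        (w ! p = Under X (-1) \<and> w ! q = Over X (-1) \<longrightarrow> c (arc_at w (Suc p)) \<triangleright> c (arc_at w q) = c (arc_at w p)))"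
  (is "?L \<longleftrightarrow> ?R")
proof
  assume L: ?L
  then have rel: "qeval c s = qeval c t" if "(s, t) \<in> upper_relations w" "s \<in> qterms (arcs w)" "t \<in> qterms (arcs w)" for s t
    using that by (simp add: rel_maps_def)
  show ?R
  proof (intro conjI allI impI)
    show "c \<in> arcs w \<rightarrow>\<^sub>E Q" using L by (simp add: rel_maps_def)
    show "c (arc_at w p) \<triangleright> c (arc_at w q) = c (arc_at w (Suc p))"
      if "p < length w" "q < length w" "w ! p = Under X 1 \<and> w ! q = Over X 1" for p q X
    proof -
      have "(QOp (Gen (arc_at w p)) (Gen (arc_at w q)), Gen (arc_at w (Suc p))) \<in> upper_relations w"
        using that unfolding upper_relations_def by blast
      from rel[OF this] show ?thesis by (simp add: arc_at_arcs)
    qed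
    show "c (arc_at w (Suc p)) \<triangleright> c (arc_at w q) = c (arc_at w p)"
      if "p < length w" "q < length w" "w ! p = Under X (-1) \<and> w ! q = Over X (-1)" for p q X
    proof -
      have "(QOp (Gen (arc_at w (Suc p))) (Gen (arc_at w q)), Gen (arc_at w p)) \<in> upper_relations w"
        using that unfolding upper_relations_def by blast
      from rel[OF this] show ?thesis by (simp add: arc_at_arcs)
    qed
  qed
next
  assume R: ?R
  show ?L
    unfolding rel_maps_def
  proof (intro CollectI conjI allI impI)
    show "c \<in> arcs w \<rightarrow>\<^sub>E Q" using R by blast
    show "qeval c s = qeval c t" if "(s, t) \<in> upper_relations w" for s t
      using that R unfolding upper_relations_def by auto
  qed
qed

text \<open>A colouring of positions is constant along each arc and every arc contains a position,
  so such colourings correspond to maps on the generators.\<close>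

theorem card_Hom_upper: "card (Hom (upper_quandle w) T) = card (colourings T w)"
proof -
  let ?F = "\<lambda>c. \<lambda>p\<in>{..length w}. c (arc_at w p)"
  have "bij_betw ?F (rel_maps (arcs w) (upper_relations w)) (colourings T w)"
    unfolding bij_betw_def
  proof
    show "inj_on ?F (rel_maps (arcs w) (upper_relations w))"
    proof (rule inj_onI)
      fix c c' assume c: "c \<in> rel_maps (arcs w) (upper_relations w)" "c' \<in> rel_maps (arcs w) (upper_relations w)"
        and eq: "?F c = ?F c'"
      have "c k = c' k" if "k \<in> arcs w" for k
      proof -
        obtain p where "p \<le> length w" "arc_at w p = k" using arc_at_surj[OF \<open>k \<in> arcs w\<close>] by blast
        then show ?thesis using fun_cong[OF eq, of p] by simp
      qed
      then show "c = c'" using c PiE_ext[of c "arcs w" "\<lambda>_. Q" c'] by (simp add: rel_maps_def)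
    qed
    show "?F ` rel_maps (arcs w) (upper_relations w) = colourings T w"
    proof
      show "?F ` rel_maps (arcs w) (upper_relations w) \<subseteq> colourings T w"
      proof
        fix E assume "E \<in> ?F ` rel_maps (arcs w) (upper_relations w)"
        then obtain c where c: "c \<in> rel_maps (arcs w) (upper_relations w)" and E: "E = ?F c" by blast
        have "c \<in> arcs w \<rightarrow>\<^sub>E Q" using c by (simp add: rel_maps_def)
        then have "E \<in> {..length w} \<rightarrow>\<^sub>E Q" using arc_at_arcs by (auto simp: E)
        moreover have "E p = c (arc_at w p)" if "p \<le> length w" for p using that by (simp add: E)
        ultimately show "E \<in> colourings T w"
          using c arc_at_ends[of w] arc_at_over unfolding rel_maps_upper colourings_def by simp
      qed
      show "colourings T w \<subseteq> ?F ` rel_maps (arcs w) (upper_relations w)"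
      proof
        fix E assume E: "E \<in> colourings T w"
        define c where "c = (\<lambda>k\<in>arcs w. E (SOME p. p \<le> length w \<and> arc_at w p = k))"
        have c: "c (arc_at w p) = E p" if p: "p \<le> length w" for p
        proof -
          have "\<exists>q. q \<le> length w \<and> arc_at w q = arc_at w p" using p by blast
          from someI_ex[OF this] show ?thesis
            using colouring_same_arc[OF E _ p] arc_at_arcs[of w p] unfolding c_def by simp
        qed
        have EQ: "E p \<in> Q" if "p \<le> length w" for p using E that by (auto simp: colourings_def)
        have "c \<in> arcs w \<rightarrow>\<^sub>E Q"
        proof (rule PiE_I)
          fix k assume "k \<in> arcs w"
          then obtain p where "p \<le> length w" "arc_at w p = k" using arc_at_surj by blast
          then show "c k \<in> Q" using c EQ by metis
        qed (simp add: c_def)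
        then have "c \<in> rel_maps (arcs w) (upper_relations w)"
          using E c unfolding rel_maps_upper colourings_def by simp
        moreover have "?F c = E"
        proof (rule extensionalityI[of _ "{..length w}"])
          show "E \<in> extensional {..length w}" using E by (simp add: colourings_def PiE_def)
        qed (simp_all add: c)
        ultimately show "E \<in> ?F ` rel_maps (arcs w) (upper_relations w)" by blast
      qed
    qed
  qed
  then show ?thesis
    unfolding upper_quandle_def card_Hom_presented by (rule bij_betw_same_card)
qed

end

section \<open>Invariance under the moves\<close>

lemma gauss_code_letters:
  assumes w: "gauss_code w" and l: "l \<in> set w"
  obtains e where "e = 1 \<or> e = -1" "{m \<in> set w. label m = label l} = {Over (label l) e, Under (label l) e}"
proof -
  obtain e where e: "e \<in> {1, -1}" "mset (filter (\<lambda>m. label m = label l) w) = {#Over (label l) e, Under (label l) e#}"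
    using w l unfolding gauss_code_def by blast
  have "set (filter (\<lambda>m. label m = label l) w) = {Over (label l) e, Under (label l) e}"
    using arg_cong[OF e(2), of set_mset] by simp
  then show thesis using that e(1) by auto
qed

lemma gauss_code_distinct:
  assumes "gauss_code w"
  shows "distinct w"
  unfolding distinct_count_atmost_1
proof
  fix l
  show "count (mset w) l = (if l \<in> set w then 1 else 0)"
  proof (cases "l \<in> set w")
    case True
    obtain e where e: "mset (filter (\<lambda>m. label m = label l) w) = {#Over (label l) e, Under (label l) e#}"
      using assms True unfolding gauss_code_def by blast
    have "count (mset w) l = count (mset (filter (\<lambda>m. label m = label l) w)) l"
      by (simp add: mset_filter)
    also have "\<dots> \<le> 1" unfolding e by (cases l) auto
    finally have "count (mset w) l \<le> 1" .
    moreover have "count (mset w) l > 0" using True by simp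
    ultimately have "count (mset w) l = 1" by linarith
    then show ?thesis using True by simp
  qed (simp add: count_eq_zero_iff)
qed

lemma gauss_code_sign:
  assumes "gauss_code w" "l \<in> set w"
  shows "lsign l = 1 \<or> lsign l = -1"
proof -
  obtain e where e: "e = 1 \<or> e = -1" "{m \<in> set w. label m = label l} = {Over (label l) e, Under (label l) e}"
    by (rule gauss_code_letters[OF assms])
  have "l \<in> {m \<in> set w. label m = label l}" using assms(2) by simp
  then have "l \<in> {Over (label l) e, Under (label l) e}" unfolding e(2) .
  moreover have "lsign k = e" if "k \<in> {Over X e, Under X e}" for k X using that by auto
  ultimately have "lsign l = e" by metis
  then show ?thesis using e(1) by simp
qed

lemma gauss_code_same_sign:
  assumes "gauss_code w" "l \<in> set w" "m \<in> set w" "label l = label m"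
  shows "lsign l = lsign m"
proof -
  obtain e where e: "{k \<in> set w. label k = label l} = {Over (label l) e, Under (label l) e}"
    using gauss_code_letters[OF assms(1,2)] by metis
  have "l \<in> {k \<in> set w. label k = label l}" "m \<in> {k \<in> set w. label k = label l}" using assms by auto
  then have "l \<in> {Over (label l) e, Under (label l) e}" "m \<in> {Over (label l) e, Under (label l) e}"
    unfolding e by simp_all
  moreover have "lsign k = e" if "k \<in> {Over X e, Under X e}" for k X using that by auto
  ultimately show ?thesis by metis
qed

lemma gauss_code_partner:
  assumes "gauss_code w" "Over X e \<in> set w \<or> Under X e \<in> set w"
  shows "Over X e \<in> set w" "Under X e \<in> set w"
proof -
  obtain l where l: "l \<in> set w" "l = Over X e \<or> l = Under X e" using assms(2) by blast
  obtain e' where e': "{k \<in> set w. label k = label l} = {Over (label l) e', Under (label l) e'}"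
    using gauss_code_letters[OF assms(1) l(1)] by metis
  have "l \<in> {k \<in> set w. label k = label l}" using l by simp
  then have "e' = e" "label l = X" using l(2) unfolding e' by auto
  then show "Over X e \<in> set w" "Under X e \<in> set w" using e' by auto
qed

lemma swap_letter_simps [simp]: "swap_letter (swap_letter l) = l" "label (swap_letter l) = label l"
    "lsign (swap_letter l) = lsign l"
  by (cases l; simp)+

lemma map_swap_swap [simp]: "map swap_letter (map swap_letter w) = w"
  by (simp add: comp_def)

lemma gauss_code_swap:
  assumes "gauss_code w"
  shows "gauss_code (map swap_letter w)"
  unfolding gauss_code_def
proof
  fix X assume "X \<in> label ` set (map swap_letter w)"
  then have "X \<in> label ` set w" by force
  then obtain e where e: "e \<in> {1, -1}" "mset (filter (\<lambda>l. label l = X) w) = {#Over X e, Under X e#}"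
    using assms unfolding gauss_code_def by blast
  have "filter (\<lambda>l. label l = X) (map swap_letter w) = map swap_letter (filter (\<lambda>l. label l = X) w)"
    by (simp add: filter_map comp_def)
  then have "mset (filter (\<lambda>l. label l = X) (map swap_letter w)) = {#Over X e, Under X e#}"
    by (simp only: mset_map e(2)) simp
  then show "\<exists>e\<in>{1, -1}. mset (filter (\<lambda>l. label l = X) (map swap_letter w)) = {#Over X e, Under X e#}"
    using e(1) by blast
qed

context quandle_target
begin

text \<open>The rule at an underpass is read in the direction of travel: the colour before
  determines the colour after, with the defining equation of a negative crossing solved by
  \<open>\<triangleleft>\<close>.\<close>

definition act :: "int \<Rightarrow> 'b \<Rightarrow> 'b \<Rightarrow> 'b" where
  "act e x y = (if e = 1 then x \<triangleright> y else x \<triangleleft> y)"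

lemma act_closed: "x \<in> Q \<Longrightarrow> y \<in> Q \<Longrightarrow> act e x y \<in> Q"
  by (simp add: act_def op_closed quot_closed)

lemma act_idem: "x \<in> Q \<Longrightarrow> act e x x = x"
  by (simp add: act_def op_idem quot_unique)

lemma act_inverse:
  assumes "e = 1 \<or> e = -1" "x \<in> Q" "y \<in> Q"
  shows "act (- e) (act e x y) y = x"
  using assms(1) quot_op[OF assms(2,3)] op_quot[OF assms(2,3)] by (elim disjE) (simp_all add: act_def)

lemma act_cancel:
  assumes "x \<in> Q" "x' \<in> Q" "y \<in> Q" "act e x y = act e x' y"
  shows "x = x'"
proof (cases "e = 1")
  case True
  then show ?thesis using op_cancel[OF assms(1-3)] assms(4) by (simp add: act_def)
next
  case False
  then have "(x \<triangleleft> y) \<triangleright> y = (x' \<triangleleft> y) \<triangleright> y" using assms(4) by (simp add: act_def)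
  then show ?thesis by (simp only: quot_op[OF assms(1,3)] quot_op[OF assms(2,3)])
qed

lemma quot_aut:
  assumes t: "t \<in> Q"
    and x: "x \<in> Q" and y: "y \<in> Q"
  shows "(x \<triangleright> y) \<triangleleft> t = (x \<triangleleft> t) \<triangleright> (y \<triangleleft> t)"
proof (rule quot_unique)
  show "(x \<triangleleft> t) \<triangleright> (y \<triangleleft> t) \<triangleright> t = x \<triangleright> y"
    using op_dist[OF quot_closed[OF x t] quot_closed[OF y t] t] by (simp only: quot_op[OF x t] quot_op[OF y t])
qed (use assms op_closed quot_closed in auto)

lemma op_quot_dist:
  assumes "x \<in> Q" "y \<in> Q" "t \<in> Q"
  shows "(x \<triangleleft> y) \<triangleright> t = (x \<triangleright> t) \<triangleleft> (y \<triangleright> t)"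
proof (rule sym, rule quot_unique)
  show "(x \<triangleleft> y) \<triangleright> t \<triangleright> (y \<triangleright> t) = x \<triangleright> t"
    using op_dist[OF quot_closed[OF assms(1,2)] assms(2,3)] by (simp only: quot_op[OF assms(1,2)])
qed (use assms op_closed quot_closed in auto)

lemma quot_quot_dist:
  assumes "x \<in> Q" "y \<in> Q" "t \<in> Q"
  shows "(x \<triangleleft> y) \<triangleleft> t = (x \<triangleleft> t) \<triangleleft> (y \<triangleleft> t)"
proof (rule sym, rule quot_unique)
  show "(x \<triangleleft> y) \<triangleleft> t \<triangleright> (y \<triangleleft> t) = x \<triangleleft> t"
    using quot_aut[OF assms(3) quot_closed[OF assms(1,2)] assms(2)] by (simp only: quot_op[OF assms(1,2)])
qed (use assms op_closed quot_closed in auto)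

text \<open>Both \<open>\<triangleright> t\<close> and \<open>\<triangleleft> t\<close> are
  automorphisms for both operations, so self-distributivity holds for all four combinations of
  signs.\<close>

lemma act_dist:
  assumes "x \<in> Q" "y \<in> Q" "t \<in> Q"
  shows "act b (act c x y) t = act c (act b x t) (act b y t)"
  using op_dist[OF assms] quot_aut[OF assms(3,1,2)] op_quot_dist[OF assms] quot_quot_dist[OF assms]
  by (simp add: act_def)

text \<open>In the following, \<open>y X\<close> is the colour of the overpass at \<open>X\<close>. A colouring is the same as a choice of
  \<open>y\<close> together with an initial colour \<open>x\<close> such that walking once along the code starts and ends in \<open>x\<close>
  and meets each overpass in the colour prescribed by \<open>y\<close>.\<close>

fun pass :: "(nat \<Rightarrow> 'b) \<Rightarrow> nat letter \<Rightarrow> 'b \<Rightarrow> 'b" where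
  "pass y (Over X e) x = x"
| "pass y (Under X e) x = act e x (y X)"

fun fits :: "(nat \<Rightarrow> 'b) \<Rightarrow> nat letter \<Rightarrow> 'b \<Rightarrow> bool" where
  "fits y (Over X e) x \<longleftrightarrow> x = y X"
| "fits y (Under X e) x \<longleftrightarrow> True"

primrec walk :: "(nat \<Rightarrow> 'b) \<Rightarrow> code \<Rightarrow> 'b \<Rightarrow> 'b \<Rightarrow> bool" where
  "walk y [] x x' \<longleftrightarrow> x = x'"
| "walk y (l # w) x x' \<longleftrightarrow> fits y l x \<and> walk y w (pass y l x) x'"

definition path_colourings :: "code \<Rightarrow> ((nat \<Rightarrow> 'b) \<times> 'b) set" where
  "path_colourings w = {(y, x). y \<in> label ` set w \<rightarrow>\<^sub>E Q \<and> x \<in> Q \<and> walk y w x x}"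

section \<open>Walks along a code, rotation and renaming\<close>

lemma walk_append: "walk y (u @ v) x x' \<longleftrightarrow> (\<exists>x1. walk y u x x1 \<and> walk y v x1 x')"
  by (induction u arbitrary: x) auto

lemma pass_closed: "y (label l) \<in> Q \<Longrightarrow> x \<in> Q \<Longrightarrow> pass y l x \<in> Q"
  by (cases l) (auto simp: act_closed)

lemma walk_closed: "walk y w x x' \<Longrightarrow> y ` label ` set w \<subseteq> Q \<Longrightarrow> x \<in> Q \<Longrightarrow> x' \<in> Q"
proof (induction w arbitrary: x)
  case (Cons l w)
  then have "pass y l x \<in> Q" by (intro pass_closed) auto
  then show ?case using Cons.IH[of "pass y l x"] Cons.prems by simp
qed simp

lemma walk_det: "walk y w x x' \<Longrightarrow> walk y w x x'' \<Longrightarrow> x' = x''"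
  by (induction w arbitrary: x) auto

lemma walk_cong:
  assumes "\<And>X. X \<in> label ` set w \<Longrightarrow> y X = y' X"
  shows "walk y w x x' \<longleftrightarrow> walk y' w x x'"
  using assms
proof (induction w arbitrary: x)
  case (Cons l w)
  have "fits y l x = fits y' l x" "pass y l x = pass y' l x"
    using Cons.prems[of "label l"] by (cases l; simp)+
  then show ?case using Cons by simp
qed simp

lemma walk_iff_states:
  "walk y w x x' \<longleftrightarrow> (\<exists>E. E 0 = x \<and> E (length w) = x' \<and>
     (\<forall>p<length w. fits y (w ! p) (E p) \<and> E (Suc p) = pass y (w ! p) (E p)))"
proof (induction w arbitrary: x)
  case Nil
  then show ?case by (auto intro: exI[of _ "\<lambda>_. x"])
next
  case (Cons l w)
  show ?case
  proof
    assume p: "walk y (l # w) x x'"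
    then obtain E where E: "E 0 = pass y l x" "E (length w) = x'"
      "\<forall>p<length w. fits y (w ! p) (E p) \<and> E (Suc p) = pass y (w ! p) (E p)"
      using Cons.IH by auto
    define E' where "E' = case_nat x E"
    have "fits y ((l # w) ! q) (E' q) \<and> E' (Suc q) = pass y ((l # w) ! q) (E' q)" if "q < length (l # w)" for q
      using that p E by (cases q) (auto simp: E'_def)
    then show "\<exists>E. E 0 = x \<and> E (length (l # w)) = x' \<and>
     (\<forall>p<length (l # w). fits y ((l # w) ! p) (E p) \<and> E (Suc p) = pass y ((l # w) ! p) (E p))"
      using E(2) by (intro exI[of _ E']) (auto simp: E'_def)
  next
    assume "\<exists>E. E 0 = x \<and> E (length (l # w)) = x' \<and>
     (\<forall>p<length (l # w). fits y ((l # w) ! p) (E p) \<and> E (Suc p) = pass y ((l # w) ! p) (E p))"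
    then obtain E where E: "E 0 = x" "E (Suc (length w)) = x'"
      and st: "\<And>p. p < Suc (length w) \<Longrightarrow> fits y ((l # w) ! p) (E p) \<and> E (Suc p) = pass y ((l # w) ! p) (E p)"
      by auto
    have "walk y w (E (Suc 0)) x'"
      unfolding Cons.IH
      using E(2) st[of "Suc p" for p] by (intro exI[of _ "\<lambda>p. E (Suc p)"]) auto
    then show "walk y (l # w) x x'" using st[of 0] E(1) by simp
  qed
qed

theorem card_colourings_path:
  assumes w: "gauss_code w"
  shows "card (colourings T w) = card (path_colourings w)"
proof (rule bij_betw_same_card)
  \<comment> \<open>Each label has just one over letter in a Gauss code; its position is where the
    colour prescribed by \<open>y\<close> is read off.\<close>
  define pos where "pos X = (SOME q. q < length w \<and> is_over (w ! q) \<and> label (w ! q) = X)" for X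
  have pos: "pos X < length w" "w ! pos X = Over X e" if X: "Over X e \<in> set w" for X e
  proof -
    obtain q where "q < length w" "w ! q = Over X e" using X by (auto simp: in_set_conv_nth)
    then have "\<exists>q. q < length w \<and> is_over (w ! q) \<and> label (w ! q) = X" by auto
    from someI_ex[OF this] have p: "pos X < length w" "is_over (w ! pos X)" "label (w ! pos X) = X"
      unfolding pos_def by blast+
    then show "pos X < length w" by simp
    obtain e' where e': "w ! pos X = Over X e'" using p by (cases "w ! pos X") auto
    have "w ! pos X \<in> set w" using p(1) by simp
    then have "e' = e" using gauss_code_same_sign[OF w X, of "w ! pos X"] e' by simp
    then show "w ! pos X = Over X e" using e' by simp
  qed
  have pos_unique: "q = pos X" if "q < length w" "w ! q = Over X e" for q X e
  proof -
    have "Over X e \<in> set w" using that by (metis nth_mem)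
    from pos[OF this] show ?thesis using that gauss_code_distinct[OF w] nth_eq_iff_index_eq by metis
  qed
  have over_ex: "\<exists>e. Over X e \<in> set w" if X: "X \<in> label ` set w" for X
  proof -
    obtain l where l: "l \<in> set w" "label l = X" using X by blast
    have "l = Over (label l) (lsign l) \<or> l = Under (label l) (lsign l)" by (cases l) auto
    then have "Over X (lsign l) \<in> set w \<or> Under X (lsign l) \<in> set w" using l by metis
    then show ?thesis using gauss_code_partner(1)[OF w] by blast
  qed
  let ?F = "\<lambda>E. (\<lambda>X\<in>label ` set w. E (pos X), E 0)"
  have states: "fits (\<lambda>X\<in>label ` set w. E (pos X)) (w ! p) (E p) \<and>
      E (Suc p) = pass (\<lambda>X\<in>label ` set w. E (pos X)) (w ! p) (E p)"
    if E: "E \<in> colourings T w" and p: "p < length w" for E p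
  proof -
    have EQ: "\<And>p. p \<le> length w \<Longrightarrow> E p \<in> Q" and over: "\<And>p. p < length w \<Longrightarrow> is_over (w ! p) \<Longrightarrow> E (Suc p) = E p"
      and plus: "\<And>p q X. p < length w \<Longrightarrow> q < length w \<Longrightarrow> w ! p = Under X 1 \<Longrightarrow> w ! q = Over X 1 \<Longrightarrow> E p \<triangleright> E q = E (Suc p)"
      and minus: "\<And>p q X. p < length w \<Longrightarrow> q < length w \<Longrightarrow> w ! p = Under X (-1) \<Longrightarrow> w ! q = Over X (-1) \<Longrightarrow> E (Suc p) \<triangleright> E q = E p"
      using E by (auto simp: colourings_def)
    have mem: "w ! p \<in> set w" using p by simp
    show ?thesis
    proof (cases "w ! p")
      case (Over X e)
      have "X \<in> label ` set w" using mem Over by force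
      then show ?thesis using Over over[OF p] pos_unique[OF p Over] by simp
    next
      case (Under X e)
      have X: "X \<in> label ` set w" using mem Under by force
      have "Over X e \<in> set w" using gauss_code_partner[OF w] mem Under by metis
      note q = pos[OF this]
      have "e = 1 \<or> e = -1" using gauss_code_sign[OF w mem] Under by simp
      then show ?thesis
      proof
        assume "e = 1"
        then show ?thesis using Under X plus[OF p q(1), of X] q(2) by (simp add: act_def)
      next
        assume "e = -1"
        then have "E (Suc p) \<triangleright> E (pos X) = E p" using Under minus[OF p q(1), of X] q(2) by simp
        then have "E p \<triangleleft> E (pos X) = E (Suc p)"
          using EQ[of "Suc p"] EQ[of "pos X"] p q(1) by (intro quot_unique) auto
        then show ?thesis using Under X \<open>e = -1\<close> by (simp add: act_def)
      qed
    qed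
  qed
  show "bij_betw ?F (colourings T w) (path_colourings w)"
    unfolding bij_betw_def
  proof
    show "inj_on ?F (colourings T w)"
    proof (rule inj_onI)
      fix E E' assume E: "E \<in> colourings T w" and E': "E' \<in> colourings T w" and eq: "?F E = ?F E'"
      have "E p = E' p" if "p \<le> length w" for p
        using that
      proof (induction p)
        case 0
        then show ?case using eq by simp
      next
        case (Suc p)
        have "(\<lambda>X\<in>label ` set w. E (pos X)) = (\<lambda>X\<in>label ` set w. E' (pos X))" using eq by simp
        then show ?case using states[OF E, of p] states[OF E', of p] Suc by simp
      qed
      then show "E = E'" using E E' PiE_ext[of E "{..length w}" "\<lambda>_. Q" E'] by (simp add: colourings_def)
    qed
    show "?F ` colourings T w = path_colourings w"
    proof
      show "?F ` colourings T w \<subseteq> path_colourings w"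
      proof
        fix z assume "z \<in> ?F ` colourings T w"
        then obtain E where E: "E \<in> colourings T w" and z: "z = ?F E" by blast
        have EQ: "\<And>p. p \<le> length w \<Longrightarrow> E p \<in> Q" and ends: "E 0 = E (length w)" using E by (auto simp: colourings_def)
        have "walk (\<lambda>X\<in>label ` set w. E (pos X)) w (E 0) (E 0)"
          unfolding walk_iff_states using states[OF E] ends by (intro exI[of _ E]) simp
        moreover have "(\<lambda>X\<in>label ` set w. E (pos X)) \<in> label ` set w \<rightarrow>\<^sub>E Q"
        proof (rule PiE_I)
          fix X assume X: "X \<in> label ` set w"
          obtain e where "Over X e \<in> set w" using over_ex[OF X] by blast
          from pos(1)[OF this] show "(\<lambda>X\<in>label ` set w. E (pos X)) X \<in> Q" using EQ X by simp
        qed simp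
        ultimately show "z \<in> path_colourings w" using EQ[of 0] by (simp add: z path_colourings_def)
      qed
      show "path_colourings w \<subseteq> ?F ` colourings T w"
      proof
        fix z assume "z \<in> path_colourings w"
        then obtain y x where z: "z = (y, x)" and y: "y \<in> label ` set w \<rightarrow>\<^sub>E Q" and x: "x \<in> Q" and p: "walk y w x x"
          by (auto simp: path_colourings_def)
        obtain E0 where E0: "E0 0 = x" "E0 (length w) = x"
          and st0: "\<And>p. p < length w \<Longrightarrow> fits y (w ! p) (E0 p) \<and> E0 (Suc p) = pass y (w ! p) (E0 p)"
          using p unfolding walk_iff_states by blast
        define E where "E = (\<lambda>p\<in>{..length w}. E0 p)"
        have EE: "E p = E0 p" if "p \<le> length w" for p using that by (simp add: E_def)
        have st: "fits y (w ! p) (E p)" "E (Suc p) = pass y (w ! p) (E p)" if "p < length w" for p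
          using st0[OF that] EE[of p] EE[of "Suc p"] that by simp_all
        have yQ: "y (label (w ! p)) \<in> Q" if "p < length w" for p
          using y that by (auto simp: PiE_def Pi_def)
        have EQ: "E p \<in> Q" if "p \<le> length w" for p
          using that
        proof (induction p)
          case 0
          then show ?case using EE[of 0] E0 x by simp
        next
          case (Suc p)
          then show ?case using st(2)[of p] pass_closed[of y "w ! p" "E p"] yQ[of p] by simp
        qed
        have "E \<in> {..length w} \<rightarrow>\<^sub>E Q" using EQ by (auto simp: E_def)
        moreover have "E 0 = E (length w)" using EE E0 by simp
        moreover have "E (Suc p) = E p" if "p < length w" "is_over (w ! p)" for p
          using st(2)[OF that(1)] that(2) by (cases "w ! p") auto
        moreover have "E p \<triangleright> E q = E (Suc p)" if "p < length w" "q < length w" "w ! p = Under X 1" "w ! q = Over X 1" for p q X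
          using st(2)[OF that(1)] st(1)[OF that(2)] that(3,4) by (simp add: act_def)
        moreover have "E (Suc p) \<triangleright> E q = E p" if "p < length w" "q < length w" "w ! p = Under X (-1)" "w ! q = Over X (-1)" for p q X
          using st(2)[OF that(1)] st(1)[OF that(2)] that(3,4) quot_op[of "E p" "E q"] EQ[of p] EQ[of q] that(1,2)
          by (simp add: act_def)
        ultimately have "E \<in> colourings T w" by (simp add: colourings_def)
        moreover have "?F E = z"
        proof -
          have "(\<lambda>X\<in>label ` set w. E (pos X)) = y"
          proof (rule extensionalityI[of _ "label ` set w"])
            show "y \<in> extensional (label ` set w)" using y by (simp add: PiE_def)
            fix X assume X: "X \<in> label ` set w"
            obtain e where "Over X e \<in> set w" using over_ex[OF X] by blast
            from pos[OF this] show "(\<lambda>X\<in>label ` set w. E (pos X)) X = y X" using st(1) X by fastforce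
          qed simp
          then show ?thesis using EE[of 0] E0 z by simp
        qed
        ultimately show "z \<in> ?F ` colourings T w" by blast
      qed
    qed
  qed
qed

text \<open>Starting one letter later replaces the initial colour by its image under
  \<open>pass y l\<close>. This map is injective by \<open>act_cancel\<close>, and a preimage is
  provided by the colour that the walk has just before its last letter.\<close>

lemma card_path_rotate1: "card (path_colourings (rotate1 w)) = card (path_colourings w)"
proof (cases w)
  case (Cons l v)
  have "bij_betw (\<lambda>(y, x). (y, pass y l x)) (path_colourings (l # v)) (path_colourings (v @ [l]))"
    unfolding bij_betw_def
  proof
    have yl: "y (label l) \<in> Q" if "y \<in> label ` set (l # v) \<rightarrow>\<^sub>E Q" for y
      using that by (auto simp: PiE_def Pi_def)
    have inj: "x = x'" if "y (label l) \<in> Q" "x \<in> Q" "x' \<in> Q" "pass y l x = pass y l x'" for y x x'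
      using that act_cancel by (cases l) auto
    show "inj_on (\<lambda>(y, x). (y, pass y l x)) (path_colourings (l # v))"
      using yl inj by (auto simp: inj_on_def path_colourings_def)
    show "(\<lambda>(y, x). (y, pass y l x)) ` path_colourings (l # v) = path_colourings (v @ [l])"
    proof
      show "(\<lambda>(y, x). (y, pass y l x)) ` path_colourings (l # v) \<subseteq> path_colourings (v @ [l])"
        using yl by (auto simp: path_colourings_def walk_append pass_closed insert_commute)
      show "path_colourings (v @ [l]) \<subseteq> (\<lambda>(y, x). (y, pass y l x)) ` path_colourings (l # v)"
      proof
        fix z assume "z \<in> path_colourings (v @ [l])"
        then obtain y x where z: "z = (y, x)" and y: "y \<in> label ` set (l # v) \<rightarrow>\<^sub>E Q" and x: "x \<in> Q"
          and p: "walk y (v @ [l]) x x"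
          by (auto simp: path_colourings_def)
        obtain x1 where x1: "walk y v x x1" "fits y l x1" "pass y l x1 = x" using p by (auto simp: walk_append)
        have "y ` label ` set v \<subseteq> Q" using y by (auto simp: PiE_def Pi_def)
        then have "x1 \<in> Q" by (rule walk_closed[OF x1(1) _ x])
        then have "(y, x1) \<in> path_colourings (l # v)" using y x1 by (simp add: path_colourings_def)
        then show "z \<in> (\<lambda>(y, x). (y, pass y l x)) ` path_colourings (l # v)"
          using z x1(3) by (intro image_eqI[of _ _ "(y, x1)"]) auto
      qed
    qed
  qed
  from bij_betw_same_card[OF this] show ?thesis using Cons by simp
qed simp

lemma card_path_rotate: "card (path_colourings (rotate n w)) = card (path_colourings w)"
  by (induction n) (simp_all add: card_path_rotate1)

lemma card_path_append_commute: "card (path_colourings (u @ v)) = card (path_colourings (v @ u))"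
  using card_path_rotate[of "length u" "u @ v"] by (simp add: rotate_append)

lemma walk_map_letter: "walk y (map (map_letter p) w) x x' \<longleftrightarrow> walk (y \<circ> p) w x x'"
proof (induction w arbitrary: x)
  case (Cons l w)
  have "fits y (map_letter p l) x = fits (y \<circ> p) l x" "pass y (map_letter p l) x = pass (y \<circ> p) l x"
    by (cases l; simp)+
  then show ?case by (simp only: list.map walk.simps Cons.IH)
qed simp

lemma label_map_letter: "label (map_letter p l) = p (label l)"
  by (cases l) auto

lemma card_path_rename:
  assumes inj: "inj_on p (label ` set w)"
  shows "card (path_colourings (map (map_letter p) w)) = card (path_colourings w)"
proof (rule bij_betw_same_card)
  let ?L = "label ` set w"
  have L': "label ` set (map (map_letter p) w) = p ` ?L"
    by (auto simp: label_map_letter image_image)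
  have rp: "walk (restrict (y \<circ> p) ?L) w x x' \<longleftrightarrow> walk y (map (map_letter p) w) x x'" for y x x'
    unfolding walk_map_letter by (rule walk_cong) simp
  show "bij_betw (\<lambda>(y, x). (restrict (y \<circ> p) ?L, x)) (path_colourings (map (map_letter p) w)) (path_colourings w)"
    unfolding bij_betw_def
  proof
    show "inj_on (\<lambda>(y, x). (restrict (y \<circ> p) ?L, x)) (path_colourings (map (map_letter p) w))"
    proof (rule inj_onI, clarify)
      fix y x y' x'
      assume y: "(y, x) \<in> path_colourings (map (map_letter p) w)" "(y', x') \<in> path_colourings (map (map_letter p) w)"
        and eq: "restrict (y \<circ> p) ?L = restrict (y' \<circ> p) ?L"
      have "y (p X) = y' (p X)" if "X \<in> ?L" for X using fun_cong[OF eq, of X] that by simp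
      then have "y = y'"
        using y PiE_ext[of y "p ` ?L" "\<lambda>_. Q" y'] unfolding path_colourings_def L' by auto
      then show "y = y' \<and> x = x" by simp
    qed
    show "(\<lambda>(y, x). (restrict (y \<circ> p) ?L, x)) ` path_colourings (map (map_letter p) w) = path_colourings w"
    proof
      show "(\<lambda>(y, x). (restrict (y \<circ> p) ?L, x)) ` path_colourings (map (map_letter p) w) \<subseteq> path_colourings w"
      proof clarify
        fix y x assume "(y, x) \<in> path_colourings (map (map_letter p) w)"
        then have "y \<in> p ` ?L \<rightarrow>\<^sub>E Q" "x \<in> Q" "walk y (map (map_letter p) w) x x"
          unfolding path_colourings_def L' by simp_all
        then show "(restrict (y \<circ> p) ?L, x) \<in> path_colourings w"
          unfolding path_colourings_def by (simp add: rp) (auto simp: PiE_def Pi_def)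
      qed
      show "path_colourings w \<subseteq> (\<lambda>(y, x). (restrict (y \<circ> p) ?L, x)) ` path_colourings (map (map_letter p) w)"
      proof clarify
        fix y x assume yx: "(y, x) \<in> path_colourings w"
        then have y: "y \<in> ?L \<rightarrow>\<^sub>E Q" by (simp add: path_colourings_def)
        define y' where "y' = restrict (y \<circ> inv_into ?L p) (p ` ?L)"
        have y': "restrict (y' \<circ> p) ?L = y"
        proof (rule extensionalityI[of _ ?L])
          show "y \<in> extensional ?L" using y by (simp add: PiE_def)
          show "restrict (y' \<circ> p) ?L X = y X" if "X \<in> ?L" for X
            using that inv_into_f_f[OF inj that] by (simp add: y'_def)
        qed simp
        have "y' \<in> p ` ?L \<rightarrow>\<^sub>E Q"
        proof (rule PiE_I)
          fix Z assume "Z \<in> p ` ?L"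
          then obtain X where X: "X \<in> ?L" "Z = p X" by blast
          then have "y' Z = y X" using inv_into_f_f[OF inj X(1)] by (auto simp: y'_def)
          then show "y' Z \<in> Q" using y X(1) by (auto simp: PiE_def Pi_def)
        qed (simp add: y'_def)
        then have "(y', x) \<in> path_colourings (map (map_letter p) w)"
          using yx rp[of y' x x] y' unfolding path_colourings_def L' by simp
        then show "(y, x) \<in> (\<lambda>(y, x). (restrict (y \<circ> p) ?L, x)) ` path_colourings (map (map_letter p) w)"
          using y' by (intro image_eqI[of _ _ "(y', x)"]) auto
      qed
    qed
  qed
qed

end

section \<open>Reidemeister moves on walks\<close>

lemma mset_pairD:
  assumes "mset p = {#a, b#}"
  shows "p = [a, b] \<or> p = [b, a]"
proof -
  have "length p = 2" using arg_cong[OF assms, of size] by simp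
  then obtain c d where p: "p = [c, d]" by (metis length_0_conv length_Suc_conv numeral_2_eq_2)
  then have "{#c, d#} = {#a, b#}" using assms by simp
  from arg_cong[OF this, of set_mset] have "{c, d} = {a, b}" by simp
  then have "c = a \<and> d = b \<or> c = b \<and> d = a" by (simp add: doubleton_eq_iff)
  then show ?thesis using p by blast
qed

text \<open>With the strands written as words of two letters, move III simply reverses each of them;
  \<open>s\<close> is the order sign of the move.\<close>

definition top_strand :: "int \<Rightarrow> nat \<Rightarrow> int \<Rightarrow> nat \<Rightarrow> int \<Rightarrow> code" where
  "top_strand s A a B b = (if s = 1 then [Over A a, Over B b] else [Over B b, Over A a])"

definition middle_strand :: "int \<Rightarrow> nat \<Rightarrow> int \<Rightarrow> nat \<Rightarrow> int \<Rightarrow> code" where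
  "middle_strand s A a C c = (if s = 1 then [Under A a, Over C c] else [Over C c, Under A a])"

definition bottom_strand :: "int \<Rightarrow> nat \<Rightarrow> int \<Rightarrow> nat \<Rightarrow> int \<Rightarrow> code" where
  "bottom_strand s B b C c = (if s = 1 then [Under B b, Under C c] else [Under C c, Under B b])"

lemma set_strands:
  "set (top_strand s A a B b) = {Over A a, Over B b}"
  "set (middle_strand s A a C c) = {Under A a, Over C c}"
  "set (bottom_strand s B b C c) = {Under B b, Under C c}"
  by (auto simp: top_strand_def middle_strand_def bottom_strand_def)

text \<open>After the exchange of over and under, the crossing that counted as first on a strand
  counts as second, hence the opposite order sign.\<close>

lemma swap_strands:
  assumes "s = 1 \<or> s = -1"
  shows "map swap_letter (top_strand s A a B b) = bottom_strand (- s) B b A a"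
    "map swap_letter (middle_strand s A a C c) = middle_strand (- s) C c A a"
    "map swap_letter (bottom_strand s B b C c) = top_strand (- s) C c B b"
  using assms by (auto simp: top_strand_def middle_strand_def bottom_strand_def)

context quandle_target
begin

text \<open>Moves I and II delete crossings whose overpasses all carry the colour met at the cut
  between \<open>u\<close> and \<open>v\<close>. Their colours are thus forced by the rest, and
  restriction to the remaining labels loses nothing.\<close>

lemma card_path_extend:
  assumes L: "label ` set w = label ` set (u @ v) \<union> N" "label ` set (u @ v) \<inter> N = {}"
    and walk: "\<And>y x. y ` label ` set w \<subseteq> Q \<Longrightarrow> x \<in> Q \<Longrightarrow>
      walk y w x x \<longleftrightarrow> (\<exists>x1. walk y u x x1 \<and> walk y v x1 x \<and> (\<forall>X\<in>N. y X = x1))"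
  shows "card (path_colourings w) = card (path_colourings (u @ v))"
proof (rule bij_betw_same_card)
  let ?L = "label ` set (u @ v)"
  have Lu: "label ` set u \<subseteq> ?L" "label ` set v \<subseteq> ?L" by auto
  have cong: "walk (restrict y ?L) u x x' \<longleftrightarrow> walk y u x x'" "walk (restrict y ?L) v x x' \<longleftrightarrow> walk y v x x'" for y x x'
    by (rule walk_cong; use Lu in \<open>auto simp del: set_append\<close>)+
  have PC: "(y, x) \<in> path_colourings w \<longleftrightarrow> y \<in> (?L \<union> N) \<rightarrow>\<^sub>E Q \<and> x \<in> Q \<and>
      (\<exists>x1. walk y u x x1 \<and> walk y v x1 x \<and> (\<forall>X\<in>N. y X = x1))" for y x
  proof -
    have "y ` label ` set w \<subseteq> Q" if "y \<in> (?L \<union> N) \<rightarrow>\<^sub>E Q" using that unfolding L(1) by (auto simp: PiE_def Pi_def)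
    then show ?thesis unfolding path_colourings_def using walk L(1) by auto
  qed
  show "bij_betw (\<lambda>(y, x). (restrict y ?L, x)) (path_colourings w) (path_colourings (u @ v))"
    unfolding bij_betw_def
  proof
    show "inj_on (\<lambda>(y, x). (restrict y ?L, x)) (path_colourings w)"
    proof (rule inj_onI)
      fix z z' assume z: "z \<in> path_colourings w" "z' \<in> path_colourings w"
        and eq: "(case z of (y, x) \<Rightarrow> (restrict y ?L, x)) = (case z' of (y, x) \<Rightarrow> (restrict y ?L, x))"
      obtain y x y' where zz: "z = (y, x)" "z' = (y', x)" and eq: "restrict y ?L = restrict y' ?L"
        using eq by (cases z; cases z') auto
      have y: "(y, x) \<in> path_colourings w" and y': "(y', x) \<in> path_colourings w" using z zz by simp_all
      obtain x1 where x1: "walk y u x x1" "\<forall>X\<in>N. y X = x1" using y unfolding PC by blast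
      obtain x2 where x2: "walk y' u x x2" "\<forall>X\<in>N. y' X = x2" using y' unfolding PC by blast
      have "walk y' u x x1" using x1(1) cong(1)[of y] cong(1)[of y'] eq by simp
      then have "x1 = x2" using x2(1) by (rule walk_det)
      then have "y X = y' X" if "X \<in> ?L \<union> N" for X
        using that x1(2) x2(2) fun_cong[OF eq, of X] by (cases "X \<in> N") (auto simp del: set_append)
      moreover have "y \<in> (?L \<union> N) \<rightarrow>\<^sub>E Q" "y' \<in> (?L \<union> N) \<rightarrow>\<^sub>E Q" using y y' unfolding PC by blast+
      ultimately have "y = y'" using PiE_ext by metis
      then show "z = z'" using zz by simp
    qed
    show "(\<lambda>(y, x). (restrict y ?L, x)) ` path_colourings w = path_colourings (u @ v)"
    proof
      show "(\<lambda>(y, x). (restrict y ?L, x)) ` path_colourings w \<subseteq> path_colourings (u @ v)"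
      proof
        fix z assume "z \<in> (\<lambda>(y, x). (restrict y ?L, x)) ` path_colourings w"
        then obtain y x where yx: "(y, x) \<in> path_colourings w" and z: "z = (restrict y ?L, x)" by auto
        obtain x1 where "walk y u x x1" "walk y v x1 x" using yx unfolding PC by blast
        then have "walk (restrict y ?L) (u @ v) x x" unfolding walk_append using cong by blast
        moreover have "restrict y ?L \<in> ?L \<rightarrow>\<^sub>E Q" using yx unfolding PC by (auto simp: PiE_def Pi_def)
        moreover have "x \<in> Q" using yx unfolding PC by blast
        ultimately show "z \<in> path_colourings (u @ v)" unfolding z path_colourings_def by blast
      qed
      show "path_colourings (u @ v) \<subseteq> (\<lambda>(y, x). (restrict y ?L, x)) ` path_colourings w"
      proof
        fix z assume "z \<in> path_colourings (u @ v)"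
        then obtain y x where z: "z = (y, x)" and y: "y \<in> ?L \<rightarrow>\<^sub>E Q" and x: "x \<in> Q" and p: "walk y (u @ v) x x"
          unfolding path_colourings_def by blast
        obtain x1 where x1: "walk y u x x1" "walk y v x1 x" using p unfolding walk_append by blast
        have "y ` label ` set u \<subseteq> Q" using y by (auto simp: PiE_def Pi_def)
        then have x1Q: "x1 \<in> Q" by (rule walk_closed[OF x1(1) _ x])
        define y' where "y' X = (if X \<in> N then x1 else y X)" for X
        have r: "restrict y' ?L = y"
        proof (rule extensionalityI[of _ ?L])
          show "y \<in> extensional ?L" using y by (simp add: PiE_def)
          show "restrict y' ?L X = y X" if "X \<in> ?L" for X
            using that L(2) by (auto simp: y'_def simp del: set_append)
        qed simp
        have "y' \<in> (?L \<union> N) \<rightarrow>\<^sub>E Q"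
        proof (rule PiE_I)
          show "y' X \<in> Q" if "X \<in> ?L \<union> N" for X
            using that PiE_mem[OF y, of X] x1Q by (cases "X \<in> N") (auto simp: y'_def simp del: set_append)
          show "y' X = undefined" if "X \<notin> ?L \<union> N" for X
            using that PiE_arb[OF y, of X] by (simp add: y'_def del: set_append)
        qed
        moreover have "walk y' u x x1" "walk y' v x1 x" using x1 cong[of y'] r by simp_all
        ultimately have "(y', x) \<in> path_colourings w" unfolding PC using x by (auto simp: y'_def)
        then show "z \<in> (\<lambda>(y, x). (restrict y ?L, x)) ` path_colourings w"
          using z r by (intro image_eqI[of _ _ "(y', x)"]) simp_all
      qed
    qed
  qed
qed

lemma gauss_code_fresh:
  assumes w: "gauss_code w" and X: "Over X e \<in> set w" and m: "m \<in> set w" "label m = X"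
  shows "m = Over X e \<or> m = Under X e"
proof -
  have "lsign m = e" using gauss_code_same_sign[OF w m(1) X] m(2) by simp
  then show ?thesis using m(2) by (cases m) auto
qed

text \<open>The kink passes under its own colour, which changes nothing by idempotence. If the
  underpass comes first, cancellation shows that the colour before it is already that of the
  overpass.\<close>

lemma card_path_RI:
  assumes w: "gauss_code (u @ p @ v)" and p: "p = [Over X e, Under X e] \<or> p = [Under X e, Over X e]"
  shows "card (path_colourings (u @ p @ v)) = card (path_colourings (u @ v))"
proof (rule card_path_extend[where N = "{X}"])
  have d: "distinct (u @ p @ v)" by (rule gauss_code_distinct[OF w])
  have "Over X e \<in> set (u @ p @ v)" using p by auto
  note fresh = gauss_code_fresh[OF w this]
  have "X \<notin> label ` set (u @ v)"
  proof
    assume "X \<in> label ` set (u @ v)"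
    then obtain m where m: "m \<in> set (u @ v)" "label m = X" by blast
    then have "m = Over X e \<or> m = Under X e" using fresh[of m] by auto
    then have "m \<in> set p" using p by auto
    then show False using m(1) d by auto
  qed
  then show "label ` set (u @ v) \<inter> {X} = {}" by blast
  show "label ` set (u @ p @ v) = label ` set (u @ v) \<union> {X}" using p by auto
  fix y x assume y: "y ` label ` set (u @ p @ v) \<subseteq> Q" and x: "x \<in> Q"
  have yX: "y X \<in> Q" and yu: "y ` label ` set u \<subseteq> Q" using y p by auto
  have wp: "walk y p x1 x2 \<longleftrightarrow> y X = x1 \<and> x2 = x1" if "x1 \<in> Q" for x1 x2
    using p
  proof
    assume "p = [Over X e, Under X e]"
    then show ?thesis using act_idem[OF yX] by auto
  next
    assume "p = [Under X e, Over X e]"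
    then show ?thesis using act_idem[OF yX] act_cancel[OF that yX yX, of e] by auto
  qed
  show "walk y (u @ p @ v) x x \<longleftrightarrow> (\<exists>x1. walk y u x x1 \<and> walk y v x1 x \<and> (\<forall>X\<in>{X}. y X = x1))"
    unfolding walk_append using wp walk_closed[OF _ yu x] by auto
qed

text \<open>The adjacent overpasses share one colour, so the two underpasses act by the same element
  with opposite signs and cancel in either order. The cut is at the place of the overpasses, where
  this common colour is met.\<close>

lemma card_path_RII:
  assumes w: "gauss_code (u @ p @ v @ q @ z)"
    and p: "mset p = {#Over X e, Over Y (- e)#}" and q: "mset q = {#Under X e, Under Y (- e)#}"
  shows "card (path_colourings (u @ p @ v @ q @ z)) = card (path_colourings (u @ v @ z))"
proof (rule card_path_extend[where N = "{X, Y}"])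
  let ?w = "u @ p @ v @ q @ z"
  have d: "distinct ?w" by (rule gauss_code_distinct[OF w])
  note p' = mset_pairD[OF p] and q' = mset_pairD[OF q]
  have XY: "Over X e \<in> set ?w" "Over Y (- e) \<in> set ?w" using p' by auto
  have e: "e = 1 \<or> e = -1" using gauss_code_sign[OF w XY(1)] by simp
  have nin: "label m \<noteq> X \<and> label m \<noteq> Y" if m: "m \<in> set (u @ v @ z)" for m
  proof (rule ccontr)
    assume "\<not> (label m \<noteq> X \<and> label m \<noteq> Y)"
    then have "m = Over X e \<or> m = Under X e \<or> m = Over Y (- e) \<or> m = Under Y (- e)"
      using gauss_code_fresh[OF w XY(1), of m] gauss_code_fresh[OF w XY(2), of m] m by auto
    then have "m \<in> set (p @ q)" using p' q' by auto
    then show False using m d by auto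
  qed
  then show "label ` set (u @ v @ z) \<inter> {X, Y} = {}" by blast
  show "label ` set ?w = label ` set (u @ v @ z) \<union> {X, Y}" using p' q' by auto
  fix y x assume y: "y ` label ` set ?w \<subseteq> Q" and x: "x \<in> Q"
  have yXY: "y X \<in> Q" "y Y \<in> Q" and yu: "y ` label ` set u \<subseteq> Q" and yv: "y ` label ` set v \<subseteq> Q"
    using y p' by auto
  have wp: "walk y p x1 x2 \<longleftrightarrow> y X = x1 \<and> y Y = x1 \<and> x2 = x1" for x1 x2
    using p' by auto
  have wq: "walk y q x1 x2 \<longleftrightarrow> x2 = x1" if x1: "x1 \<in> Q" and eq: "y X = y Y" for x1 x2
  proof -
    have "act (- e) (act e x1 (y Y)) (y Y) = x1" "act e (act (- e) x1 (y Y)) (y Y) = x1"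
      using act_inverse[OF e x1 yXY(2)] act_inverse[of "- e", OF _ x1 yXY(2)] e by auto
    then show ?thesis using q' eq by auto
  qed
  show "walk y ?w x x \<longleftrightarrow> (\<exists>x1. walk y u x x1 \<and> walk y (v @ z) x1 x \<and> (\<forall>X\<in>{X, Y}. y X = x1))"
  proof
    assume "walk y ?w x x"
    then obtain x1 x2 x3 x4 where st: "walk y u x x1" "walk y p x1 x2" "walk y v x2 x3" "walk y q x3 x4" "walk y z x4 x"
      unfolding walk_append by blast
    have x1: "x1 \<in> Q" using walk_closed[OF st(1) yu x] .
    have yx: "y X = x1" "y Y = x1" "x2 = x1" using st(2) wp by auto
    have "x3 \<in> Q" using walk_closed[OF st(3) yv] x1 yx(3) by simp
    then have "x4 = x3" using st(4) wq yx by simp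
    then show "\<exists>x1. walk y u x x1 \<and> walk y (v @ z) x1 x \<and> (\<forall>X\<in>{X, Y}. y X = x1)"
      unfolding walk_append using st yx by auto
  next
    assume "\<exists>x1. walk y u x x1 \<and> walk y (v @ z) x1 x \<and> (\<forall>X\<in>{X, Y}. y X = x1)"
    then obtain x1 x3 where st: "walk y u x x1" "walk y v x1 x3" "walk y z x3 x" "y X = x1" "y Y = x1"
      unfolding walk_append by auto
    have x1: "x1 \<in> Q" using walk_closed[OF st(1) yu x] .
    have x3: "x3 \<in> Q" using walk_closed[OF st(2) yv x1] .
    have "walk y p x1 x1" "walk y q x3 x3" using wp wq x3 st(4,5) by auto
    then show "walk y ?w x x" unfolding walk_append using st(1-3) by blast
  qed
qed

text \<open>In move III, the only overpass whose colour changes is the one at \<open>C\<close>: it lies on the middle strand,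
  before or after that strand dives under the top strand at \<open>A\<close>.\<close>

definition recolour :: "int \<Rightarrow> nat \<Rightarrow> nat \<Rightarrow> (nat \<Rightarrow> 'b) \<Rightarrow> nat \<Rightarrow> 'b" where
  "recolour s A C y = y(C := act s (y C) (y A))"

text \<open>The condition on \<open>y\<close> keeps colours in \<open>Q\<close> along
  \<open>u\<close>; this makes the relation compatible with concatenation.\<close>

definition same_walks :: "(nat \<Rightarrow> 'b) \<Rightarrow> (nat \<Rightarrow> 'b) \<Rightarrow> code \<Rightarrow> code \<Rightarrow> bool" where
  "same_walks y y' u u' \<longleftrightarrow> y ` label ` set u \<subseteq> Q \<and> (\<forall>x\<in>Q. \<forall>x'. walk y u x x' \<longleftrightarrow> walk y' u' x x')"

lemma same_walks_append: "same_walks y y' u u' \<Longrightarrow> same_walks y y' v v' \<Longrightarrow> same_walks y y' (u @ v) (u' @ v')"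
  unfolding same_walks_def walk_append using walk_closed by (simp add: image_Un) metis

lemma same_walks_cong: "y ` label ` set u \<subseteq> Q \<Longrightarrow> (\<And>X. X \<in> label ` set u \<Longrightarrow> y X = y' X) \<Longrightarrow> same_walks y y' u u"
  unfolding same_walks_def using walk_cong[of u y y'] by blast

text \<open>If \<open>A\<close> comes first, the overpass at \<open>C\<close> is seen after the
  action at \<open>A\<close>, and after the move it is seen before it, so the action has to be
  undone. In the other order it has to be applied. Both cases are the exponent
  \<open>- s * a\<close>.\<close>

lemma same_walks_middle:
  assumes "C \<noteq> A" "y A \<in> Q" "y C \<in> Q" "a = 1 \<or> a = -1" "s = 1 \<or> s = -1"
  shows "same_walks y (recolour (- s * a) A C y) (middle_strand s A a C c) (rev (middle_strand s A a C c))"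
  unfolding same_walks_def
proof (intro conjI ballI allI)
  show "y ` label ` set (middle_strand s A a C c) \<subseteq> Q" using assms by (auto simp: middle_strand_def)
  fix x x' assume x: "x \<in> Q"
  have "act a x (y A) = y C \<longleftrightarrow> x = act (- a) (y C) (y A)"
    using act_inverse[OF assms(4) x assms(2)] act_inverse[of "- a", OF _ assms(3,2)] assms(4) by auto
  moreover have "act a x (y A) = act a (y C) (y A) \<longleftrightarrow> x = y C"
    using act_cancel[OF x assms(3,2)] by blast
  ultimately show "walk y (middle_strand s A a C c) x x' \<longleftrightarrow>
      walk (recolour (- s * a) A C y) (rev (middle_strand s A a C c)) x x'"
    using assms(1,5) by (auto simp: middle_strand_def recolour_def)
qed

text \<open>Self-distributivity lets the actions at \<open>B\<close> and \<open>C\<close> change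
  places once the colour at \<open>C\<close> is acted on by that of the top strand. The exponent
  needed here is \<open>- s * b\<close>; that it agrees with the one demanded by the middle strand
  is part of the sign condition of the move.\<close>

lemma same_walks_bottom:
  assumes "C \<noteq> B" "y A \<in> Q" "y C \<in> Q" "y B = y A" "b = 1 \<or> b = -1" "s = 1 \<or> s = -1"
  shows "same_walks y (recolour (- s * b) A C y) (bottom_strand s B b C c) (rev (bottom_strand s B b C c))"
  unfolding same_walks_def
proof (intro conjI ballI allI)
  show "y ` label ` set (bottom_strand s B b C c) \<subseteq> Q" using assms by (auto simp: bottom_strand_def)
  fix x x' assume x: "x \<in> Q"
  have "act b (act c x (act (- b) (y C) (y A))) (y A) = act c (act b x (y A)) (y C)"
    using act_dist[OF x act_closed[OF assms(3,2)] assms(2)] act_inverse[of "- b", OF _ assms(3,2)] assms(5) by auto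
  moreover have "act b (act c x (y C)) (y A) = act c (act b x (y A)) (act b (y C) (y A))"
    by (rule act_dist[OF x assms(3,2)])
  ultimately show "walk y (bottom_strand s B b C c) x x' \<longleftrightarrow>
      walk (recolour (- s * b) A C y) (rev (bottom_strand s B b C c)) x x'"
    using assms(1,4,6) by (auto simp: bottom_strand_def recolour_def)
qed

text \<open>The bijection recolours \<open>C\<close>, with \<open>rel\<close> ensuring that the
  middle and the bottom strand ask for the same recolouring. Elsewhere the walks are unaffected
  because \<open>C\<close> does not occur there.\<close>

lemma card_path_RIII:
  assumes ne: "C \<noteq> A" "C \<noteq> B" and sg: "a = 1 \<or> a = -1" "b = 1 \<or> b = -1" "sm = 1 \<or> sm = -1" "sb = 1 \<or> sb = -1"
    and rel: "sm * a = sb * b" and tp: "tp = top_strand st A a B b"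
    and ms: "m1 = middle_strand sm A a C c \<and> m2 = bottom_strand sb B b C c \<or>
      m1 = bottom_strand sb B b C c \<and> m2 = middle_strand sm A a C c"
    and C: "C \<notin> label ` set (u @ v @ z)"
  shows "card (path_colourings (tp @ u @ m1 @ v @ m2 @ z)) =
    card (path_colourings (rev tp @ u @ rev m1 @ v @ rev m2 @ z))"
proof (rule bij_betw_same_card)
  let ?w = "tp @ u @ m1 @ v @ m2 @ z" and ?w' = "rev tp @ u @ rev m1 @ v @ rev m2 @ z"
  define s where "s = - sm * a"
  have s: "s = 1 \<or> s = -1" using sg(1,3) by (auto simp: s_def)
  have lab: "label ` set ?w' = label ` set ?w" by simp
  have ABC: "A \<in> label ` set ?w" "C \<in> label ` set ?w" "label ` set (tp @ u @ v @ z) \<subseteq> label ` set ?w"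
    using ms by (auto simp: tp set_strands)
  have walks: "walk y ?w x x \<longleftrightarrow> walk (recolour s A C y) ?w' x x"
    if y: "y ` label ` set ?w \<subseteq> Q" and x: "x \<in> Q" for y x
  \<comment> \<open>The top strand meets \<open>A\<close> and \<open>B\<close> without an underpass
    between them, so if their colours differ it cannot be walked in either order.\<close>
  proof (cases "y A = y B")
    case False
    have "\<not> walk y tp x' x''" "\<not> walk (recolour s A C y) (rev tp) x' x''" for x' x''
      using False ne by (auto simp: tp top_strand_def recolour_def)
    then show ?thesis unfolding walk_append by blast
  next
    case True
    have yA: "y A \<in> Q" and yC: "y C \<in> Q" using y ABC(1,2) by blast+
    have yz: "y ` label ` set u' \<subseteq> Q" if "set u' \<subseteq> set ?w" for u' using y that by blast
    have r: "recolour s A C y X = y X" if "X \<noteq> C" for X using that by (simp add: recolour_def)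
    have "same_walks y (recolour s A C y) tp (rev tp)"
      using True ne yA by (auto simp: same_walks_def tp top_strand_def recolour_def)
    moreover have "same_walks y (recolour s A C y) u u" "same_walks y (recolour s A C y) v v" "same_walks y (recolour s A C y) z z"
      by (rule same_walks_cong[OF yz]; use C r in force)+
    moreover have "same_walks y (recolour s A C y) (middle_strand sm A a C c) (rev (middle_strand sm A a C c))"
      unfolding s_def by (rule same_walks_middle[OF ne(1) yA yC sg(1,3)])
    moreover have "s = - sb * b" using rel by (simp add: s_def)
    then have "same_walks y (recolour s A C y) (bottom_strand sb B b C c) (rev (bottom_strand sb B b C c))"
      using same_walks_bottom[OF ne(2) yA yC True[symmetric] sg(2,4)] by simp
    ultimately have "same_walks y (recolour s A C y) ?w ?w'"
      using ms by (auto intro!: same_walks_append)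
    then show ?thesis using x unfolding same_walks_def by blast
  qed
  have PiE: "recolour t A C y \<in> label ` set ?w \<rightarrow>\<^sub>E Q" if y: "y \<in> label ` set ?w \<rightarrow>\<^sub>E Q" for t y
  proof (rule PiE_I)
    fix X assume "X \<in> label ` set ?w"
    then show "recolour t A C y X \<in> Q"
      using PiE_mem[OF y] ABC(1,2) act_closed by (simp only: recolour_def fun_upd_apply split: if_split) blast
  next
    fix X assume X: "X \<notin> label ` set ?w"
    then have "X \<noteq> C" using ABC(2) by blast
    then show "recolour t A C y X = undefined" using PiE_arb[OF y X] by (simp add: recolour_def)
  qed
  have img: "y ` label ` set ?w \<subseteq> Q" if "y \<in> label ` set ?w \<rightarrow>\<^sub>E Q" for y
    using PiE_mem[OF that] by blast
  have inv: "recolour (- t) A C (recolour t A C y) = y" if "t = 1 \<or> t = -1" "y \<in> label ` set ?w \<rightarrow>\<^sub>E Q" for t y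
    using act_inverse[OF that(1) PiE_mem[OF that(2) ABC(2)] PiE_mem[OF that(2) ABC(1)]] ne(1)
    by (simp add: recolour_def)
  have ms': "- s = 1 \<or> - s = -1" using s by auto
  show "bij_betw (\<lambda>(y, x). (recolour s A C y, x)) (path_colourings ?w) (path_colourings ?w')"
  proof (rule bij_betw_byWitness[where f' = "\<lambda>(y, x). (recolour (- s) A C y, x)"])
    show "\<forall>z\<in>path_colourings ?w. (case (case z of (y, x) \<Rightarrow> (recolour s A C y, x)) of (y, x) \<Rightarrow> (recolour (- s) A C y, x)) = z"
      using inv[OF s] by (auto simp: path_colourings_def simp del: set_append)
    show "\<forall>z\<in>path_colourings ?w'. (case (case z of (y, x) \<Rightarrow> (recolour (- s) A C y, x)) of (y, x) \<Rightarrow> (recolour s A C y, x)) = z"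
      using inv[OF ms'] unfolding path_colourings_def lab by (auto simp del: set_append)
    show "(\<lambda>(y, x). (recolour s A C y, x)) ` path_colourings ?w \<subseteq> path_colourings ?w'"
    proof
      fix k assume "k \<in> (\<lambda>(y, x). (recolour s A C y, x)) ` path_colourings ?w"
      then obtain y x where k: "k = (recolour s A C y, x)" and yx: "(y, x) \<in> path_colourings ?w" by auto
      then have y: "y \<in> label ` set ?w \<rightarrow>\<^sub>E Q" and x: "x \<in> Q" and p: "walk y ?w x x"
        unfolding path_colourings_def by blast+
      have "walk (recolour s A C y) ?w' x x" using walks[OF img[OF y] x] p by blast
      then show "k \<in> path_colourings ?w'" unfolding k path_colourings_def lab using PiE[OF y] x by blast
    qed
    show "(\<lambda>(y, x). (recolour (- s) A C y, x)) ` path_colourings ?w' \<subseteq> path_colourings ?w"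
    proof
      fix k assume "k \<in> (\<lambda>(y, x). (recolour (- s) A C y, x)) ` path_colourings ?w'"
      then obtain y x where k: "k = (recolour (- s) A C y, x)" and yx: "(y, x) \<in> path_colourings ?w'" by auto
      then have y: "y \<in> label ` set ?w \<rightarrow>\<^sub>E Q" and x: "x \<in> Q" and p: "walk y ?w' x x"
        unfolding path_colourings_def lab by blast+
      have "recolour s A C (recolour (- s) A C y) = y" using inv[OF ms' y] by simp
      then have "walk (recolour (- s) A C y) ?w x x" using walks[OF img[OF PiE[OF y]] x] p by metis
      then show "k \<in> path_colourings ?w" unfolding k path_colourings_def using PiE[OF y] x by blast
    qed
  qed
qed

end

section \<open>Locating the three strands of move III in the list\<close>

lemma length_swap_next [simp]: "length (swap_next w i) = length w"
  by (simp add: swap_next_def Let_def)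

lemma swap_next_append: "swap_next (u @ [x, y] @ v) (length u) = u @ [y, x] @ v"
  by (simp add: swap_next_def Let_def nth_append list_update_append)

lemma swap_next_nth:
  assumes "t < length w" "i < length w"
  shows "swap_next w i ! t = (if t = Suc i mod length w then w ! i else if t = i then w ! (Suc i mod length w) else w ! t)"
  using assms by (simp add: swap_next_def Let_def nth_list_update)

text \<open>The pairs of move III may wrap around the end of the list. Rotation brings the top pair
  to the front without changing the effect of the transpositions.\<close>

lemma swap_next_rotate:
  assumes m: "m < length w"
  shows "swap_next (rotate r w) m = rotate r (swap_next w ((r + m) mod length w))"
proof (rule nth_equalityI)
  let ?n = "length w"
  show "length (swap_next (rotate r w) m) = length (rotate r (swap_next w ((r + m) mod ?n)))" by simp
  fix t assume "t < length (swap_next (rotate r w) m)"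
  then have t: "t < ?n" by simp
  have n: "?n > 0" using m by linarith
  have inj1: "a = b" if "a \<le> b" "b < ?n" "(r + a) mod ?n = (r + b) mod ?n" for a b
  proof -
    have "?n dvd (r + b) - (r + a)"
      using mod_eq_dvd_iff_nat[of "r + a" "r + b" ?n] that(1,3) by simp
    then have "?n dvd b - a" by simp
    then have "b - a = 0" using that(2) by (metis dvd_imp_le le_less_trans diff_le_self not_less zero_less_iff_neq_zero)
    then show ?thesis using that(1) by simp
  qed
  have inj: "(r + a) mod ?n = (r + b) mod ?n \<longleftrightarrow> a = b" if "a < ?n" "b < ?n" for a b
    using inj1[of a b] inj1[of b a] that by (metis linorder_linear)
  have suc: "Suc ((r + m) mod ?n) mod ?n = (r + (Suc m mod ?n)) mod ?n"
    by (simp add: mod_Suc_eq mod_add_right_eq)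
  have Sm: "Suc m mod ?n < ?n" using n by simp
  show "swap_next (rotate r w) m ! t = rotate r (swap_next w ((r + m) mod ?n)) ! t"
    using t m n Sm inj[OF t m] inj[OF t Sm] by (simp add: swap_next_nth nth_rotate suc)
qed

lemma adjacent_at_rotate:
  assumes "m < length w"
  shows "adjacent_at (rotate r w) m k l \<longleftrightarrow> adjacent_at w ((r + m) mod length w) k l"
proof -
  let ?n = "length w"
  have n: "?n > 0" using assms by linarith
  have "Suc ((r + m) mod ?n) mod ?n = (r + (Suc m mod ?n)) mod ?n"
    by (simp add: mod_Suc_eq mod_add_right_eq)
  then show ?thesis using assms n by (simp add: adjacent_at_def nth_rotate)
qed

text \<open>The two orders of the last transpositions account for the middle strand preceding the
  bottom strand or following it.\<close>

lemma three_pairs_ordered: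
  assumes jk: "2 \<le> j" "Suc j < k" "Suc k < length w"
  obtains u v z where "w = [w ! 0, w ! 1] @ u @ [w ! j, w ! Suc j] @ v @ [w ! k, w ! Suc k] @ z"
    "swap_next (swap_next (swap_next w 0) j) k = [w ! 1, w ! 0] @ u @ [w ! Suc j, w ! j] @ v @ [w ! Suc k, w ! k] @ z"
    "swap_next (swap_next (swap_next w 0) k) j = [w ! 1, w ! 0] @ u @ [w ! Suc j, w ! j] @ v @ [w ! Suc k, w ! k] @ z"
proof -
  have pair: "drop i w = [w ! i, w ! Suc i] @ drop (i + 2) w" if "Suc i < length w" for i
    using that by (simp add: Cons_nth_drop_Suc)
  have split: "drop a w = take (b - a) (drop a w) @ drop b w" if "a \<le> b" for a b
    using append_take_drop_id[of "b - a" "drop a w"] that by simp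
  define u where "u = take (j - 2) (drop 2 w)"
  define v where "v = take (k - (j + 2)) (drop (j + 2) w)"
  define z where "z = drop (k + 2) w"
  have lu: "length u = j - 2" and lv: "length v = k - (j + 2)" using jk by (auto simp: u_def v_def)
  have "w = [w ! 0, w ! 1] @ drop 2 w" using pair[of 0] jk by (simp add: numeral_2_eq_2)
  also have "drop 2 w = u @ drop j w" unfolding u_def by (rule split) (use jk in simp)
  also have "drop j w = [w ! j, w ! Suc j] @ drop (j + 2) w" by (rule pair) (use jk in simp)
  also have "drop (j + 2) w = v @ drop k w" unfolding v_def by (rule split) (use jk in simp)
  also have "drop k w = [w ! k, w ! Suc k] @ z" unfolding z_def by (rule pair) (use jk in simp)
  finally have w: "w = [w ! 0, w ! 1] @ u @ [w ! j, w ! Suc j] @ v @ [w ! k, w ! Suc k] @ z" .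
  have main: "swap_next (swap_next (swap_next ([a, b] @ u @ [c, d] @ v @ [e, f] @ z) 0) j) k = [b, a] @ u @ [d, c] @ v @ [f, e] @ z \<and>
    swap_next (swap_next (swap_next ([a, b] @ u @ [c, d] @ v @ [e, f] @ z) 0) k) j = [b, a] @ u @ [d, c] @ v @ [f, e] @ z"
    for a b c d e f
  proof -
    have 1: "swap_next ([a, b] @ r) 0 = [b, a] @ r" for r
      using swap_next_append[of "[]" a b r] by simp
    have 2: "swap_next ([b, a] @ u @ [c, d] @ r) j = [b, a] @ u @ [d, c] @ r" for r
    proof -
      have "length ([b, a] @ u) = j" using lu jk by simp
      then show ?thesis using swap_next_append[of "[b, a] @ u" c d r] by simp
    qed
    have 3: "swap_next ([b, a] @ u @ [c', d'] @ v @ [e, f] @ z) k = [b, a] @ u @ [c', d'] @ v @ [f, e] @ z" for c' d'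
    proof -
      have "length ([b, a] @ u @ [c', d'] @ v) = k" using lu lv jk by simp
      then show ?thesis using swap_next_append[of "[b, a] @ u @ [c', d'] @ v" e f z] by simp
    qed
    show ?thesis by (simp only: 1 2 3)
  qed
  show thesis
    by (rule that[OF w])
      (subst w, simp only: main)+
qed

lemma strands_rev:
  assumes "{x, y} = {k, l}" "k \<noteq> l"
  shows "[x, y] = (if x = k then [k, l] else [l, k])" "[y, x] = rev [x, y]"
  using assms by (auto simp: doubleton_eq_iff)

lemma RIII_decompose:
  assumes adj: "adjacent_at w 0 (Over A a) (Over B b)" "adjacent_at w j (Under A a) (Over C c)"
      "adjacent_at w k (Under B b) (Under C c)"
    and ne: "distinct [A, B, C]"
  obtains u m1 v m2 z where "w = top_strand (if w ! 0 = Over A a then 1 else -1) A a B b @ u @ m1 @ v @ m2 @ z"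
    "swap_next (swap_next (swap_next w 0) j) k =
      rev (top_strand (if w ! 0 = Over A a then 1 else -1) A a B b) @ u @ rev m1 @ v @ rev m2 @ z"
    "m1 = middle_strand (if w ! j = Under A a then 1 else -1) A a C c \<and>
       m2 = bottom_strand (if w ! k = Under B b then 1 else -1) B b C c \<or>
     m1 = bottom_strand (if w ! k = Under B b then 1 else -1) B b C c \<and>
       m2 = middle_strand (if w ! j = Under A a then 1 else -1) A a C c"
proof -
  let ?n = "length w"
  have len: "0 < ?n" "j < ?n" "k < ?n" using adj by (simp_all add: adjacent_at_def)
  have T: "{w ! 0, w ! (Suc 0 mod ?n)} = {Over A a, Over B b}"
    and M: "{w ! j, w ! (Suc j mod ?n)} = {Under A a, Over C c}"
    and B: "{w ! k, w ! (Suc k mod ?n)} = {Under B b, Under C c}"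
    using adj by (simp_all add: adjacent_at_def)
  have "?n \<noteq> 1"
  proof
    assume "?n = 1"
    then have "Over A a = Over B b" using T by (auto simp: doubleton_eq_iff)
    then show False using ne by simp
  qed
  then have n2: "Suc 0 mod ?n = 1" using len by simp
  have T': "{w ! 0, w ! 1} = {Over A a, Over B b}" using T n2 by simp
  have disj: "w ! i \<notin> {Over A a, Over B b}" if "w ! i \<in> {Under A a, Over C c} \<or> w ! i \<in> {Under B b, Under C c}" for i
    using that ne by auto
  have disj': "w ! i \<notin> {Under B b, Under C c}" if "w ! i \<in> {Under A a, Over C c}" for i
    using that ne by auto
  have m0: "w ! j \<in> {Under A a, Over C c}" "w ! (Suc j mod ?n) \<in> {Under A a, Over C c}"
    and b0: "w ! k \<in> {Under B b, Under C c}" "w ! (Suc k mod ?n) \<in> {Under B b, Under C c}"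
    and t0: "w ! 0 \<in> {Over A a, Over B b}" "w ! 1 \<in> {Over A a, Over B b}"
    using M B T' by blast+
  \<comment> \<open>Positions 0 and 1 are occupied by the top pair, so the other pairs neither start
    there nor end at 0; in particular they do not wrap around.\<close>
  have "j \<noteq> 0" "j \<noteq> 1" "k \<noteq> 0" "k \<noteq> 1" "Suc j mod ?n \<noteq> 0" "Suc k mod ?n \<noteq> 0"
    using m0 b0 t0 disj by metis+
  then have j: "2 \<le> j" "Suc j < ?n" and k: "2 \<le> k" "Suc k < ?n"
    using len by (auto simp: mod_Suc split: if_splits)
  have M': "{w ! j, w ! Suc j} = {Under A a, Over C c}" and B': "{w ! k, w ! Suc k} = {Under B b, Under C c}"
    using M B j k by simp_all
  have "j \<noteq> k" "Suc j \<noteq> k" "j \<noteq> Suc k"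
    using M' B' disj' by (metis insertI1 insert_commute)+
  then have jk: "Suc j < k \<or> Suc k < j" by linarith
  have top: "[w ! 0, w ! 1] = top_strand (if w ! 0 = Over A a then 1 else -1) A a B b"
    using strands_rev(1)[OF T'] ne by (simp add: top_strand_def)
  have mid: "[w ! j, w ! Suc j] = middle_strand (if w ! j = Under A a then 1 else -1) A a C c"
    using strands_rev(1)[OF M'] by (simp add: middle_strand_def)
  have bot: "[w ! k, w ! Suc k] = bottom_strand (if w ! k = Under B b then 1 else -1) B b C c"
    using strands_rev(1)[OF B'] ne by (simp add: bottom_strand_def)
  have rv: "[y, x] = rev [x, y]" for x y :: "nat letter" by simp
  from jk show thesis
  proof
    assume "Suc j < k"
    then obtain u v z where
      "w = [w ! 0, w ! 1] @ u @ [w ! j, w ! Suc j] @ v @ [w ! k, w ! Suc k] @ z"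
      "swap_next (swap_next (swap_next w 0) j) k = [w ! 1, w ! 0] @ u @ [w ! Suc j, w ! j] @ v @ [w ! Suc k, w ! k] @ z"
      using three_pairs_ordered[OF j(1) _ k(2)] by metis
    then show thesis
      using that[of u _ v _ z] unfolding rv[of "w ! 1"] rv[of "w ! Suc j"] rv[of "w ! Suc k"] top mid bot by blast
  next
    assume "Suc k < j"
    then obtain u v z where
      "w = [w ! 0, w ! 1] @ u @ [w ! k, w ! Suc k] @ v @ [w ! j, w ! Suc j] @ z"
      "swap_next (swap_next (swap_next w 0) j) k = [w ! 1, w ! 0] @ u @ [w ! Suc k, w ! k] @ v @ [w ! Suc j, w ! j] @ z"
      using three_pairs_ordered[OF k(1) _ j(2)] by metis
    then show thesis
      using that[of u _ v _ z] unfolding rv[of "w ! 1"] rv[of "w ! Suc j"] rv[of "w ! Suc k"] top mid bot by blast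
  qed
qed

lemma gauss_code_rotate: "gauss_code w \<Longrightarrow> gauss_code (rotate r w)"
proof -
  assume w: "gauss_code w"
  have "mset (rotate r w) = mset w"
    by (metis append_take_drop_id mset_append add.commute rotate_drop_take)
  then have "mset (filter P (rotate r w)) = mset (filter P w)" for P :: "nat letter \<Rightarrow> bool"
    by (simp add: mset_filter)
  then show "gauss_code (rotate r w)" using w by (simp add: gauss_code_def)
qed

context quandle_target
begin

text \<open>Exchanging over and under turns the top into the bottom strand, so that the crossings \<open>C\<close>, \<open>B\<close>, \<open>A\<close>
  take the roles of \<open>A\<close>, \<open>B\<close>, \<open>C\<close>.\<close>

lemma card_path_RIII_swap:
  assumes ne: "distinct [A, B, C]" and sg: "a = 1 \<or> a = -1" "b = 1 \<or> b = -1" "c = 1 \<or> c = -1"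
      "st = 1 \<or> st = -1" "sm = 1 \<or> sm = -1" "sb = 1 \<or> sb = -1"
    and rel: "st * b = sm * c" and tp: "tp = top_strand st A a B b"
    and ms: "m1 = middle_strand sm A a C c \<and> m2 = bottom_strand sb B b C c \<or>
      m1 = bottom_strand sb B b C c \<and> m2 = middle_strand sm A a C c"
    and A: "A \<notin> label ` set (u @ v @ z)"
  shows "card (path_colourings (map swap_letter (tp @ u @ m1 @ v @ m2 @ z))) =
    card (path_colourings (map swap_letter (rev tp @ u @ rev m1 @ v @ rev m2 @ z)))"
proof -
  let ?S = "map swap_letter"
  have lab: "label ` set (?S w) = label ` set w" for w by (simp add: image_image)
  have AC: "A \<noteq> C" "A \<noteq> B" using ne by auto
  have sg': "- sm = 1 \<or> - sm = -1" "- st = 1 \<or> - st = -1" using sg by auto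
  have rel': "- sm * c = - st * b" using rel by simp
  have bs: "?S tp = bottom_strand (- st) B b A a" using swap_strands(1)[OF sg(4)] by (simp add: tp)
  from ms show ?thesis
  proof
    assume m: "m1 = middle_strand sm A a C c \<and> m2 = bottom_strand sb B b C c"
    have 1: "?S m2 = top_strand (- sb) C c B b" "?S m1 = middle_strand (- sm) C c A a"
      using m swap_strands[OF sg(6)] swap_strands[OF sg(5)] by auto
    \<comment> \<open>The former bottom strand \<open>?S m2\<close> is now the top strand, and the
      cyclic word is read starting from it.\<close>
    have "card (path_colourings (?S m2 @ ?S z @ ?S tp @ ?S u @ ?S m1 @ ?S v)) =
      card (path_colourings (rev (?S m2) @ ?S z @ rev (?S tp) @ ?S u @ rev (?S m1) @ ?S v))"
      by (rule card_path_RIII[OF AC sg(3,2) sg' rel' 1(1)])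
        (use 1 bs A lab in \<open>auto simp: image_Un\<close>)
    moreover have "card (path_colourings (?S (tp @ u @ m1 @ v @ m2 @ z))) =
        card (path_colourings (?S m2 @ ?S z @ ?S tp @ ?S u @ ?S m1 @ ?S v))"
      using card_path_append_commute[of "?S (tp @ u @ m1 @ v)" "?S (m2 @ z)"] by simp
    moreover have "card (path_colourings (?S (rev tp @ u @ rev m1 @ v @ rev m2 @ z))) =
        card (path_colourings (rev (?S m2) @ ?S z @ rev (?S tp) @ ?S u @ rev (?S m1) @ ?S v))"
      using card_path_append_commute[of "?S (rev tp @ u @ rev m1 @ v)" "?S (rev m2 @ z)"] by (simp add: rev_map)
    ultimately show ?thesis by simp
  next
    assume m: "m1 = bottom_strand sb B b C c \<and> m2 = middle_strand sm A a C c"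
    have 1: "?S m1 = top_strand (- sb) C c B b" "?S m2 = middle_strand (- sm) C c A a"
      using m swap_strands[OF sg(6)] swap_strands[OF sg(5)] by auto
    have "card (path_colourings (?S m1 @ ?S v @ ?S m2 @ ?S z @ ?S tp @ ?S u)) =
      card (path_colourings (rev (?S m1) @ ?S v @ rev (?S m2) @ ?S z @ rev (?S tp) @ ?S u))"
      by (rule card_path_RIII[OF AC sg(3,2) sg' rel' 1(1)])
        (use 1 bs A lab in \<open>auto simp: image_Un\<close>)
    moreover have "card (path_colourings (?S (tp @ u @ m1 @ v @ m2 @ z))) =
        card (path_colourings (?S m1 @ ?S v @ ?S m2 @ ?S z @ ?S tp @ ?S u))"
      using card_path_append_commute[of "?S (tp @ u)" "?S (m1 @ v @ m2 @ z)"] by simp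
    moreover have "card (path_colourings (?S (rev tp @ u @ rev m1 @ v @ rev m2 @ z))) =
        card (path_colourings (rev (?S m1) @ ?S v @ rev (?S m2) @ ?S z @ rev (?S tp) @ ?S u))"
      using card_path_append_commute[of "?S (rev tp @ u)" "?S (rev m1 @ v @ rev m2 @ z)"] by (simp add: rev_map)
    ultimately show ?thesis by simp
  qed
qed

lemma card_path_move_RIII:
  assumes w: "gauss_code w" and ne: "distinct [A, B, C]"
    and adj: "adjacent_at w i (Over A a) (Over B b)" "adjacent_at w j (Under A a) (Over C c)"
      "adjacent_at w k (Under B b) (Under C c)"
    and st: "st = (if w ! i = Over A a then 1 else -1)"
    and sm: "sm = (if w ! j = Under A a then 1 else -1)"
    and sb: "sb = (if w ! k = Under B b then 1 else -1)"
    and rel: "st * sm * a = st * sb * b" "st * sb * b = sm * sb * c"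
  shows "card (path_colourings w) = card (path_colourings (swap_next (swap_next (swap_next w i) j) k)) \<and>
    card (path_colourings (map swap_letter w)) =
      card (path_colourings (map swap_letter (swap_next (swap_next (swap_next w i) j) k)))"
proof -
  let ?n = "length w"
  have len: "i < ?n" "j < ?n" "k < ?n" using adj by (simp_all add: adjacent_at_def)
  define W where "W = rotate i w"
  \<comment> \<open>Adding \<open>?n\<close> first prevents truncated subtraction.\<close>
  define j' where "j' = (j + ?n - i) mod ?n"
  define k' where "k' = (k + ?n - i) mod ?n"
  have shift: "(i + 0) mod ?n = i" "(i + j') mod ?n = j" "(i + k') mod ?n = k"
    using len by (simp_all add: j'_def k'_def mod_add_right_eq)
  have lt: "0 < ?n" using len by linarith
  then have lt: "0 < ?n" "j' < ?n" "k' < ?n" by (simp_all add: j'_def k'_def)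
  have nths: "W ! 0 = w ! i" "W ! j' = w ! j" "W ! k' = w ! k"
    unfolding W_def using lt shift by (simp_all add: nth_rotate)
  have W2: "swap_next (swap_next (swap_next W 0) j') k' = rotate i (swap_next (swap_next (swap_next w i) j) k)"
    unfolding W_def using lt shift by (simp add: swap_next_rotate)
  have adjW: "adjacent_at W 0 (Over A a) (Over B b)" "adjacent_at W j' (Under A a) (Over C c)"
      "adjacent_at W k' (Under B b) (Under C c)"
    unfolding W_def using adj lt shift by (simp_all add: adjacent_at_rotate)
  have gW: "gauss_code W" unfolding W_def by (rule gauss_code_rotate[OF w])
  obtain u m1 v m2 z where dec: "W = top_strand st A a B b @ u @ m1 @ v @ m2 @ z"
    "swap_next (swap_next (swap_next W 0) j') k' = rev (top_strand st A a B b) @ u @ rev m1 @ v @ rev m2 @ z"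
    "m1 = middle_strand sm A a C c \<and> m2 = bottom_strand sb B b C c \<or>
     m1 = bottom_strand sb B b C c \<and> m2 = middle_strand sm A a C c"
    by (rule RIII_decompose[OF adjW ne, unfolded nths, folded st sm sb])
  have mem: "Over A a \<in> set W" "Over B b \<in> set W" "Over C c \<in> set W"
    "set (top_strand st A a B b @ m1 @ m2) = {Over A a, Under A a, Over B b, Under B b, Over C c, Under C c}"
    using dec(1,3) by (auto simp: set_strands)
  have sg: "a = 1 \<or> a = -1" "b = 1 \<or> b = -1" "c = 1 \<or> c = -1"
      "st = 1 \<or> st = -1" "sm = 1 \<or> sm = -1" "sb = 1 \<or> sb = -1"
    using gauss_code_sign[OF gW mem(1)] gauss_code_sign[OF gW mem(2)] gauss_code_sign[OF gW mem(3)] st sm sb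
    by simp_all
  have d: "distinct W" by (rule gauss_code_distinct[OF gW])
  have fresh: "X \<notin> label ` set (u @ v @ z)" if X: "X = A \<or> X = C" for X
  proof
    assume "X \<in> label ` set (u @ v @ z)"
    then obtain m where m: "m \<in> set (u @ v @ z)" "label m = X" by blast
    then have mW: "m \<in> set W" unfolding dec(1) by auto
    have "m = Over A a \<or> m = Under A a \<or> m = Over C c \<or> m = Under C c"
      using X gauss_code_fresh[OF gW mem(1) mW] gauss_code_fresh[OF gW mem(3) mW] m(2) by blast
    then have "m \<in> set (top_strand st A a B b @ m1 @ m2)" unfolding mem(4) by blast
    then show False using m(1) d unfolding dec(1) by auto
  qed
  \<comment> \<open>The sign condition consists of two equations: after cancelling a common sign,
    one serves the word itself and the other the word with over and under exchanged.\<close>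
  have r1: "sm * a = sb * b" using rel(1) sg(4) by auto
  have r2: "st * b = sm * c" using rel(2) sg(6) by auto
  have neAC: "C \<noteq> A" "C \<noteq> B" using ne by auto
  have "card (path_colourings W) = card (path_colourings (swap_next (swap_next (swap_next W 0) j') k'))"
    unfolding dec(2) by (subst dec(1), rule card_path_RIII[OF neAC sg(1,2,5,6) r1 refl dec(3) fresh]) simp
  moreover have "card (path_colourings (map swap_letter W)) =
      card (path_colourings (map swap_letter (swap_next (swap_next (swap_next W 0) j') k')))"
    unfolding dec(2) by (subst dec(1), rule card_path_RIII_swap[OF ne sg r2 refl dec(3) fresh]) simp
  ultimately show ?thesis
    unfolding W2 unfolding W_def by (simp add: card_path_rotate flip: rotate_map)
qed

section \<open>Invariance under all moves\<close>

lemma card_path_move: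
  assumes "move w w'"
  shows "card (path_colourings w) = card (path_colourings w') \<and>
    card (path_colourings (map swap_letter w)) = card (path_colourings (map swap_letter w'))"
  using assms
proof cases
  case rotate
  then show ?thesis by (simp add: card_path_rotate1 flip: rotate1_map)
next
  case (rename p)
  have "map swap_letter (map (map_letter p) w) = map (map_letter p) (map swap_letter w)"
  proof -
    have "swap_letter (map_letter p l) = map_letter p (swap_letter l)" for l :: "nat letter" by (cases l) auto
    then show ?thesis by simp
  qed
  moreover have "label ` set (map swap_letter w) = label ` set w" by (simp add: image_image)
  ultimately show ?thesis
    using rename card_path_rename[of p w] card_path_rename[of p "map swap_letter w"] by (simp del: map_map)
next
  case (RI_over_under u X e v)
  then show ?thesis
    using card_path_RI[of u "[Over X e, Under X e]" v X e] gauss_code_swap[of w]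
      card_path_RI[of "map swap_letter u" "[Under X e, Over X e]" "map swap_letter v" X e] by simp
next
  case (RI_under_over u X e v)
  then show ?thesis
    using card_path_RI[of u "[Under X e, Over X e]" v X e] gauss_code_swap[of w]
      card_path_RI[of "map swap_letter u" "[Over X e, Under X e]" "map swap_letter v" X e] by simp
next
  case (RII u p v q z X e Y)
  let ?S = "map swap_letter"
  have "mset (?S q) = image_mset swap_letter (mset q)" "mset (?S p) = image_mset swap_letter (mset p)" by simp_all
  then have m: "mset (?S q) = {#Over X e, Over Y (- e)#}" "mset (?S p) = {#Under X e, Under Y (- e)#}"
    using RII by (simp_all only: image_mset_add_mset image_mset_empty swap_letter.simps)
  \<comment> \<open>After the exchange the former underpasses are the overpasses and come second; a
    rotation brings them to the front, as \<open>card_path_RII\<close> requires.\<close>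
  have "gauss_code (rotate (length (u @ p @ v)) (u @ p @ v @ q @ z))"
    using RII by (intro gauss_code_rotate) simp
  then have "gauss_code (q @ z @ u @ p @ v)" using rotate_append[of "u @ p @ v" "q @ z"] by simp
  from gauss_code_swap[OF this] have "gauss_code ([] @ ?S q @ ?S (z @ u) @ ?S p @ ?S v)" by simp
  from card_path_RII[OF this m] have "card (path_colourings (?S (q @ z @ u @ p @ v))) = card (path_colourings (?S (z @ u @ v)))"
    by simp
  moreover have "card (path_colourings (?S (u @ p @ v @ q @ z))) = card (path_colourings (?S (q @ z @ u @ p @ v)))"
    using card_path_append_commute[of "?S (u @ p @ v)" "?S (q @ z)"] by simp
  moreover have "card (path_colourings (?S (z @ u @ v))) = card (path_colourings (?S (u @ v @ z)))"
    using card_path_append_commute[of "?S z" "?S (u @ v)"] by simp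
  ultimately show ?thesis using RII card_path_RII[of u p v q z X e Y] by simp
next
  case (RIII A B C i a b j c k st sm sb)
  then show ?thesis using card_path_move_RIII[of w A B C i a b j c k st sm sb] by blast
qed

lemma card_path_isotopy:
  assumes "equivclp move w w'"
  shows "card (path_colourings w) = card (path_colourings w') \<and>
    card (path_colourings (map swap_letter w)) = card (path_colourings (map swap_letter w'))"
  using assms
proof (induction rule: equivclp_induct)
  case (step y z)
  then show ?case using card_path_move[of y z] card_path_move[of z y] by auto
qed simp

end

section \<open>Mirror images and the comparison on a realizable code\<close>

lemma plane_det_cnj: "plane_det (cnj a) (cnj b) = plane_det b a"
  by (simp add: plane_det_def)

text \<open>Both the reflection and the exchange of over and under reverse the crossing signs.\<close>

lemma mirror_diagram:
  assumes kd: "knot_diagram f Ov" and gc: "gauss_code_of f Ov w"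
  shows "knot_diagram (cnj \<circ> f) (double_params f - Ov)"
    and "gauss_code_of (cnj \<circ> f) (double_params f - Ov) (map swap_letter w)"
proof -
  have g: "generic_closed_curve f" using kd by (simp add: knot_diagram_def)
  interpret generic_curve f by unfold_locales (rule g)
  have der: "((cnj \<circ> f) has_vector_derivative cnj (velocity f t)) (at t)" for t
    using has_vector_derivative_cnj[OF f_deriv[of t]] by (simp add: o_def)
  have vel: "velocity (cnj \<circ> f) t = cnj (velocity f t)" for t
    unfolding velocity_def[of "cnj \<circ> f"] by (rule vector_derivative_at[OF der])
  have dp: "double_params (cnj \<circ> f) = double_params f" by (simp add: double_params_def)
  have C1: "(cnj \<circ> f) C1_differentiable_on UNIV"
    unfolding C1_differentiable_on_def using der velocity_continuous
    by (intro exI[of _ "\<lambda>t. cnj (velocity f t)"]) (auto intro: continuous_on_cnj)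
  have trans: "plane_det (velocity f t) (velocity f s) \<noteq> 0" if "s \<in> {0..<1}" "t \<in> {0..<1}" "s \<noteq> t" "f s = f t" for s t
    using g that unfolding generic_closed_curve_def by metis
  have g': "generic_closed_curve (cnj \<circ> f)"
    using g C1 trans unfolding generic_closed_curve_def dp vel plane_det_cnj by simp
  have ov: "s \<in> Ov \<longleftrightarrow> t \<notin> Ov" if "s \<in> {0..<1}" "t \<in> {0..<1}" "s \<noteq> t" "f s = f t" for s t
    using kd that unfolding knot_diagram_def by blast
  have dd: "s \<in> double_params f" if "s \<in> {0..<1}" "t \<in> {0..<1}" "s \<noteq> t" "f s = f t" for s t
    using that unfolding double_params_def by auto
  show "knot_diagram (cnj \<circ> f) (double_params f - Ov)"
    unfolding knot_diagram_def dp
  proof (intro conjI ballI impI g')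
    show "double_params f - Ov \<subseteq> double_params f" by blast
    fix s t assume st: "s \<in> {0..<1}" "t \<in> {0..<1}" "s \<noteq> t \<and> (cnj \<circ> f) s = (cnj \<circ> f) t"
    then have "s \<noteq> t" "f s = f t" by simp_all
    then show "s \<in> double_params f - Ov \<longleftrightarrow> t \<notin> double_params f - Ov"
      using ov[OF st(1,2)] dd[OF st(1,2)] dd[OF st(2,1)] by auto
  qed
  define ts where "ts = sorted_list_of_set (double_params f)"
  have fin: "finite (double_params f)" using g by (simp add: generic_closed_curve_def)
  note c = gc[unfolded gauss_code_of_def Let_def, folded ts_def]
  have lw: "length w = length ts" using c by blast
  have mem: "ts ! i \<in> double_params f" if "i < length w" for i
    using that lw fin nth_mem[of i ts] by (simp add: ts_def)
  show "gauss_code_of (cnj \<circ> f) (double_params f - Ov) (map swap_letter w)"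
    unfolding gauss_code_of_def Let_def dp ts_def[symmetric]
  proof (intro conjI allI impI)
    show "length (map swap_letter w) = length ts" using lw by simp
    show "is_over (map swap_letter w ! i) \<longleftrightarrow> ts ! i \<in> double_params f - Ov" if "i < length (map swap_letter w)" for i
      using c that mem by (simp add: is_over_swap)
    show "label (map swap_letter w ! i) = label (map swap_letter w ! j) \<longleftrightarrow> (cnj \<circ> f) (ts ! i) = (cnj \<circ> f) (ts ! j)"
      if "i < length (map swap_letter w)" "j < length (map swap_letter w)" for i j
      using c that by simp
    fix i j assume ij: "i < length (map swap_letter w)" "j < length (map swap_letter w)"
      and e: "(cnj \<circ> f) (ts ! i) = (cnj \<circ> f) (ts ! j) \<and> ts ! i \<in> double_params f - Ov \<and> ts ! j \<notin> double_params f - Ov"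
    then have i: "i < length w" and j: "j < length w" and ff: "f (ts ! j) = f (ts ! i)"
      and o: "ts ! j \<in> Ov" "ts ! i \<notin> Ov"
      using mem[of j] by auto
    have "real_of_int (lsign (w ! j)) = sgn (plane_det (velocity f (ts ! j)) (velocity f (ts ! i))) \<and>
            lsign (w ! i) = lsign (w ! j)"
      using c[THEN conjunct2, THEN conjunct2, THEN conjunct2] i j ff o by blast
    then show "real_of_int (lsign (map swap_letter w ! i)) =
        sgn (plane_det (velocity (cnj \<circ> f) (ts ! i)) (velocity (cnj \<circ> f) (ts ! j)))"
      "lsign (map swap_letter w ! j) = lsign (map swap_letter w ! i)"
      using i j by (simp_all add: vel plane_det_cnj)
  qed
qed

lemma card_colourings_realizable_le:
  assumes T: "quandle T" "finite (qcarrier T)" and w: "gauss_code w"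
    and d: "knot_diagram f Ov" "gauss_code_of f Ov w"
  shows "card (colourings T w) \<le> card (colourings T (map swap_letter w))"
proof (cases "w = []")
  case False
  have "generic_closed_curve f" using d(1) by (simp add: knot_diagram_def)
  then interpret coded_diagram f T Ov w
    using T(1) w d False by unfold_locales
  show ?thesis by (rule card_colourings_swap_le[OF T(2)])
qed simp

theorem card_colourings_realizable:
  assumes T: "quandle T" "finite (qcarrier T)" and w: "gauss_code w" "realizable w"
  shows "card (colourings T w) = card (colourings T (map swap_letter w))"
proof -
  obtain f Ov where d: "knot_diagram f Ov" "gauss_code_of f Ov w" using w(2) unfolding realizable_def by blast
  show ?thesis
    using card_colourings_realizable_le[OF T w(1) d]
      card_colourings_realizable_le[OF T gauss_code_swap[OF w(1)] mirror_diagram[OF d]]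
    by (simp del: map_map)
qed

theorem theorem3:
  fixes K :: "code set" and T :: "'b quandle_struct" and w :: code
  assumes "K \<in> virtual_knots"
    and "classical K"
    and "finite_quandle T"
    and "w \<in> K"
  shows "QD T w = 0"
proof -
  have T: "quandle T" "finite (qcarrier T)" using assms(3) by (simp_all add: finite_quandle_def)
  interpret quandle_target T by unfold_locales (rule T(1))
  obtain w0 where w0: "w0 \<in> K" "realizable w0" using assms(2) unfolding classical_def by blast
  obtain v where K: "K = virtual_isotopy `` {v}" using assms(1) unfolding virtual_knots_def by (rule quotientE)
  have vw: "(v, w) \<in> virtual_isotopy" "(v, w0) \<in> virtual_isotopy" using assms(4) w0(1) K by auto
  then have g: "gauss_code w" "gauss_code w0" and "equivclp move v w" "equivclp move v w0"
    by (simp_all add: virtual_isotopy_def)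
  then have "card (path_colourings w) = card (path_colourings w0)"
    "card (path_colourings (map swap_letter w)) = card (path_colourings (map swap_letter w0))"
    using card_path_isotopy by metis+
  then have "card (colourings T w) = card (colourings T (map swap_letter w))"
    using card_colourings_path g gauss_code_swap card_colourings_realizable[OF T g(2) w0(2)] by metis
  then show ?thesis by (simp add: QD_def lower_quandle_def card_Hom_upper)
qed

end
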